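(* For integers $p,q\ge1$, the Möbius function $\mu_{NC^{(B)}(p,q)}$ of the poset $NC^{(B)}(p,q)$, with minimal element $\widehat{0}$ and maximal element $\widehat{1}$, satisfies $$\mu_{NC^{(B)}(p,q)}(\widehat{0},\widehat{1}) = (-1)^{p+q}\left(\binom{2p-1}{p}\binom{2q-1}{q}+\sum_{c=1}^p2c\binom{2p-c-1}{p-1}\binom{2q+c-1}{q-1}\right).$$
   Context: Let $p,q$ be positive integers and $N = p+q$. The hyperoctahedral group $B_N$ is the group of permutations $\tau$ of $\{\pm 1,\ldots,\pm N\}$ with $\tau(-i) = -\tau(i)$ for $1\le i\le N$. It is generated by the set consisting of the elements $(i,j)(-i,-j)$ and $(i,-j)(-i,j)$ for $1\le i,j\le N$, $i\neq j$, and the elements $(i,-i)$ for $1\le i\le N$. For $\tau\in B_N$, let $\ell_B(\tau)$ be the smallest $k\ge 0$ such that $\tau$ is a product of $k$ of these generators (the empty product being the identity). The partial order on $B_N$ is: $\tau\le\sigma$ if and only if $\ell_B(\sigma)=\ell_B(\tau)+\ell_B(\tau^{-1}\sigma)$. Let $\gamma_{p,q}\in B_N$ be the permutation with two cycles $$\gamma_{p,q} = (1,\ldots,p,-1,\ldots,-p)\,(p+1,\ldots,p+q,-(p+1),\ldots,-(p+q)),$$ and let $\mathcal{S}^{(B)}_{nc}(p,q) = \{\tau\in B_N \mid \tau\le\gamma_{p,q}\}$. For $\tau\in B_N$, let $\Omega(\tau)$ be the partition of $\{\pm1,\ldots,\pm N\}$ into orbits of $\tau$, and let $\widetilde{\Omega}(\tau)$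 be the partition obtained from $\Omega(\tau)$ by merging all inversion-invariant blocks (blocks $A$ with $A=-A$), if any exist, into one single block. Define $NC^{(B)}(p,q) = \{\widetilde{\Omega}(\tau)\mid \tau\in \mathcal{S}^{(B)}_{nc}(p,q)\}$, partially ordered by $\pi\le\rho$ if and only if every block of $\pi$ is contained in a block of $\rho$. Its minimal element $\widehat{0}$ is the partition into $2(p+q)$ singletons and its maximal element $\widehat{1}$ is the partition with only one block. *)

theory Defs
  imports
    "HOL-Combinatorics.Orbits"
    "HOL-Combinatorics.Cycles"
    "HOL-Library.Disjoint_Sets"
begin

section \<open>The Moebius function of a finite poset\<close>

text \<open>
  The poset has carrier \<open>P\<close> and order relation \<open>r\<close>. The test that \<open>P\<close> is finite and partially
  ordered by \<open>r\<close> is there for termination.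
\<close>

function moebius :: "'a set \<Rightarrow> 'a rel \<Rightarrow> 'a \<Rightarrow> 'a \<Rightarrow> int" where
  "moebius P r x y =
    (if finite P \<and> partial_order_on P r \<and> x \<in> P \<and> y \<in> P \<and> (x, y) \<in> r
     then (if x = y then 1
           else - (\<Sum>z \<in> {z \<in> P. (x, z) \<in> r \<and> (z, y) \<in> r \<and> z \<noteq> y}. moebius P r x z))
     else 0)"
  by pat_completeness auto
termination
proof (relation "measure (\<lambda>(P, r, x, y). card {z \<in> P. (z, y) \<in> r})", goal_cases)
  case (2 P r x y z)
  then have fin: "finite P" and po: "partial_order_on P r" and y: "y \<in> P"
    and z: "(z, y) \<in> r" "z \<noteq> y" by auto
  from po have tr: "trans r" and anti: "antisym r" and rfl: "refl_on P r"
    by (auto simp: partial_order_on_def preorder_on_def)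
  have "{w \<in> P. (w, z) \<in> r} \<subseteq> {w \<in> P. (w, y) \<in> r}"
    using tr z by (auto dest: transD)
  moreover have "y \<in> {w \<in> P. (w, y) \<in> r}" "y \<notin> {w \<in> P. (w, z) \<in> r}"
    using rfl y z anti by (auto simp: refl_on_def dest: antisymD)
  ultimately have "{w \<in> P. (w, z) \<in> r} \<subset> {w \<in> P. (w, y) \<in> r}" by blast
  then show ?case using fin by (simp add: psubset_card_mono)
qed auto

declare moebius.simps [simp del]


section \<open>The hyperoctahedral group\<close>

definition pm_set :: "nat \<Rightarrow> int set" where
  "pm_set N = {- int N .. int N} - {0}"

text \<open>
  Elements of the group are functions on all integers that fix everything outside
  \<open>{\<plusminus>1, \<dots>, \<plusminus>N}\<close>; the product is \<open>\<circ>\<close>.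
\<close>

definition hyperoctahedral :: "nat \<Rightarrow> (int \<Rightarrow> int) set" where
  "hyperoctahedral N = {\<tau>. \<tau> permutes pm_set N \<and> (\<forall>i\<in>{1..int N}. \<tau> (- i) = - \<tau> i)}"

definition gens_B :: "nat \<Rightarrow> (int \<Rightarrow> int) set" where
  "gens_B N =
     {transpose i j \<circ> transpose (- i) (- j) | i j. i \<in> {1..int N} \<and> j \<in> {1..int N} \<and> i \<noteq> j} \<union>
     {transpose i (- j) \<circ> transpose (- i) j | i j. i \<in> {1..int N} \<and> j \<in> {1..int N} \<and> i \<noteq> j} \<union>
     {transpose i (- i) | i. i \<in> {1..int N}}"

definition length_B :: "nat \<Rightarrow> (int \<Rightarrow> int) \<Rightarrow> nat" where
  "length_B N \<tau> = (LEAST k. \<exists>ts. length ts = k \<and> set ts \<subseteq> gens_B N \<and> foldr (\<circ>) ts id = \<tau>)"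

definition le_B :: "nat \<Rightarrow> (int \<Rightarrow> int) \<Rightarrow> (int \<Rightarrow> int) \<Rightarrow> bool" where
  "le_B N \<tau> \<sigma> \<longleftrightarrow> length_B N \<sigma> = length_B N \<tau> + length_B N (inv \<tau> \<circ> \<sigma>)"

definition gamma_B :: "nat \<Rightarrow> nat \<Rightarrow> int \<Rightarrow> int" where
  "gamma_B p q =
     cycle_of_list ([1..int p] @ map uminus [1..int p]) \<circ>
     cycle_of_list ([int p + 1..int p + int q] @ map uminus [int p + 1..int p + int q])"

definition S_nc_B :: "nat \<Rightarrow> nat \<Rightarrow> (int \<Rightarrow> int) set" where
  "S_nc_B p q = {\<tau> \<in> hyperoctahedral (p + q). le_B (p + q) \<tau> (gamma_B p q)}"


section \<open>Annular noncrossing partitions of type B\<close>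

definition Orb :: "nat \<Rightarrow> (int \<Rightarrow> int) \<Rightarrow> int set set" where
  "Orb N \<tau> = orbit \<tau> ` pm_set N"

definition inv_blocks :: "int set set \<Rightarrow> int set set" where
  "inv_blocks \<pi> = {A \<in> \<pi>. uminus ` A = A}"

definition Orb_merged :: "nat \<Rightarrow> (int \<Rightarrow> int) \<Rightarrow> int set set" where
  "Orb_merged N \<tau> =
     (let \<pi> = Orb N \<tau>; Z = inv_blocks \<pi>
      in if Z = {} then \<pi> else insert (\<Union>Z) (\<pi> - Z))"

definition NC_B :: "nat \<Rightarrow> nat \<Rightarrow> int set set set" where
  "NC_B p q = Orb_merged (p + q) ` S_nc_B p q"

definition NC_B_rel :: "nat \<Rightarrow> nat \<Rightarrow> int set set rel" where
  "NC_B_rel p q = {(\<pi>, \<rho>). \<pi> \<in> NC_B p q \<and> \<rho> \<in> NC_B p q \<and> refines (pm_set (p + q)) \<pi> \<rho>}"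

definition zero_B :: "nat \<Rightarrow> int set set" where
  "zero_B N = (\<lambda>i. {i}) ` pm_set N"

definition one_B :: "nat \<Rightarrow> int set set" where
  "one_B N = {pm_set N}"


section \<open>\<open>NC_B p q\<close> is a finite poset\<close>

lemma finite_pm_set: "finite (pm_set N)"
  by (simp add: pm_set_def)

lemma partition_on_Orb:
  assumes "\<tau> permutes pm_set N"
  shows "partition_on (pm_set N) (Orb N \<tau>)"
proof -
  have perm: "permutation \<tau>"
    using assms finite_pm_set permutation_permutes by blast
  have self: "x \<in> orbit \<tau> x" for x
    using perm by (rule permutation_self_in_orbit)
  have sub: "orbit \<tau> x \<subseteq> pm_set N" if "x \<in> pm_set N" for x
    using permutes_orbit_subset[OF assms that] .
  have eq: "orbit \<tau> x = orbit \<tau> y" if "z \<in> orbit \<tau> x" "z \<in> orbit \<tau> y" for x y z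
    using orbit_cyclic_eq3[OF cyclic_on_orbit[OF assms finite_pm_set] that(1)]
      orbit_cyclic_eq3[OF cyclic_on_orbit[OF assms finite_pm_set] that(2)] by simp
  show ?thesis
  proof (rule partition_onI)
    show "\<Union> (Orb N \<tau>) = pm_set N"
      using self sub by (auto simp: Orb_def)
    show "disjnt A B" if A: "A \<in> Orb N \<tau>" and B: "B \<in> Orb N \<tau>" and ne: "A \<noteq> B" for A B
    proof -
      obtain x y where "A = orbit \<tau> x" "B = orbit \<tau> y"
        using A B by (auto simp: Orb_def)
      then show ?thesis using eq ne by (metis disjnt_iff)
    qed
    show "{} \<notin> Orb N \<tau>"
      using self by (auto simp: Orb_def)
  qed
qed

lemma partition_on_Orb_merged:
  assumes "\<tau> permutes pm_set N"
  shows "partition_on (pm_set N) (Orb_merged N \<tau>)"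
proof -
  have P: "partition_on (pm_set N) (Orb N \<tau>)" by (rule partition_on_Orb[OF assms])
  have Z: "inv_blocks (Orb N \<tau>) \<subseteq> Orb N \<tau>" by (auto simp: inv_blocks_def)
  have "partition_on (pm_set N) (insert (\<Union>Z) (Orb N \<tau> - Z))" if "Z \<subseteq> Orb N \<tau>" "Z \<noteq> {}" for Z
  proof (rule partition_onI)
    show "\<Union> (insert (\<Union> Z) (Orb N \<tau> - Z)) = pm_set N"
    proof -
      have "\<Union> (insert (\<Union> Z) (Orb N \<tau> - Z)) = \<Union> (Orb N \<tau>)"
        using that(1) by blast
      then show ?thesis using P by (simp add: partition_on_def)
    qed
    show "disjnt A B" if "A \<in> insert (\<Union> Z) (Orb N \<tau> - Z)" "B \<in> insert (\<Union> Z) (Orb N \<tau> - Z)"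
        "A \<noteq> B" for A B
    proof -
      have dj: "disjnt C D" if "C \<in> Orb N \<tau>" "D \<in> Orb N \<tau>" "C \<noteq> D" for C D
        using P that by (auto simp: partition_on_def pairwise_def)
      have Zdj: "disjnt (\<Union>Z) C" if "C \<in> Orb N \<tau> - Z" for C
        unfolding disjnt_Union1
      proof
        fix D assume "D \<in> Z"
        with that \<open>Z \<subseteq> Orb N \<tau>\<close> show "disjnt D C" by (intro dj) auto
      qed
      from that show ?thesis
        by (elim insertE) (use Zdj dj in \<open>auto intro: disjnt_sym simp del: disjnt_Union1 disjnt_Union2\<close>)
    qed
    show "{} \<notin> insert (\<Union>Z) (Orb N \<tau> - Z)"
    proof -
      have ne: "{} \<notin> Orb N \<tau>" using P by (simp add: partition_on_def)
      obtain A where "A \<in> Z" using \<open>Z \<noteq> {}\<close> by blast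
      with ne \<open>Z \<subseteq> Orb N \<tau>\<close> have "\<Union>Z \<noteq> {}" by (metis Union_empty_conv subsetD)
      with ne show ?thesis by simp
    qed
  qed
  then show ?thesis
    using P Z by (simp add: Orb_merged_def Let_def)
qed

lemma partition_on_NC_B: "\<pi> \<in> NC_B p q \<Longrightarrow> partition_on (pm_set (p + q)) \<pi>"
  by (auto simp: NC_B_def S_nc_B_def hyperoctahedral_def intro!: partition_on_Orb_merged)

lemma finite_NC_B: "finite (NC_B p q)"
proof -
  have "finite {\<tau>. \<tau> permutes pm_set (p + q)}"
    using finite_permutations[OF finite_pm_set] .
  then show ?thesis
    unfolding NC_B_def
    by (rule finite_imageI[OF finite_subset, rotated]) (auto simp: S_nc_B_def hyperoctahedral_def)
qed

lemma partial_order_on_NC_B: "partial_order_on (NC_B p q) (NC_B_rel p q)"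
  unfolding partial_order_on_def preorder_on_def
proof (intro conjI)
  show "NC_B_rel p q \<subseteq> NC_B p q \<times> NC_B p q"
    by (auto simp: NC_B_rel_def)
  show "refl_on (NC_B p q) (NC_B_rel p q)"
    by (simp add: NC_B_rel_def refl_on_def refines_refl partition_on_NC_B)
  show "trans (NC_B_rel p q)"
    unfolding NC_B_rel_def trans_def by (blast intro: refines_trans)
  show "antisym (NC_B_rel p q)"
    by (rule antisymI) (simp add: NC_B_rel_def, metis refines_asym)
qed

end

theory Submission
  imports Defs "HOL-Library.Numeral_Type" "HOL-Computational_Algebra.Formal_Power_Series"
begin

text \<open>
  The noncrossing partitions in question are the elements of an interval of the hyperoctahedral group
  in disguise, and the Moebius function of that interval is computed from a recursion over the
  reflections that move one point.

  Reflection length is codimension: let the group act on the odd vectors indexed by the signed integers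
  \<open>\<plusminus>1, \<dots>, \<plusminus>N\<close>, and let \<open>Fix N w\<close> be the space of vectors fixed by \<open>w\<close>. If the reflection \<open>t\<close> fixes all of
  \<open>Fix N w\<close>, then the fixed space of \<open>w \<circ> t\<close> is larger by one dimension; otherwise it is smaller by one
  dimension (\<open>Fix_comp_srefl_linked\<close>, \<open>Fix_comp_srefl_not_linked\<close>). Therefore \<open>length_B N w\<close> is the
  codimension of \<open>Fix N w\<close> (\<open>card_Fix_length_B\<close>). The scalars are the integers modulo 3, so that dimensions are read off
  from cardinalities of finite sets.

  The partition \<open>Orb_merged N w\<close> and the space \<open>Fix N w\<close> determine each other: two points are in one block if and
  only if no fixed vector distinguishes them (\<open>Orb_merged_linked\<close>), and refinement of partitions is reverse
  inclusion of fixed spaces (\<open>refines_Orb_merged_iff\<close>). Among the elements below a common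
  upper bound, reverse inclusion of fixed spaces is the absolute order
  (\<open>le_B_Fix_subset\<close>, \<open>Fix_subset_imp_le_B\<close>). So the poset of partitions is isomorphic to the interval
  between \<open>id\<close> and \<open>gamma_B p q\<close>, and the wanted number is \<open>mu (p + q) (gamma_B p q)\<close>, where \<open>mu N\<close> is the
  Moebius function of the group under the absolute order, with first argument \<open>id\<close>
  (\<open>moebius_NC_B_eq_mu\<close>).

  For a point \<open>k\<close> moved by \<open>w\<close>, the number \<open>mu N w\<close> is minus the sum of \<open>mu N (w \<circ> t)\<close> over the
  reflections \<open>t\<close> below \<open>w\<close> that move \<open>k\<close> (\<open>mu_strip\<close>). On cycles, such a product \<open>w \<circ> t\<close> is easily described: the
  reflection cuts the cycle through \<open>k\<close>, or changes its sign, or joins two negative cycles to a positive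
  one. A positive cycle of length \<open>m\<close> contributes the factor \<open>(- 1) ^ (m - 1)\<close> times the Catalan number
  with index \<open>m - 1\<close> (\<open>mu_comp_cyc\<close>), and two negative cycles of lengths \<open>p\<close> and \<open>q\<close> contribute
  \<open>(- 1) ^ (p + q)\<close> times a number subject to the recursion \<open>annulus_count_Suc\<close>
  (\<open>mu_ncyc_ncyc\<close>). Its solution has two parts. The product of binomial coefficients comes
  from resolving the two cycles separately; the sum accounts for the \<open>2 * q\<close> ways of joining them, convolved with
  central binomial coefficients, and is brought to the stated form by
  a telescoping identity (\<open>join_count_eq\<close>).
\<close>

section \<open>Integers modulo three\<close>

lemma mod3_cases: "(x::3) = 0 \<or> x = 1 \<or> x = -1"
proof (cases x rule: bit1_cases)
  case (of_int z)
  then have "z = 0 \<or> z = 1 \<or> z = 2" by auto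
  then show ?thesis using of_int(1) by auto
qed

lemma mod3_add_self: "(x::3) + x = - x"
  using mod3_cases[of x] by auto

lemma mod3_mult_self: "(x::3) \<noteq> 0 \<Longrightarrow> x * x = 1"
  using mod3_cases[of x] by auto

lemma mod3_mult_eq_0: "(x::3) * y = 0 \<longleftrightarrow> x = 0 \<or> y = 0"
  using mod3_cases[of x] mod3_cases[of y] by auto

lemma mod3_eq_uminus: "(x::3) = - x \<longleftrightarrow> x = 0"
  using mod3_cases[of x] by auto

section \<open>Signed permutations\<close>

lemma pm_set_uminus_iff [simp]: "- i \<in> pm_set N \<longleftrightarrow> i \<in> pm_set N"
  by (auto simp: pm_set_def)

lemma pm_set_nonzero: "i \<in> pm_set N \<Longrightarrow> i \<noteq> 0"
  by (auto simp: pm_set_def)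

lemma hyperoctahedral_iff:
  "w \<in> hyperoctahedral N \<longleftrightarrow> w permutes pm_set N \<and> (\<forall>i. w (- i) = - w i)"
proof
  assume w: "w \<in> hyperoctahedral N"
  then have p: "w permutes pm_set N" by (simp add: hyperoctahedral_def)
  have "w (- i) = - w i" for i
  proof (cases "i \<in> pm_set N")
    case False
    then show ?thesis using p by (metis permutes_not_in pm_set_uminus_iff)
  next
    case True
    then have "i \<in> {1..int N} \<or> - i \<in> {1..int N}" by (auto simp: pm_set_def)
    moreover have neg: "w (- j) = - w j" if "j \<in> {1..int N}" for j
      using w that by (simp add: hyperoctahedral_def)
    ultimately show ?thesis
      using neg[of i] neg[of "- i"] by auto
  qed
  with p show "w permutes pm_set N \<and> (\<forall>i. w (- i) = - w i)" by blast
qed (auto simp: hyperoctahedral_def)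

lemma hyperoctahedralD:
  assumes "w \<in> hyperoctahedral N"
  shows "w permutes pm_set N" "w (- i) = - w i" "bij w" "inj w" "w i \<in> pm_set N \<longleftrightarrow> i \<in> pm_set N"
  using assms permutes_bij permutes_inj permutes_in_image by (force simp: hyperoctahedral_iff)+

lemma id_in_hyperoctahedral [simp]: "id \<in> hyperoctahedral N"
  by (simp add: hyperoctahedral_iff permutes_id)

lemma comp_in_hyperoctahedral [intro]:
  "u \<in> hyperoctahedral N \<Longrightarrow> v \<in> hyperoctahedral N \<Longrightarrow> u \<circ> v \<in> hyperoctahedral N"
  by (simp add: hyperoctahedral_iff permutes_compose)

lemma inv_in_hyperoctahedral [intro]:
  assumes "w \<in> hyperoctahedral N" shows "inv w \<in> hyperoctahedral N"
proof -
  note w = hyperoctahedralD[OF assms]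
  have "inv w (- i) = - inv w i" for i
    using w(2,3) by (metis bij_inv_eq_iff)
  then show ?thesis using permutes_inv[OF w(1)] by (simp add: hyperoctahedral_iff)
qed

lemma comp_inv_hyperoctahedral [simp]:
  assumes "w \<in> hyperoctahedral N"
  shows "w \<circ> inv w = id" "inv w \<circ> w = id" "inv (inv w) = w" "w (inv w i) = i" "inv w (w i) = i"
  using hyperoctahedralD[OF assms]
  by (auto simp: bij_is_surj surj_iff inv_o_cancel inv_inv_eq bij_is_inj surj_f_inv_f)

lemma inv_comp_hyperoctahedral:
  "u \<in> hyperoctahedral N \<Longrightarrow> v \<in> hyperoctahedral N \<Longrightarrow> inv (u \<circ> v) = inv v \<circ> inv u"
  by (simp add: hyperoctahedralD(3) o_inv_distrib)

lemma finite_hyperoctahedral: "finite (hyperoctahedral N)"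
  by (rule finite_subset[OF _ finite_permutations[OF finite_pm_set]]) (auto simp: hyperoctahedral_def)

section \<open>Reflections\<close>

text \<open>
  One formula covers all reflections: for \<open>b \<noteq> - a\<close> this is the product of the two transpositions
  exchanging \<open>a\<close> with \<open>b\<close> and \<open>- a\<close> with \<open>- b\<close>, and for \<open>b = - a\<close> it is the transposition of \<open>a\<close>
  and \<open>- a\<close>. Allowing every pair \<open>a\<close>, \<open>b\<close> of signed indices removes case distinctions later on.
\<close>

definition srefl :: "int \<Rightarrow> int \<Rightarrow> int \<Rightarrow> int" where
  "srefl a b = (\<lambda>i. if i = a then b else if i = b then a
                    else if i = - a then - b else if i = - b then - a else i)"

lemma srefl_apply [simp]: "srefl a b a = b" "srefl a b b = a"
  by (auto simp: srefl_def)

lemma srefl_uminus [simp]: "a \<noteq> 0 \<Longrightarrow> b \<noteq> 0 \<Longrightarrow> srefl a b (- i) = - srefl a b i"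
  by (auto simp: srefl_def)

lemma srefl_other: "i \<notin> {a, b, - a, - b} \<Longrightarrow> srefl a b i = i"
  by (auto simp: srefl_def)

lemma srefl_srefl [simp]: "a \<noteq> 0 \<Longrightarrow> b \<noteq> 0 \<Longrightarrow> srefl a b (srefl a b i) = i"
  by (auto simp: srefl_def)

lemma srefl_comp_srefl [simp]: "a \<noteq> 0 \<Longrightarrow> b \<noteq> 0 \<Longrightarrow> srefl a b \<circ> srefl a b = id"
  by (auto simp: fun_eq_iff)

lemma srefl_commute: "a \<noteq> 0 \<Longrightarrow> b \<noteq> 0 \<Longrightarrow> srefl a b = srefl b a"
  by (auto simp: srefl_def)

lemma srefl_in_hyperoctahedral [intro]:
  assumes "a \<in> pm_set N" "b \<in> pm_set N"
  shows "srefl a b \<in> hyperoctahedral N"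
proof -
  have nz: "a \<noteq> 0" "b \<noteq> 0" using assms pm_set_nonzero by auto
  have "bij_betw (srefl a b) (pm_set N) (pm_set N)"
    by (rule bij_betw_byWitness[where f' = "srefl a b"]) (use nz assms in \<open>auto simp: srefl_def\<close>)
  moreover have "srefl a b i = i" if "i \<notin> pm_set N" for i
    using that assms by (intro srefl_other) (metis insertE pm_set_uminus_iff singletonD)
  ultimately have "srefl a b permutes pm_set N"
    by (rule bij_imp_permutes)
  then show ?thesis using nz by (simp add: hyperoctahedral_iff)
qed

lemma inv_srefl [simp]: "a \<noteq> 0 \<Longrightarrow> b \<noteq> 0 \<Longrightarrow> inv (srefl a b) = srefl a b"
  by (rule inv_unique_comp) auto

lemma srefl_neg_neg: "a \<noteq> 0 \<Longrightarrow> b \<noteq> 0 \<Longrightarrow> srefl (- a) (- b) = srefl a b"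
  by (auto simp: srefl_def)

lemma transpose_comp_eq_srefl:
  "a \<noteq> 0 \<Longrightarrow> b \<noteq> 0 \<Longrightarrow> a \<noteq> b \<Longrightarrow> a \<noteq> - b \<Longrightarrow> transpose a b \<circ> transpose (- a) (- b) = srefl a b"
  by (auto simp: srefl_def transpose_def fun_eq_iff)

lemma transpose_eq_srefl: "a \<noteq> 0 \<Longrightarrow> transpose a (- a) = srefl a (- a)"
  by (auto simp: srefl_def transpose_def fun_eq_iff)

text \<open>
  This replaces the three families of generators by the single family \<open>srefl a b\<close>.
\<close>

lemma gens_B_eq: "gens_B N = {srefl a b | a b. a \<in> pm_set N \<and> b \<in> pm_set N \<and> a \<noteq> b}"
  (is "?L = ?R")
proof
  show "?L \<subseteq> ?R"
  proof
    fix g assume "g \<in> ?L"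
    then show "g \<in> ?R"
      unfolding gens_B_def
    proof (elim UnE CollectE exE conjE)
      fix i j
      assume g: "g = transpose i j \<circ> transpose (- i) (- j)"
        and ij: "i \<in> {1..int N}" "j \<in> {1..int N}" "i \<noteq> j"
      then have "g = srefl i j" by (simp add: transpose_comp_eq_srefl)
      moreover have "i \<in> pm_set N" "j \<in> pm_set N" using ij by (simp_all add: pm_set_def)
      ultimately show ?thesis using ij(3) by blast
    next
      fix i j
      assume g: "g = transpose i (- j) \<circ> transpose (- i) j"
        and ij: "i \<in> {1..int N}" "j \<in> {1..int N}" "i \<noteq> j"
      then have "g = srefl i (- j)" using transpose_comp_eq_srefl[of i "- j"] by simp
      moreover have "i \<in> pm_set N" "- j \<in> pm_set N" "i \<noteq> - j"
        using ij by (simp_all add: pm_set_def)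
      ultimately show ?thesis by blast
    next
      fix i
      assume g: "g = transpose i (- i)" and i: "i \<in> {1..int N}"
      then have "g = srefl i (- i)" by (simp add: transpose_eq_srefl)
      moreover have "i \<in> pm_set N" "- i \<in> pm_set N" "i \<noteq> - i"
        using i by (simp_all add: pm_set_def)
      ultimately show ?thesis by blast
    qed
  qed
  show "?R \<subseteq> ?L"
  proof
    fix g assume "g \<in> ?R"
    then obtain a b where g: "g = srefl a b" "a \<in> pm_set N" "b \<in> pm_set N" "a \<noteq> b" by blast
    \<comment> \<open>the sign of the first index can be taken positive\<close>
    define i where "i = \<bar>a\<bar>"
    define c where "c = (if a > 0 then b else - b)"
    have i: "i \<in> {1..int N}" "c \<in> pm_set N" "c \<noteq> i"
      using g by (auto simp: i_def c_def pm_set_def)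
    have gi: "g = srefl i c"
      using g(1) srefl_neg_neg[OF pm_set_nonzero[OF g(2)] pm_set_nonzero[OF g(3)]]
      by (auto simp: i_def c_def)
    consider "c > 0" | "c = - i" | "c < 0" "c \<noteq> - i" using pm_set_nonzero[OF i(2)] by linarith
    then show "g \<in> ?L"
    proof cases
      case 1
      then have "g = transpose i c \<circ> transpose (- i) (- c)" "c \<in> {1..int N}"
        using i gi transpose_comp_eq_srefl[of i c] by (auto simp: pm_set_def)
      then show ?thesis using i unfolding gens_B_def by blast
    next
      case 2
      then have "g = transpose i (- i)" using i gi transpose_eq_srefl[of i] by auto
      then show ?thesis using i unfolding gens_B_def by blast
    next
      case 3
      define j where "j = - c"
      have "j \<in> {1..int N}" "i \<noteq> j" using 3 i by (auto simp: j_def pm_set_def)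
      moreover have "g = transpose i (- j) \<circ> transpose (- i) j"
        using i gi 3 transpose_comp_eq_srefl[of i c] by (auto simp: j_def)
      ultimately show ?thesis using i unfolding gens_B_def
        by blast
    qed
  qed
qed

section \<open>Fixed vectors over the field with three elements\<close>

text \<open>
  Odd vectors are determined by their entries at \<open>1, \<dots>, N\<close>, so this is the reflection representation
  of the group with scalars reduced modulo 3. Scalars modulo 3 are chosen for two reasons: the space
  is finite, so that dimension arguments become comparisons of cardinalities, and the characteristic
  is odd, so that \<open>x = - x\<close> forces \<open>x = 0\<close> on inversion-invariant orbits.
\<close>

definition odd_vecs :: "nat \<Rightarrow> (int \<Rightarrow> 3) set" where
  "odd_vecs N = {x. (\<forall>i. x (- i) = - x i) \<and> (\<forall>i. i \<notin> pm_set N \<longrightarrow> x i = 0)}"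

definition Fix :: "nat \<Rightarrow> (int \<Rightarrow> int) \<Rightarrow> (int \<Rightarrow> 3) set" where
  "Fix N w = {x \<in> odd_vecs N. \<forall>i. x (w i) = x i}"

text \<open>
  The root of the reflection \<open>srefl a b\<close> is the functional \<open>x \<mapsto> x a - x b\<close>; being linked means that this
  functional vanishes on the fixed space of \<open>w\<close>, that is, that the reflection fixes every vector
  fixed by \<open>w\<close>. In terms of \<open>w\<close> it says that \<open>a\<close> and \<open>b\<close> lie in the same merged orbit.
\<close>

definition linked :: "nat \<Rightarrow> (int \<Rightarrow> int) \<Rightarrow> int \<Rightarrow> int \<Rightarrow> bool" where
  "linked N w a b \<longleftrightarrow> (\<forall>x\<in>Fix N w. x a = x b)"

lemma odd_vecs_uminus: "x \<in> odd_vecs N \<Longrightarrow> x (- i) = - x i"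
  by (simp add: odd_vecs_def)

lemma odd_vecs_lincomb:
  "x \<in> odd_vecs N \<Longrightarrow> y \<in> odd_vecs N \<Longrightarrow> (\<lambda>i. x i + c * y i) \<in> odd_vecs N"
  by (simp add: odd_vecs_def)

lemma Fix_lincomb:
  "x \<in> Fix N w \<Longrightarrow> y \<in> Fix N w \<Longrightarrow> (\<lambda>i. x i + c * y i) \<in> Fix N w"
  by (simp add: Fix_def odd_vecs_lincomb)

lemma FixD: "x \<in> Fix N w \<Longrightarrow> x (w i) = x i" "x \<in> Fix N w \<Longrightarrow> x \<in> odd_vecs N"
  by (auto simp: Fix_def)

lemma finite_odd_vecs: "finite (odd_vecs N)"
proof -
  have "odd_vecs N \<subseteq> {x. \<forall>i. (i \<in> pm_set N \<longrightarrow> x i \<in> UNIV) \<and> (i \<notin> pm_set N \<longrightarrow> x i = 0)}"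
    by (auto simp: odd_vecs_def)
  then show ?thesis
    by (rule finite_subset) (rule finite_set_of_finite_funs[OF finite_pm_set finite])
qed

lemma finite_Fix: "finite (Fix N w)"
  by (rule finite_subset[OF _ finite_odd_vecs]) (auto simp: Fix_def)

lemma Fix_id [simp]: "Fix N id = odd_vecs N"
  by (simp add: Fix_def)

lemma zero_in_Fix: "(\<lambda>_. 0) \<in> Fix N w"
  by (simp add: Fix_def odd_vecs_def)

lemma card_Fix_pos: "card (Fix N w) > 0"
  using zero_in_Fix finite_Fix card_gt_0_iff by blast

lemma Fix_inv:
  assumes "w \<in> hyperoctahedral N" shows "Fix N (inv w) = Fix N w"
  unfolding Fix_def using comp_inv_hyperoctahedral(4,5)[OF assms] by (metis (no_types, lifting))

lemma Fix_srefl_iff: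
  assumes "x \<in> odd_vecs N"
  shows "(\<forall>i. x (srefl a b i) = x i) \<longleftrightarrow> x a = x b"
proof
  assume "\<forall>i. x (srefl a b i) = x i"
  then have "x (srefl a b a) = x a" by blast
  then show "x a = x b" by simp
next
  assume "x a = x b"
  moreover have "x (- a) = - x a" "x (- b) = - x b"
    using assms by (simp_all add: odd_vecs_uminus)
  ultimately show "\<forall>i. x (srefl a b i) = x i" by (simp add: srefl_def)
qed

text \<open>
  If the functional \<open>x \<mapsto> x a - x b\<close> is not identically zero on the fixed space, its kernel is a
  hyperplane, and a hyperplane has a third of the elements. The bijection adds multiples of one vector
  \<open>z\<close> outside the kernel.
\<close>

lemma card_slice:
  assumes "z \<in> Fix N w" "z a \<noteq> z b"
  shows "card (Fix N w) = 3 * card {x \<in> Fix N w. x a = x b}"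
proof -
  let ?I = "{x \<in> Fix N w. x a = x b}"
  define d where "d = z a - z b"
  have "d \<noteq> 0" using assms(2) by (simp add: d_def)
  then have d: "d * d = 1" by (rule mod3_mult_self)
  have "bij_betw (\<lambda>(x, c). (\<lambda>i. x i + c * z i)) (?I \<times> UNIV) (Fix N w)"
  proof (rule bij_betw_byWitness[where f' = "\<lambda>y. (\<lambda>i. y i + - ((y a - y b) * d) * z i, (y a - y b) * d)"])
    have "(x a + c * z a - (x b + c * z b)) * d = c" if "x a = x b" for x c
    proof -
      have "(x a + c * z a - (x b + c * z b)) * d = c * (d * d)"
        unfolding that d_def by (simp add: algebra_simps)
      then show ?thesis by (simp add: d)
    qed
    then show "\<forall>xc\<in>?I \<times> UNIV. (\<lambda>y. (\<lambda>i. y i + - ((y a - y b) * d) * z i, (y a - y b) * d))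
        ((\<lambda>(x, c). (\<lambda>i. x i + c * z i)) xc) = xc"
      by auto
    show "\<forall>y\<in>Fix N w. (\<lambda>(x, c). (\<lambda>i. x i + c * z i))
        (\<lambda>i. y i + - ((y a - y b) * d) * z i, (y a - y b) * d) = y"
      by auto
    show "(\<lambda>(x, c). (\<lambda>i. x i + c * z i)) ` (?I \<times> UNIV) \<subseteq> Fix N w"
      using assms(1) by (auto intro: Fix_lincomb)
    show "(\<lambda>y. (\<lambda>i. y i + - ((y a - y b) * d) * z i, (y a - y b) * d)) ` Fix N w \<subseteq> ?I \<times> UNIV"
    proof (rule image_subsetI)
      fix y assume y: "y \<in> Fix N w"
      have "y a + - ((y a - y b) * d) * z a - (y b + - ((y a - y b) * d) * z b)
          = (y a - y b) * (1 - d * d)"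
        unfolding d_def by (simp add: algebra_simps)
      then have "y a + - ((y a - y b) * d) * z a = y b + - ((y a - y b) * d) * z b"
        by (simp add: d)
      then show "(\<lambda>i. y i + - ((y a - y b) * d) * z i, (y a - y b) * d) \<in> ?I \<times> UNIV"
        using Fix_lincomb[OF y assms(1)] by blast
    qed
  qed
  then have "card (Fix N w) = card (?I \<times> (UNIV :: 3 set))"
    by (rule bij_betw_same_card[symmetric])
  then show ?thesis by (simp add: card_cartesian_product)
qed

text \<open>
  On vectors that the reflection fixes, \<open>w\<close> and \<open>w \<circ> srefl a b\<close> act in the same way. So the fixed
  spaces of \<open>w\<close> and \<open>w \<circ> srefl a b\<close> both meet the reflecting hyperplane in the same subspace, and
  each of them contains it with index 1 or 3.
\<close>

lemma Fix_comp_srefl_slice: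
  assumes "w \<in> hyperoctahedral N" "a \<in> pm_set N" "b \<in> pm_set N"
  shows "{x \<in> Fix N (w \<circ> srefl a b). x a = x b} = {x \<in> Fix N w. x a = x b}"
proof -
  have nz: "a \<noteq> 0" "b \<noteq> 0" using assms pm_set_nonzero by auto
  have "(\<forall>i. x (w (srefl a b i)) = x i) \<longleftrightarrow> (\<forall>i. x (w i) = x i)"
    if "x \<in> odd_vecs N" "x a = x b" for x
  proof -
    have t: "x (srefl a b i) = x i" for i
      using Fix_srefl_iff[OF that(1), of a b] that(2) by simp
    have "x (w i) = x i" if "\<forall>i. x (w (srefl a b i)) = x i" for i
      using that[rule_format, of "srefl a b i"] nz t by simp
    moreover have "x (w (srefl a b i)) = x i" if "\<forall>i. x (w i) = x i" for i
      using that t by simp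
    ultimately show ?thesis by blast
  qed
  then show ?thesis by (auto simp: Fix_def)
qed

section \<open>How a reflection changes the fixed space\<close>

definition dot :: "nat \<Rightarrow> (int \<Rightarrow> 3) \<Rightarrow> (int \<Rightarrow> 3) \<Rightarrow> 3" where
  "dot N x y = (\<Sum>i\<in>pm_set N. x i * y i)"

text \<open>
  Signed permutations are isometries of the standard inner product; this is what excludes, below, that
  multiplication by a reflection leaves the dimension of the fixed space unchanged.
\<close>

lemma dot_permute:
  assumes "w \<in> hyperoctahedral N"
  shows "dot N (\<lambda>i. x (w i)) (\<lambda>i. y (w i)) = dot N x y"
  unfolding dot_def
  using sum.permute[OF hyperoctahedralD(1)[OF assms], of "\<lambda>i. x i * y i"] by (simp add: comp_def)

lemma dot_diff_srefl:
  assumes "x \<in> odd_vecs N" "y \<in> odd_vecs N" "a \<in> pm_set N" "b \<in> pm_set N" "a \<noteq> b"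
  shows "dot N x (\<lambda>i. y (srefl a b i)) - dot N x y =
    (if b = - a then 1 else - 1) * ((x a - x b) * (y b - y a))"
proof -
  have nz: "a \<noteq> 0" "b \<noteq> 0" using assms pm_set_nonzero by auto
  have "dot N x (\<lambda>i. y (srefl a b i)) - dot N x y
      = (\<Sum>i\<in>pm_set N. x i * (y (srefl a b i) - y i))"
    by (simp add: dot_def sum_subtractf right_diff_distrib)
  also have "\<dots> = (\<Sum>i\<in>{a, b, - a, - b}. x i * (y (srefl a b i) - y i))"
    by (rule sum.mono_neutral_right) (use assms in \<open>auto simp: finite_pm_set srefl_other\<close>)
  also have "\<dots> = (if b = - a then 1 else - 1) * ((x a - x b) * (y b - y a))"
  proof (cases "b = - a")
    case True
    then have "{a, b, - a, - b} = {a, b}" by auto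
    then show ?thesis using True assms(5) by (simp add: algebra_simps)
  next
    case False
    have "a \<noteq> - a" "b \<noteq> - b" using nz by auto
    moreover have "a \<noteq> - b" "b \<noteq> - a" using False by auto
    ultimately have "(\<Sum>i\<in>{a, b, - a, - b}. x i * (y (srefl a b i) - y i))
      = (x a - x b) * (y b - y a) + (x a - x b) * (y b - y a)"
      using assms(5) nz odd_vecs_uminus[OF assms(1)] odd_vecs_uminus[OF assms(2)]
      by (simp add: algebra_simps)
    then show ?thesis using False by (simp add: mod3_add_self)
  qed
  finally show ?thesis .
qed

text \<open>
  The index cannot be 3 on both sides. Vectors \<open>x\<close> fixed by \<open>w\<close> and \<open>y\<close> fixed by \<open>w \<circ> srefl a b\<close>, neither
  of them fixed by the reflection, would satisfy \<open>dot x y = dot x (y \<circ> srefl a b)\<close> by invariance of the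
  inner product under \<open>w\<close>, whereas these two values differ by a nonzero multiple of
  \<open>(x a - x b) * (y a - y b)\<close>.
\<close>

lemma linked_or_linked_comp:
  assumes "w \<in> hyperoctahedral N" "a \<in> pm_set N" "b \<in> pm_set N" "a \<noteq> b"
  shows "linked N w a b \<or> linked N (w \<circ> srefl a b) a b"
proof (rule ccontr)
  assume "\<not> ?thesis"
  then obtain x y where x: "x \<in> Fix N w" "x a \<noteq> x b" and y: "y \<in> Fix N (w \<circ> srefl a b)" "y a \<noteq> y b"
    by (auto simp: linked_def)
  have nz: "a \<noteq> 0" "b \<noteq> 0" using assms pm_set_nonzero by auto
  have yw: "y (w i) = y (srefl a b i)" for i
    using FixD(1)[OF y(1), of "srefl a b i"] nz by simp
  have "dot N x y = dot N x (\<lambda>i. y (srefl a b i))"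
    using dot_permute[OF assms(1), of x y] FixD(1)[OF x(1)] by (simp add: yw)
  then have "(if b = - a then 1 else - 1) * ((x a - x b) * (y b - y a)) = 0"
    using dot_diff_srefl[OF FixD(2)[OF x(1)] FixD(2)[OF y(1)] assms(2-4)] by simp
  then show False using x(2) y(2) by (simp add: mod3_mult_eq_0 split: if_splits)
qed

lemma permutation_hyperoctahedral: "w \<in> hyperoctahedral N \<Longrightarrow> permutation w"
  using hyperoctahedralD(1) finite_pm_set permutation_permutes by blast

lemma orbit_uminus:
  assumes "w \<in> hyperoctahedral N" "j \<in> orbit w a"
  shows "- j \<in> orbit w (- a)"
  using assms(2)
  by induction (auto simp: hyperoctahedralD(2)[OF assms(1), symmetric] intro: orbit.intros)

lemma orbit_step_iff:
  assumes "w \<in> hyperoctahedral N"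
  shows "w i \<in> orbit w a \<longleftrightarrow> i \<in> orbit w a"
proof
  note perm = permutation_hyperoctahedral[OF assms]
  assume "w i \<in> orbit w a"
  then have "a \<in> orbit w (w i)"
    using orbit_swap[OF permutation_self_in_orbit[OF perm]] by blast
  then have "a \<in> orbit w i" by (simp add: permutation_orbit_step[OF perm])
  then show "i \<in> orbit w a"
    using orbit_swap[OF permutation_self_in_orbit[OF perm]] by blast
qed (rule orbit.step)

lemma Fix_orbit:
  assumes "x \<in> Fix N w" "b \<in> orbit w a"
  shows "x b = x a"
  using assms(2) by induction (simp_all add: FixD(1)[OF assms(1)])

text \<open>
  Orbits that are disjoint from their negatives give fixed vectors: \<open>1\<close> on the set, \<open>- 1\<close> on its negative.
\<close>

lemma Fix_indicator:
  assumes w: "w \<in> hyperoctahedral N"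
    and S: "S \<subseteq> pm_set N" "\<And>i. w i \<in> S \<longleftrightarrow> i \<in> S" "\<And>i. i \<in> S \<Longrightarrow> - i \<notin> S"
  shows "(\<lambda>i. if i \<in> S then 1 else if - i \<in> S then - 1 else 0) \<in> Fix N w"
proof -
  have "- w i \<in> S \<longleftrightarrow> - i \<in> S" for i
    using S(2)[of "- i"] hyperoctahedralD(2)[OF w] by simp
  moreover have "i \<in> pm_set N" if "- i \<in> S" for i
    using that S(1) pm_set_uminus_iff by blast
  ultimately show ?thesis using S by (auto simp: Fix_def odd_vecs_def)
qed

text \<open>
  The signed indicator of the orbit of \<open>a\<close> is a fixed vector with value 1 at \<open>a\<close> and 1 nowhere outside
  that orbit.
\<close>

lemma linked_imp_orbit:
  assumes w: "w \<in> hyperoctahedral N" and a: "a \<in> pm_set N" and l: "linked N w a b"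
    and n: "- a \<notin> orbit w a"
  shows "b \<in> orbit w a"
proof -
  note self = permutation_self_in_orbit[OF permutation_hyperoctahedral[OF w]]
  have disj: "- i \<notin> orbit w a" if i: "i \<in> orbit w a" for i
  proof
    assume "- i \<in> orbit w a"
    moreover have "- a \<in> orbit w (- i)"
      using orbit_uminus[OF w orbit_swap[OF self i]] .
    ultimately show False using n orbit_trans by fast
  qed
  have "(\<lambda>i. if i \<in> orbit w a then 1 else if - i \<in> orbit w a then - 1 else 0) \<in> Fix N w"
    by (rule Fix_indicator[OF w permutes_orbit_subset[OF hyperoctahedralD(1)[OF w] a]
          orbit_step_iff[OF w] disj])
  then have "(if b \<in> orbit w a then 1 else if - b \<in> orbit w a then - 1 else 0) = (1::3)"
    using l self[of a] unfolding linked_def by fastforce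
  then show ?thesis by (simp split: if_splits)
qed

lemma linked_iff:
  assumes w: "w \<in> hyperoctahedral N" and a: "a \<in> pm_set N" and b: "b \<in> pm_set N"
  shows "linked N w a b \<longleftrightarrow> b \<in> orbit w a \<or> (- a \<in> orbit w a \<and> - b \<in> orbit w b)"
proof
  note self = permutation_self_in_orbit[OF permutation_hyperoctahedral[OF w]]
  assume l: "linked N w a b"
  show "b \<in> orbit w a \<or> (- a \<in> orbit w a \<and> - b \<in> orbit w b)"
  proof (rule disjCI)
    assume n: "\<not> (- a \<in> orbit w a \<and> - b \<in> orbit w b)"
    have l': "linked N w b a" using l by (auto simp: linked_def)
    show "b \<in> orbit w a"
    proof (cases "- a \<in> orbit w a")
      case False
      then show ?thesis using linked_imp_orbit[OF w a l] by blast
    next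
      case True
      then have "a \<in> orbit w b" using linked_imp_orbit[OF w b l'] n by blast
      then show ?thesis using orbit_swap[OF self] by blast
    qed
  qed
next
  have zero: "x c = 0" if "x \<in> Fix N w" "- c \<in> orbit w c" for x c
    using Fix_orbit[OF that] odd_vecs_uminus[OF FixD(2)[OF that(1)], of c]
    by (metis mod3_eq_uminus)
  assume "b \<in> orbit w a \<or> (- a \<in> orbit w a \<and> - b \<in> orbit w b)"
  then show "linked N w a b"
    unfolding linked_def using Fix_orbit zero by metis
qed

definition evec :: "int \<Rightarrow> int \<Rightarrow> 3" where
  "evec c i = (if i = c then 1 else if i = - c then - 1 else 0)"

text \<open>
  The image of \<open>w - 1\<close> on odd vectors, that is, the moved space of \<open>w\<close>.
\<close>

definition cobounding :: "nat \<Rightarrow> (int \<Rightarrow> int) \<Rightarrow> (int \<Rightarrow> 3) \<Rightarrow> bool" where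
  "cobounding N w z \<longleftrightarrow> (\<exists>y\<in>odd_vecs N. \<forall>i. y (w i) = y i + z i)"

lemma evec_in_odd_vecs: "c \<in> pm_set N \<Longrightarrow> evec c \<in> odd_vecs N"
  using pm_set_nonzero[of c N] by (auto simp: evec_def odd_vecs_def)

lemma cobounding_zero: "cobounding N w (\<lambda>_. 0)"
  unfolding cobounding_def by (rule bexI[of _ "\<lambda>_. 0"]) (auto simp: odd_vecs_def)

lemma cobounding_lincomb:
  assumes "cobounding N w z" "cobounding N w z'"
  shows "cobounding N w (\<lambda>i. z i + c * z' i)"
proof -
  obtain y y' where y: "y \<in> odd_vecs N" "\<forall>i. y (w i) = y i + z i"
    and y': "y' \<in> odd_vecs N" "\<forall>i. y' (w i) = y' i + z' i"
    using assms unfolding cobounding_def by auto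
  have "\<forall>i. y (w i) + c * y' (w i) = (y i + c * y' i) + (z i + c * z' i)"
    using y(2) y'(2) by (simp add: algebra_simps)
  then show ?thesis
    unfolding cobounding_def by (rule bexI[where x = "\<lambda>i. y i + c * y' i"])
      (rule odd_vecs_lincomb[OF y(1) y'(1)])
qed

text \<open>
  Along one step of the orbit, the coboundary of the basis vector at \<open>w c\<close> is the difference of the basis
  vectors at \<open>c\<close> and \<open>w c\<close>; longer distances follow by adding up.
\<close>

lemma cobounding_orbit:
  assumes w: "w \<in> hyperoctahedral N" and a: "a \<in> pm_set N" and b: "b \<in> orbit w a"
  shows "cobounding N w (\<lambda>i. evec a i - evec b i)"
proof -
  have step: "cobounding N w (\<lambda>i. evec c i - evec (w c) i)" if "c \<in> pm_set N" for c
  proof -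
    have "w i = w c \<longleftrightarrow> i = c" "w i = - w c \<longleftrightarrow> i = - c" for i
      using hyperoctahedralD(2,4)[OF w] by (metis injD)+
    then have "\<forall>i. evec (w c) (w i) = evec (w c) i + (evec c i - evec (w c) i)"
      by (auto simp: evec_def)
    moreover have "evec (w c) \<in> odd_vecs N"
      using that hyperoctahedralD(5)[OF w] by (simp add: evec_in_odd_vecs)
    ultimately show ?thesis unfolding cobounding_def by blast
  qed
  have "b \<in> pm_set N \<and> cobounding N w (\<lambda>i. evec a i - evec b i)"
    using b
  proof induction
    case base
    then show ?case using step[OF a] a hyperoctahedralD(5)[OF w] by simp
  next
    case (step b)
    from step.IH have "b \<in> pm_set N" "cobounding N w (\<lambda>i. evec a i - evec b i)" by auto
    from cobounding_lincomb[OF this(2) \<open>\<And>c. c \<in> pm_set N \<Longrightarrow> _\<close>[OF this(1)], of 1] this(1)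
    show ?case using hyperoctahedralD(5)[OF w] by simp
  qed
  then show ?thesis by simp
qed

text \<open>
  The moved space contains every root that vanishes on the fixed space. For two points of different
  inversion-invariant orbits one uses that \<open>evec c - evec (- c) = 2 * evec c = - evec c\<close> modulo 3,
  so that the basis vectors at such points are themselves in the moved space.
\<close>

lemma linked_imp_cobounding:
  assumes w: "w \<in> hyperoctahedral N" and a: "a \<in> pm_set N" and b: "b \<in> pm_set N"
    and l: "linked N w a b"
  shows "cobounding N w (\<lambda>i. evec a i - evec b i)"
proof (cases "b \<in> orbit w a")
  case True
  then show ?thesis using cobounding_orbit[OF w a] by blast
next
  case False
  then have ab: "- a \<in> orbit w a" "- b \<in> orbit w b" using l linked_iff[OF w a b] by auto
  have "(\<lambda>i. evec c i - evec (- c) i) = (\<lambda>i. - evec c i)" if "c \<in> pm_set N" for c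
    using pm_set_nonzero[OF that] by (auto simp: evec_def fun_eq_iff)
  then have "cobounding N w (\<lambda>i. - evec a i)" "cobounding N w (\<lambda>i. - evec b i)"
    using cobounding_orbit[OF w a ab(1)] cobounding_orbit[OF w b ab(2)] a b by auto
  from cobounding_lincomb[OF cobounding_lincomb[OF cobounding_zero this(1), of "- 1"] this(2), of 1]
  show ?thesis by simp
qed

lemma dot_evec:
  assumes "y \<in> odd_vecs N" "c \<in> pm_set N"
  shows "dot N y (evec c) = - y c"
proof -
  have "dot N y (evec c) = (\<Sum>i\<in>{c, - c}. y i * evec c i)"
    unfolding dot_def
    by (rule sum.mono_neutral_right) (use assms in \<open>auto simp: finite_pm_set evec_def\<close>)
  also have "\<dots> = y c + y c"
    using pm_set_nonzero[OF assms(2)] odd_vecs_uminus[OF assms(1)]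
    by (simp add: evec_def)
  finally show ?thesis by (simp add: mod3_add_self)
qed

text \<open>
  The index cannot be 1 on both sides. By \<open>linked_imp_cobounding\<close> the root is of the form \<open>y \<circ> w - y\<close>.
  Since \<open>y \<circ> w\<close> and \<open>y\<close> have the same norm and differ by the root, the reflection exchanges them, so
  \<open>y\<close> is fixed by \<open>w \<circ> srefl a b\<close> although the reflection moves it.
\<close>

lemma linked_imp_not_linked_comp:
  assumes w: "w \<in> hyperoctahedral N" and a: "a \<in> pm_set N" and b: "b \<in> pm_set N" and ab: "a \<noteq> b"
    and l: "linked N w a b"
  shows "\<not> linked N (w \<circ> srefl a b) a b"
proof -
  have nz: "a \<noteq> 0" "b \<noteq> 0" using a b pm_set_nonzero by auto
  define z where "z = (\<lambda>i. evec a i - evec b i)"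
  obtain y where y: "y \<in> odd_vecs N" and yw: "\<And>i. y (w i) = y i + z i"
    using linked_imp_cobounding[OF w a b l] unfolding cobounding_def z_def by auto
  have z: "z \<in> odd_vecs N"
    using odd_vecs_lincomb[OF evec_in_odd_vecs[OF a] evec_in_odd_vecs[OF b], of "- 1"]
    by (simp add: z_def)
  have dotz: "dot N x z = x b - x a" if "x \<in> odd_vecs N" for x
  proof -
    have "dot N x z = dot N x (evec a) - dot N x (evec b)"
      unfolding dot_def z_def by (simp add: sum_subtractf right_diff_distrib)
    then show ?thesis using dot_evec[OF that a] dot_evec[OF that b] by simp
  qed
  \<comment> \<open>equality of norms pins down the difference of the two entries of \<open>y\<close>\<close>
  have "dot N y y = dot N (\<lambda>i. y i + z i) (\<lambda>i. y i + z i)"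
    using dot_permute[OF w, of y y] by (simp add: yw)
  also have "\<dots> = dot N y y + dot N y z + dot N y z + dot N z z"
    unfolding dot_def by (simp add: distrib_left distrib_right sum.distrib sum_distrib_left mult.commute add_ac)
  finally have "- dot N y z + dot N z z = 0"
    using mod3_add_self[of "dot N y z"] by (simp add: add.assoc)
  then have yz: "y a - y b = z a - z b"
    using dotz[OF y] dotz[OF z] by (simp add: algebra_simps)
  have swap: "y (srefl a b i) = y i + z i" for i
  proof (cases "b = - a")
    case True
    have "y (- a) = - y a" by (rule odd_vecs_uminus[OF y])
    moreover have "z a = - 1" "z (- a) = 1" "z b = 1"
      using True nz by (simp_all add: z_def evec_def)
    ultimately have "y a = - 1" using yz True mod3_add_self[of "y a"] by simp
    with True show ?thesis
      using nz \<open>y (- a) = - y a\<close> \<open>z a = - 1\<close> \<open>z (- a) = 1\<close>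
      by (cases "i = a \<or> i = - a") (auto simp: srefl_def z_def evec_def)
  next
    case False
    then have "z a = 1" "z b = - 1" using ab nz by (auto simp: z_def evec_def)
    then have "y a = y b - 1" using yz by (simp add: algebra_simps)
    moreover have "y (- a) = - y a" "y (- b) = - y b"
      by (rule odd_vecs_uminus[OF y])+
    ultimately show ?thesis
      using ab nz False by (auto simp: srefl_def z_def evec_def)
  qed
  have "y \<in> Fix N (w \<circ> srefl a b)"
    using y yw swap[symmetric] nz by (simp add: Fix_def)
  moreover have "y a \<noteq> y b"
  proof
    assume "y a = y b"
    then have "z a - z b = 0" using yz by simp
    then show False using ab nz by (auto simp: z_def evec_def split: if_splits)
  qed
  ultimately show ?thesis by (auto simp: linked_def)
qed

lemma linked_inv: "w \<in> hyperoctahedral N \<Longrightarrow> linked N (inv w) a b \<longleftrightarrow> linked N w a b"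
  by (simp add: linked_def Fix_inv)

lemma linked_apply: "linked N w (w a) a"
  by (simp add: linked_def FixD(1))

lemma linkedD: "linked N w a b \<Longrightarrow> x \<in> Fix N w \<Longrightarrow> x a = x b"
  by (simp add: linked_def)

lemma linked_mono: "linked N w a b \<Longrightarrow> Fix N v \<subseteq> Fix N w \<Longrightarrow> linked N v a b"
  by (auto simp: linked_def)

lemma linked_comp_srefl_iff:
  assumes "w \<in> hyperoctahedral N" "a \<in> pm_set N" "b \<in> pm_set N" "a \<noteq> b"
  shows "linked N (w \<circ> srefl a b) a b \<longleftrightarrow> \<not> linked N w a b"
  using linked_imp_not_linked_comp[OF assms] linked_or_linked_comp[OF assms] by blast

lemma card_Fix_not_linked:
  assumes "\<not> linked N w a b"
  shows "card (Fix N w) = 3 * card {x \<in> Fix N w. x a = x b}"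
proof -
  obtain z where "z \<in> Fix N w" "z a \<noteq> z b" using assms by (auto simp: linked_def)
  then show ?thesis by (rule card_slice)
qed

text \<open>
  The dichotomy resulting from the two index computations: multiplication by a reflection triples the
  fixed space when the two points are linked, and divides it by three otherwise.
\<close>

lemma Fix_comp_srefl_linked:
  assumes "w \<in> hyperoctahedral N" "a \<in> pm_set N" "b \<in> pm_set N" "a \<noteq> b" "linked N w a b"
  shows "card (Fix N (w \<circ> srefl a b)) = 3 * card (Fix N w)"
    and "Fix N w = {x \<in> Fix N (w \<circ> srefl a b). x a = x b}"
proof -
  show eq: "Fix N w = {x \<in> Fix N (w \<circ> srefl a b). x a = x b}"
    using Fix_comp_srefl_slice[OF assms(1-3)] assms(5) unfolding linked_def by blast
  show "card (Fix N (w \<circ> srefl a b)) = 3 * card (Fix N w)"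
    using card_Fix_not_linked linked_comp_srefl_iff[OF assms(1-4)] assms(5) eq by auto
qed

lemma Fix_comp_srefl_not_linked:
  assumes "w \<in> hyperoctahedral N" "a \<in> pm_set N" "b \<in> pm_set N" "a \<noteq> b" "\<not> linked N w a b"
  shows "card (Fix N w) = 3 * card (Fix N (w \<circ> srefl a b))"
proof -
  have "w \<circ> srefl a b \<circ> srefl a b = w"
    using assms(2,3) pm_set_nonzero by (auto simp: fun_eq_iff)
  then show ?thesis
    using Fix_comp_srefl_linked(1)[of "w \<circ> srefl a b" N a b] linked_comp_srefl_iff[OF assms(1-4)]
      assms comp_in_hyperoctahedral[OF assms(1) srefl_in_hyperoctahedral[OF assms(2,3)]] by simp
qed

section \<open>Reflection length\<close>

lemma Fix_srefl_comp:
  assumes "w \<in> hyperoctahedral N" "a \<in> pm_set N" "b \<in> pm_set N"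
  shows "Fix N (srefl a b \<circ> w) = Fix N (inv w \<circ> srefl a b)"
proof -
  have nz: "a \<noteq> 0" "b \<noteq> 0" using assms pm_set_nonzero by auto
  note t = srefl_in_hyperoctahedral[OF assms(2,3)]
  have "inv (srefl a b \<circ> w) = inv w \<circ> srefl a b"
    using inv_comp_hyperoctahedral[OF t assms(1)] nz by simp
  then show ?thesis using Fix_inv[OF comp_in_hyperoctahedral[OF t assms(1)]] by simp
qed

lemma prod_in_hyperoctahedral:
  "set ts \<subseteq> gens_B N \<Longrightarrow> foldr (\<circ>) ts id \<in> hyperoctahedral N"
  by (induction ts) (auto simp: gens_B_eq)

text \<open>
  One generator can shrink the fixed space at most by a factor 3.
\<close>

lemma card_odd_vecs_le:
  "set ts \<subseteq> gens_B N \<Longrightarrow> card (odd_vecs N) \<le> card (Fix N (foldr (\<circ>) ts id)) * 3 ^ length ts"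
proof (induction ts)
  case (Cons t ts)
  let ?w = "foldr (\<circ>) ts id"
  obtain a b where t: "t = srefl a b" and ab: "a \<in> pm_set N" "b \<in> pm_set N" "a \<noteq> b"
    using Cons.prems by (auto simp: gens_B_eq)
  have w: "?w \<in> hyperoctahedral N" using Cons.prems by (auto intro: prod_in_hyperoctahedral)
  have "card (Fix N ?w) \<le> 3 * card (Fix N (inv ?w \<circ> srefl a b))"
    using Fix_comp_srefl_linked(1)[OF inv_in_hyperoctahedral[OF w] ab]
      Fix_comp_srefl_not_linked[OF inv_in_hyperoctahedral[OF w] ab] Fix_inv[OF w]
    by (cases "linked N (inv ?w) a b") auto
  then have "card (Fix N ?w) \<le> 3 * card (Fix N (t \<circ> ?w))"
    using Fix_srefl_comp[OF w ab(1,2)] t by simp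
  then have "card (Fix N ?w) * 3 ^ length ts \<le> card (Fix N (t \<circ> ?w)) * 3 ^ length (t # ts)"
    by simp
  moreover have "card (odd_vecs N) \<le> card (Fix N ?w) * 3 ^ length ts"
    by (rule Cons.IH) (use Cons.prems in simp)
  ultimately have "card (odd_vecs N) \<le> card (Fix N (t \<circ> ?w)) * 3 ^ length (t # ts)"
    by (rule order_trans[rotated])
  moreover have "foldr (\<circ>) (t # ts) id = t \<circ> ?w" by simp
  ultimately show ?case by (simp only:)
qed simp

lemma ex_moved: "w \<noteq> id \<Longrightarrow> \<exists>a. w a \<noteq> (a::int)"
  by (auto simp: fun_eq_iff)

lemma moved_in_pm_set: "w \<in> hyperoctahedral N \<Longrightarrow> w a \<noteq> a \<Longrightarrow> a \<in> pm_set N"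
  using hyperoctahedralD(1) permutes_not_in by metis

text \<open>
  If \<open>w\<close> moves \<open>a\<close>, then the reflection exchanging \<open>a\<close> and \<open>w a\<close> is linked to \<open>w\<close>, and splitting it off
  triples the fixed space. Repeating this gives a factorization in which no generator is wasted.
\<close>

lemma ex_factorization:
  "w \<in> hyperoctahedral N \<Longrightarrow>
    \<exists>ts. set ts \<subseteq> gens_B N \<and> foldr (\<circ>) ts id = w \<and> card (Fix N w) * 3 ^ length ts = card (odd_vecs N)"
proof (induction "card (odd_vecs N) - card (Fix N w)" arbitrary: w rule: less_induct)
  case less
  show ?case
  proof (cases "w = id")
    case True
    then show ?thesis by (intro exI[of _ "[]"]) simp
  next
    case False
    then obtain a where wa: "w a \<noteq> a" using ex_moved by blast
    note w = less.prems
    have a: "a \<in> pm_set N" using moved_in_pm_set[OF w wa] .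
    have b: "w a \<in> pm_set N" using a hyperoctahedralD(5)[OF w] by simp
    define v where "v = srefl (w a) a \<circ> w"
    have nz: "a \<noteq> 0" "w a \<noteq> 0" using a b pm_set_nonzero by auto
    have v: "v \<in> hyperoctahedral N" using a b w by (auto simp: v_def)
    have wv: "w = srefl (w a) a \<circ> v" using nz by (auto simp: v_def fun_eq_iff)
    have c: "card (Fix N v) = 3 * card (Fix N w)"
      unfolding v_def Fix_srefl_comp[OF w b a]
      using Fix_comp_srefl_linked(1)[OF inv_in_hyperoctahedral[OF w] b a wa]
        linked_inv[OF w] linked_apply Fix_inv[OF w] by simp
    have "card (Fix N v) \<le> card (odd_vecs N)"
      by (rule card_mono[OF finite_odd_vecs]) (auto simp: Fix_def)
    then have "card (odd_vecs N) - card (Fix N v) < card (odd_vecs N) - card (Fix N w)"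
      using c card_Fix_pos[of N w] by linarith
    from less.hyps[OF this v] obtain ts where ts: "set ts \<subseteq> gens_B N" "foldr (\<circ>) ts id = v"
      "card (Fix N v) * 3 ^ length ts = card (odd_vecs N)" by blast
    have "srefl (w a) a \<in> gens_B N" using a b wa by (auto simp: gens_B_eq)
    then have "set (srefl (w a) a # ts) \<subseteq> gens_B N" using ts(1) by simp
    moreover have "foldr (\<circ>) (srefl (w a) a # ts) id = w" using ts(2) wv by simp
    moreover have "card (Fix N w) * 3 ^ length (srefl (w a) a # ts) = card (odd_vecs N)"
      using ts(3) c by simp
    ultimately show ?thesis by blast
  qed
qed

text \<open>
  Reflection length is the codimension of the fixed space.
\<close>

lemma card_Fix_length_B:
  assumes "w \<in> hyperoctahedral N"
  shows "card (Fix N w) * 3 ^ length_B N w = card (odd_vecs N)"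
proof -
  let ?P = "\<lambda>k. \<exists>ts. length ts = k \<and> set ts \<subseteq> gens_B N \<and> foldr (\<circ>) ts id = w"
  obtain ts where ts: "set ts \<subseteq> gens_B N" "foldr (\<circ>) ts id = w"
    "card (Fix N w) * 3 ^ length ts = card (odd_vecs N)"
    using ex_factorization[OF assms] by blast
  have "(LEAST k. ?P k) = length ts"
  proof (rule Least_equality)
    show "?P (length ts)" using ts by blast
    fix k assume "?P k"
    then have "card (Fix N w) * 3 ^ length ts \<le> card (Fix N w) * 3 ^ k"
      using card_odd_vecs_le ts(3) by metis
    then show "length ts \<le> k" using card_Fix_pos[of N w] by simp
  qed
  then show ?thesis using ts(3) by (simp add: length_B_def)
qed

lemma length_B_eqI:
  assumes "w \<in> hyperoctahedral N" "card (Fix N w) * 3 ^ k = card (odd_vecs N)"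
  shows "length_B N w = k"
proof -
  have "card (Fix N w) * 3 ^ k = card (Fix N w) * 3 ^ length_B N w"
    using assms card_Fix_length_B by simp
  then show ?thesis using card_Fix_pos[of N w] by simp
qed

lemma length_B_id [simp]: "length_B N id = 0"
  by (rule length_B_eqI) simp_all

lemma length_B_inv: "w \<in> hyperoctahedral N \<Longrightarrow> length_B N (inv w) = length_B N w"
  by (rule length_B_eqI) (auto simp: Fix_inv card_Fix_length_B)

lemma length_B_eq_0_iff:
  assumes "w \<in> hyperoctahedral N" shows "length_B N w = 0 \<longleftrightarrow> w = id"
proof
  assume "length_B N w = 0"
  then have "card (Fix N w) = card (odd_vecs N)" using card_Fix_length_B[OF assms] by simp
  then have eq: "Fix N w = odd_vecs N"
    by (intro card_subset_eq[OF finite_odd_vecs]) (auto simp: Fix_def)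
  show "w = id"
  proof (rule ccontr)
    assume "w \<noteq> id"
    then obtain a where wa: "w a \<noteq> a" using ex_moved by blast
    then have a: "a \<in> pm_set N" using moved_in_pm_set[OF assms] by blast
    have "evec a \<in> Fix N w" using evec_in_odd_vecs[OF a] eq by simp
    then have "evec a (w a) = evec a a" by (rule FixD)
    then show False using wa by (simp add: evec_def split: if_splits)
  qed
qed simp

lemma length_B_comp_srefl:
  assumes "w \<in> hyperoctahedral N" "a \<in> pm_set N" "b \<in> pm_set N" "a \<noteq> b"
  shows "linked N w a b \<Longrightarrow> length_B N w = Suc (length_B N (w \<circ> srefl a b))"
    and "\<not> linked N w a b \<Longrightarrow> length_B N (w \<circ> srefl a b) = Suc (length_B N w)"
proof -
  have wt: "w \<circ> srefl a b \<in> hyperoctahedral N" using assms by auto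
  show "length_B N w = Suc (length_B N (w \<circ> srefl a b))" if "linked N w a b"
    using Fix_comp_srefl_linked(1)[OF assms that] card_Fix_length_B[OF wt]
    by (intro length_B_eqI[OF assms(1)]) simp
  show "length_B N (w \<circ> srefl a b) = Suc (length_B N w)" if "\<not> linked N w a b"
    using Fix_comp_srefl_not_linked[OF assms that] card_Fix_length_B[OF assms(1)]
    by (intro length_B_eqI[OF wt]) simp
qed

lemma length_B_srefl_comp:
  assumes "w \<in> hyperoctahedral N" "a \<in> pm_set N" "b \<in> pm_set N" "a \<noteq> b"
  shows "linked N w a b \<Longrightarrow> length_B N w = Suc (length_B N (srefl a b \<circ> w))"
    and "\<not> linked N w a b \<Longrightarrow> length_B N (srefl a b \<circ> w) = Suc (length_B N w)"
proof -
  have t: "srefl a b \<in> hyperoctahedral N" using assms by auto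
  have nz: "a \<noteq> 0" "b \<noteq> 0" using assms pm_set_nonzero by auto
  have "inv (srefl a b \<circ> w) = inv w \<circ> srefl a b"
    using inv_comp_hyperoctahedral[OF t assms(1)] nz by simp
  then have "length_B N (srefl a b \<circ> w) = length_B N (inv w \<circ> srefl a b)"
    using length_B_inv[OF comp_in_hyperoctahedral[OF t assms(1)]] by simp
  then show "linked N w a b \<Longrightarrow> length_B N w = Suc (length_B N (srefl a b \<circ> w))"
    "\<not> linked N w a b \<Longrightarrow> length_B N (srefl a b \<circ> w) = Suc (length_B N w)"
    using length_B_comp_srefl[OF inv_in_hyperoctahedral[OF assms(1)] assms(2-4)]
      linked_inv[OF assms(1)] length_B_inv[OF assms(1)] by simp_all
qed

lemma length_B_srefl:
  "a \<in> pm_set N \<Longrightarrow> b \<in> pm_set N \<Longrightarrow> a \<noteq> b \<Longrightarrow> length_B N (srefl a b) = 1"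
proof -
  assume ab: "a \<in> pm_set N" "b \<in> pm_set N" "a \<noteq> b"
  have "evec a a \<noteq> evec a b" using ab(3) by (simp add: evec_def)
  then have "\<not> linked N id a b"
    using evec_in_odd_vecs[OF ab(1)] by (auto simp: linked_def)
  then show ?thesis using length_B_comp_srefl(2)[OF id_in_hyperoctahedral ab] by simp
qed

lemma length_B_comp_le:
  assumes "u \<in> hyperoctahedral N" "v \<in> hyperoctahedral N"
  shows "length_B N (u \<circ> v) \<le> length_B N u + length_B N v"
proof -
  have app: "foldr (\<circ>) ts v = foldr (\<circ>) ts id \<circ> v" for ts :: "(int \<Rightarrow> int) list"
    by (induction ts) (simp_all add: comp_assoc)
  have min: "\<exists>ts. set ts \<subseteq> gens_B N \<and> foldr (\<circ>) ts id = w \<and> length ts = length_B N w"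
    if "w \<in> hyperoctahedral N" for w
    using ex_factorization[OF that] length_B_eqI[OF that] by metis
  obtain ts us where "set ts \<subseteq> gens_B N" "foldr (\<circ>) ts id = u" "length ts = length_B N u"
    "set us \<subseteq> gens_B N" "foldr (\<circ>) us id = v" "length us = length_B N v"
    using min[OF assms(1)] min[OF assms(2)] by blast
  then have "length (ts @ us) = length_B N u + length_B N v \<and> set (ts @ us) \<subseteq> gens_B N \<and>
    foldr (\<circ>) (ts @ us) id = u \<circ> v"
    using app[of ts] by simp
  then show ?thesis unfolding length_B_def[of N "u \<circ> v"] by (intro Least_le) blast
qed

section \<open>The absolute order\<close>

lemma le_B_id [simp]: "le_B N id w"
  by (simp add: le_B_def inv_id)

lemma le_B_refl: "w \<in> hyperoctahedral N \<Longrightarrow> le_B N w w"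
  by (simp add: le_B_def)

lemma le_B_antisym:
  assumes "u \<in> hyperoctahedral N" "w \<in> hyperoctahedral N" "le_B N u w" "le_B N w u"
  shows "u = w"
proof -
  have "length_B N (inv u \<circ> w) = 0" using assms(3,4) by (simp add: le_B_def)
  then have "inv u \<circ> w = id" using assms length_B_eq_0_iff by blast
  then have "u \<circ> (inv u \<circ> w) = u" by simp
  then show ?thesis using assms(1) by (simp add: o_assoc)
qed

lemma le_B_trans:
  assumes "u \<in> hyperoctahedral N" "v \<in> hyperoctahedral N" "w \<in> hyperoctahedral N"
    "le_B N u v" "le_B N v w"
  shows "le_B N u w"
proof -
  have "(inv u \<circ> v) \<circ> (inv v \<circ> w) = inv u \<circ> w"
    using assms(2) by (simp add: fun_eq_iff)
  moreover have "length_B N ((inv u \<circ> v) \<circ> (inv v \<circ> w))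
      \<le> length_B N (inv u \<circ> v) + length_B N (inv v \<circ> w)"
    using assms by (intro length_B_comp_le) auto
  ultimately have "length_B N (inv u \<circ> w) \<le> length_B N (inv u \<circ> v) + length_B N (inv v \<circ> w)"
    by (simp only:)
  moreover have "u \<circ> (inv u \<circ> w) = w" using assms(1) by (simp add: o_assoc)
  then have "length_B N w \<le> length_B N u + length_B N (inv u \<circ> w)"
    using length_B_comp_le[of u N "inv u \<circ> w"] assms by auto
  ultimately show ?thesis using assms(4,5) by (simp add: le_B_def)
qed

definition abs_order :: "nat \<Rightarrow> (int \<Rightarrow> int) rel" where
  "abs_order N = {(u, w). u \<in> hyperoctahedral N \<and> w \<in> hyperoctahedral N \<and> le_B N u w}"

lemma partial_order_on_abs_order: "partial_order_on (hyperoctahedral N) (abs_order N)"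
  unfolding partial_order_on_def preorder_on_def
proof (intro conjI)
  show "abs_order N \<subseteq> hyperoctahedral N \<times> hyperoctahedral N"
    by (auto simp: abs_order_def)
  show "refl_on (hyperoctahedral N) (abs_order N)"
    by (auto simp: abs_order_def refl_on_def le_B_refl)
  show "trans (abs_order N)"
    by (rule transI) (auto simp: abs_order_def intro: le_B_trans)
  show "antisym (abs_order N)"
    by (rule antisymI) (auto simp: abs_order_def intro: le_B_antisym)
qed

text \<open>
  Strip reflections from the right of a factor \<open>c\<close> that is split off additively. Each of them is
  linked both to \<open>c\<close> and to \<open>u \<circ> c\<close>, so the fixed space only grows on the way from \<open>u \<circ> c\<close> to \<open>u\<close>.
\<close>

lemma le_B_imp_Fix_subset:
  assumes "u \<in> hyperoctahedral N" "c \<in> hyperoctahedral N"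
    and "length_B N (u \<circ> c) = length_B N u + length_B N c"
  shows "Fix N (u \<circ> c) \<subseteq> Fix N u"
  using assms(2,3)
proof (induction "length_B N c" arbitrary: c)
  case 0
  then have "c = id" using length_B_eq_0_iff by simp
  then show ?case by simp
next
  case (Suc n)
  note c = Suc.prems(1)
  have "c \<noteq> id" using Suc.hyps(2) by auto
  then have "inv c \<noteq> id" using comp_inv_hyperoctahedral(3)[OF c] inv_id by metis
  then obtain i where i: "inv c i \<noteq> i" using ex_moved by blast
  have ic: "inv c \<in> hyperoctahedral N" using c by blast
  define a where "a = inv c i"
  have ab: "i \<in> pm_set N" "a \<in> pm_set N" "a \<noteq> i"
    using moved_in_pm_set[OF ic i] hyperoctahedralD(5)[OF ic] i by (simp_all add: a_def)
  define c' where "c' = c \<circ> srefl a i"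
  have c': "c' \<in> hyperoctahedral N" using c ab by (auto simp: c'_def)
  have "linked N c a i" using linked_apply[of N "inv c" i] linked_inv[OF c] by (simp add: a_def)
  then have lc: "length_B N c = Suc (length_B N c')"
    using length_B_comp_srefl(1)[OF c ab(2,1,3)] by (simp add: c'_def)
  have uc: "u \<circ> c \<in> hyperoctahedral N" using assms(1) c by auto
  have eq: "u \<circ> c \<circ> srefl a i = u \<circ> c'" by (simp add: c'_def o_assoc)
  have le: "length_B N (u \<circ> c') \<le> length_B N u + length_B N c'"
    using length_B_comp_le[OF assms(1) c'] .
  have lk: "linked N (u \<circ> c) a i"
  proof (rule ccontr)
    assume "\<not> linked N (u \<circ> c) a i"
    then have "length_B N (u \<circ> c') = Suc (length_B N (u \<circ> c))"
      using length_B_comp_srefl(2)[OF uc ab(2,1,3)] eq by simp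
    then show False using le lc Suc.prems(2) by simp
  qed
  have "length_B N (u \<circ> c) = Suc (length_B N (u \<circ> c'))"
    using length_B_comp_srefl(1)[OF uc ab(2,1,3) lk] eq by simp
  then have "length_B N (u \<circ> c') = length_B N u + length_B N c'"
    using Suc.prems(2) lc by simp
  then have "Fix N (u \<circ> c') \<subseteq> Fix N u"
    using Suc.hyps(1)[of c'] Suc.hyps(2) lc c' by simp
  moreover have "Fix N (u \<circ> c) \<subseteq> Fix N (u \<circ> c')"
    using Fix_comp_srefl_linked(2)[OF uc ab(2,1,3) lk] eq by auto
  ultimately show ?case by blast
qed

lemma le_B_Fix_subset:
  assumes "u \<in> hyperoctahedral N" "w \<in> hyperoctahedral N" "le_B N u w"
  shows "Fix N w \<subseteq> Fix N u"
proof -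
  have "u \<circ> (inv u \<circ> w) = w" using assms(1) by (simp add: o_assoc)
  then show ?thesis
    using le_B_imp_Fix_subset[of u N "inv u \<circ> w"] assms by (auto simp: le_B_def)
qed

lemma Fix_srefl_comp_linked:
  assumes "w \<in> hyperoctahedral N" "a \<in> pm_set N" "b \<in> pm_set N" "a \<noteq> b" "linked N w a b"
  shows "card (Fix N (srefl a b \<circ> w)) = 3 * card (Fix N w)"
    and "Fix N w \<subseteq> Fix N (srefl a b \<circ> w)"
  using Fix_comp_srefl_linked[OF inv_in_hyperoctahedral[OF assms(1)] assms(2-4)]
    linked_inv[OF assms(1)] assms(5)
  by (auto simp: Fix_srefl_comp[OF assms(1-3)] Fix_inv[OF assms(1)])

text \<open>
  Below a common element \<open>w\<close> the fixed space determines the order. Take a reflection \<open>t\<close> below \<open>u\<close>; it is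
  linked to \<open>u\<close>, hence to \<open>v\<close> and to \<open>w\<close>, and can be removed from all three at once. The difficulty is that
  the inclusion of fixed spaces must survive the removal. If a pair \<open>j\<close>, \<open>i\<close> linked to \<open>t \<circ> u\<close> were not
  linked to \<open>t \<circ> v\<close>, then, by comparing cardinalities, the fixed space of \<open>v\<close> would be the hyperplane
  \<open>x j = x i\<close> in that of \<open>t \<circ> v\<close>. This hyperplane contains the fixed space of \<open>t \<circ> w\<close>, so \<open>t\<close> would be
  linked to \<open>t \<circ> w\<close>, contradicting that \<open>t \<circ> w\<close> is shorter than \<open>w\<close>.

  The statement is false without the common upper bound: distinct elements may have the same fixed space.
\<close>

lemma Fix_subset_imp_le_B:
  assumes "u \<in> hyperoctahedral N" "v \<in> hyperoctahedral N" "w \<in> hyperoctahedral N"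
    "le_B N u w" "le_B N v w" "Fix N v \<subseteq> Fix N u"
  shows "le_B N u v"
  using assms
proof (induction "length_B N u" arbitrary: u v w)
  case 0
  then have "u = id" using length_B_eq_0_iff[of u N] by simp
  then show ?case by (simp only: le_B_id)
next
  case (Suc n)
  note u = Suc.prems(1) and v = Suc.prems(2) and w = Suc.prems(3)
  have "u \<noteq> id" using Suc.hyps(2) by auto
  then obtain b where "u b \<noteq> b" using ex_moved by blast
  define a where "a = u b"
  have ab: "a \<in> pm_set N" "b \<in> pm_set N" "a \<noteq> b"
    using moved_in_pm_set[OF u \<open>u b \<noteq> b\<close>] hyperoctahedralD(5)[OF u] \<open>u b \<noteq> b\<close>
    by (simp_all add: a_def)
  have nz: "a \<noteq> 0" "b \<noteq> 0" using ab pm_set_nonzero by auto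
  let ?t = "srefl a b"
  have t: "?t \<in> hyperoctahedral N" using ab by blast
  have lu: "linked N u a b" using linked_apply by (simp add: a_def)
  have lv: "linked N v a b" by (rule linked_mono[OF lu Suc.prems(6)])
  have lw: "linked N w a b" by (rule linked_mono[OF lu le_B_Fix_subset[OF u w Suc.prems(4)]])
  have cancel: "inv (?t \<circ> x) \<circ> (?t \<circ> y) = inv x \<circ> y" if "x \<in> hyperoctahedral N" for x y
    using inv_comp_hyperoctahedral[OF t that] nz by (simp add: fun_eq_iff)
  have len: "length_B N x = Suc (length_B N (?t \<circ> x))" if "x \<in> hyperoctahedral N" "linked N x a b" for x
    by (rule length_B_srefl_comp(1)[OF that(1) ab that(2)])
  have H: "?t \<circ> u \<in> hyperoctahedral N" "?t \<circ> v \<in> hyperoctahedral N" "?t \<circ> w \<in> hyperoctahedral N"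
    using t u v w by auto
  have le': "le_B N (?t \<circ> u) (?t \<circ> w)" "le_B N (?t \<circ> v) (?t \<circ> w)"
    using Suc.prems(4,5) len[OF u lu] len[OF v lv] len[OF w lw]
    by (simp_all add: le_B_def cancel u v)
  have "Fix N (?t \<circ> v) \<subseteq> Fix N (?t \<circ> u)"
  proof
    fix x assume x: "x \<in> Fix N (?t \<circ> v)"
    have "x ((?t \<circ> u) i) = x i" for i
    proof (cases "(?t \<circ> u) i = i")
      case False
      define j where "j = (?t \<circ> u) i"
      have lu': "linked N (?t \<circ> u) j i" using linked_apply[of N "?t \<circ> u" i] by (simp add: j_def)
      have "linked N (?t \<circ> v) j i"
      proof (rule ccontr)
        assume nl: "\<not> linked N (?t \<circ> v) j i"
        have lv': "linked N v j i"
          using linked_mono[OF linked_mono[OF lu' Fix_srefl_comp_linked(2)[OF u ab lu]] Suc.prems(6)] .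
        let ?I = "{x \<in> Fix N (?t \<circ> v). x j = x i}"
        have "Fix N v \<subseteq> ?I"
          using Fix_srefl_comp_linked(2)[OF v ab lv] linkedD[OF lv'] by blast
        moreover have "card (Fix N v) = card ?I"
          using card_Fix_not_linked[OF nl] Fix_srefl_comp_linked(1)[OF v ab lv] by simp
        ultimately have "Fix N v = ?I"
          by (intro card_subset_eq) (auto simp: finite_Fix)
        moreover have "Fix N (?t \<circ> w) \<subseteq> ?I"
          using le_B_Fix_subset[OF H(2,3) le'(2)]
            linkedD[OF linked_mono[OF lu' le_B_Fix_subset[OF H(1,3) le'(1)]]] by blast
        ultimately have "linked N (?t \<circ> w) a b" using linked_mono[OF lv] by blast
        then have "length_B N (?t \<circ> w) = Suc (length_B N (?t \<circ> (?t \<circ> w)))" by (rule len[OF H(3)])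
        moreover have "?t \<circ> (?t \<circ> w) = w" using nz by (simp add: o_assoc)
        ultimately show False using len[OF w lw] by simp
      qed
      then show ?thesis using linkedD x by (simp add: j_def)
    qed simp
    then show "x \<in> Fix N (?t \<circ> u)" using FixD(2)[OF x] by (simp add: Fix_def)
  qed
  then have "le_B N (?t \<circ> u) (?t \<circ> v)"
    using Suc.hyps(1)[OF _ H le'] Suc.hyps(2) len[OF u lu] by simp
  then show ?case
    using len[OF u lu] len[OF v lv] by (simp add: le_B_def cancel u)
qed

section \<open>Merged orbits and fixed spaces\<close>

lemma orbit_eq_hyperoctahedral:
  assumes "w \<in> hyperoctahedral N" "j \<in> orbit w i"
  shows "orbit w j = orbit w i"
proof -
  note self = permutation_self_in_orbit[OF permutation_hyperoctahedral[OF assms(1)]]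
  have "i \<in> orbit w j" using orbit_swap[OF self assms(2)] .
  then show ?thesis using assms(2) orbit_trans by fast
qed

lemma inv_blocks_iff:
  assumes w: "w \<in> hyperoctahedral N" and i: "i \<in> pm_set N"
  shows "orbit w i \<in> inv_blocks (Orb N w) \<longleftrightarrow> - i \<in> orbit w i"
proof
  note self = permutation_self_in_orbit[OF permutation_hyperoctahedral[OF w]]
  assume "orbit w i \<in> inv_blocks (Orb N w)"
  then show "- i \<in> orbit w i" using self[of i] unfolding inv_blocks_def by blast
next
  assume i': "- i \<in> orbit w i"
  have sub: "uminus ` orbit w i \<subseteq> orbit w i"
    using orbit_uminus[OF w] orbit_eq_hyperoctahedral[OF w i'] by blast
  then have "uminus ` uminus ` orbit w i \<subseteq> uminus ` orbit w i" by (rule image_mono)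
  then have "orbit w i \<subseteq> uminus ` orbit w i" by (simp add: image_image)
  then show "orbit w i \<in> inv_blocks (Orb N w)" using sub i by (auto simp: inv_blocks_def Orb_def)
qed

text \<open>
  Fixed vectors are constant on orbits and vanish on inversion-invariant orbits, and nothing else
  constrains them. So they cannot distinguish the inversion-invariant orbits from each other, which is
  why these have to be merged.
\<close>

lemma Orb_merged_linked:
  assumes w: "w \<in> hyperoctahedral N" and i: "i \<in> pm_set N" and j: "j \<in> pm_set N"
  shows "(\<exists>X\<in>Orb_merged N w. i \<in> X \<and> j \<in> X) \<longleftrightarrow> linked N w i j"
proof -
  note self = permutation_self_in_orbit[OF permutation_hyperoctahedral[OF w]]
  define Z where "Z = inv_blocks (Orb N w)"
  have OM: "Orb_merged N w = (if Z = {} then Orb N w else insert (\<Union>Z) (Orb N w - Z))"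
    by (simp add: Orb_merged_def Z_def Let_def)
  have ZO: "Z \<subseteq> Orb N w" by (auto simp: Z_def inv_blocks_def)
  have orb: "A = orbit w m" if "A \<in> Orb N w" "m \<in> A" for A m
    using that orbit_eq_hyperoctahedral[OF w] by (auto simp: Orb_def)
  have inZ: "- m \<in> orbit w m" if "m \<in> \<Union>Z" "m \<in> pm_set N" for m
    using that orb ZO inv_blocks_iff[OF w that(2)] unfolding Z_def by blast
  have UZ: "m \<in> \<Union>Z" if "- m \<in> orbit w m" "m \<in> pm_set N" for m
    using that inv_blocks_iff[OF w that(2)] self[of m] unfolding Z_def by blast
  show ?thesis
  proof
    assume "\<exists>X\<in>Orb_merged N w. i \<in> X \<and> j \<in> X"
    then obtain X where X: "X \<in> Orb_merged N w" "i \<in> X" "j \<in> X" by blast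
    then consider "X \<in> Orb N w" | "X = \<Union>Z" by (auto simp: OM split: if_splits)
    then show "linked N w i j"
    proof cases
      case 1
      then show ?thesis using orb X linked_iff[OF w i j] by blast
    next
      case 2
      then show ?thesis using inZ X i j linked_iff[OF w i j] by blast
    qed
  next
    assume l: "linked N w i j"
    show "\<exists>X\<in>Orb_merged N w. i \<in> X \<and> j \<in> X"
    proof (cases "- i \<in> orbit w i \<and> - j \<in> orbit w j")
      case True
      then have "i \<in> \<Union>Z" "j \<in> \<Union>Z" using UZ i j by auto
      then show ?thesis by (intro bexI[of _ "\<Union>Z"]) (auto simp: OM)
    next
      case False
      then have jo: "j \<in> orbit w i" using l linked_iff[OF w i j] by blast
      have "- i \<notin> orbit w i"
      proof
        assume i': "- i \<in> orbit w i"
        have "orbit w (- i) = orbit w j" using orbit_eq_hyperoctahedral[OF w i'] orbit_eq_hyperoctahedral[OF w jo] by simp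
        then have "- j \<in> orbit w j" using orbit_uminus[OF w jo] by simp
        then show False using False i' by blast
      qed
      then have "orbit w i \<notin> Z" using inv_blocks_iff[OF w i] by (simp add: Z_def)
      then have "orbit w i \<in> Orb_merged N w" using i by (auto simp: OM Orb_def)
      then show ?thesis using jo self by blast
    qed
  qed
qed

lemma refines_Orb_merged_iff:
  assumes u: "u \<in> hyperoctahedral N" and v: "v \<in> hyperoctahedral N"
  shows "refines (pm_set N) (Orb_merged N u) (Orb_merged N v) \<longleftrightarrow> Fix N v \<subseteq> Fix N u"
proof
  assume r: "refines (pm_set N) (Orb_merged N u) (Orb_merged N v)"
  show "Fix N v \<subseteq> Fix N u"
  proof
    fix x assume x: "x \<in> Fix N v"
    have "x (u i) = x i" for i
    proof (cases "i \<in> pm_set N")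
      case True
      then have i': "u i \<in> pm_set N" using hyperoctahedralD(5)[OF u] by simp
      have "\<exists>X\<in>Orb_merged N u. u i \<in> X \<and> i \<in> X"
        using Orb_merged_linked[OF u i' True] linked_apply[of N u i] by simp
      then obtain X where X: "X \<in> Orb_merged N u" "u i \<in> X" "i \<in> X" by blast
      then obtain Y where "Y \<in> Orb_merged N v" "X \<subseteq> Y"
        using r unfolding refines_def by blast
      with X have "\<exists>Y\<in>Orb_merged N v. u i \<in> Y \<and> i \<in> Y" by blast
      then have "linked N v (u i) i"
        using Orb_merged_linked[OF v i' True] by simp
      then show ?thesis using x by (rule linkedD)
    next
      case False
      then show ?thesis using permutes_not_in[OF hyperoctahedralD(1)[OF u]] by simp
    qed
    then show "x \<in> Fix N u" using FixD(2)[OF x] by (simp add: Fix_def)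
  qed
next
  assume sub: "Fix N v \<subseteq> Fix N u"
  have P: "partition_on (pm_set N) (Orb_merged N u)" "partition_on (pm_set N) (Orb_merged N v)"
    using hyperoctahedralD(1) u v partition_on_Orb_merged by auto
  have "\<exists>Y\<in>Orb_merged N v. X \<subseteq> Y" if X: "X \<in> Orb_merged N u" for X
  proof -
    have "X \<noteq> {}" "X \<subseteq> pm_set N" using P(1) X by (auto simp: partition_on_def)
    then obtain i where i: "i \<in> X" "i \<in> pm_set N" by blast
    obtain Y where Y: "Y \<in> Orb_merged N v" "i \<in> Y"
      using P(2) i(2) by (auto simp: partition_on_def)
    have "j \<in> Y" if j: "j \<in> X" for j
    proof -
      have j': "j \<in> pm_set N" using j \<open>X \<subseteq> pm_set N\<close> by blast
      have "linked N u i j" using Orb_merged_linked[OF u i(2) j'] X i j by blast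
      then have "linked N v i j" using linked_mono sub by blast
      then obtain Y' where Y': "Y' \<in> Orb_merged N v" "i \<in> Y'" "j \<in> Y'"
        using Orb_merged_linked[OF v i(2) j'] by blast
      then have "Y' = Y"
        using P(2) Y unfolding partition_on_def disjoint_def by blast
      then show ?thesis using Y' by simp
    qed
    then show ?thesis using Y by blast
  qed
  then show "refines (pm_set N) (Orb_merged N u) (Orb_merged N v)"
    using P by (simp add: refines_def)
qed

section \<open>Moebius functions of finite posets\<close>

lemma moebius_self: "finite P \<Longrightarrow> partial_order_on P r \<Longrightarrow> x \<in> P \<Longrightarrow> moebius P r x x = 1"
  by (subst moebius.simps) (auto simp: partial_order_on_def preorder_on_def refl_on_def)

lemma moebius_rec:
  assumes "finite P" "partial_order_on P r" "x \<in> P" "y \<in> P" "(x, y) \<in> r" "x \<noteq> y"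
  shows "moebius P r x y = - (\<Sum>z \<in> {z \<in> P. (x, z) \<in> r \<and> (z, y) \<in> r \<and> z \<noteq> y}. moebius P r x z)"
  using assms by (subst moebius.simps) simp

lemma moebius_sum_eq_0:
  assumes "finite P" "partial_order_on P r" "x \<in> P" "y \<in> P" "(x, y) \<in> r" "x \<noteq> y"
  shows "(\<Sum>z \<in> {z \<in> P. (x, z) \<in> r \<and> (z, y) \<in> r}. moebius P r x z) = 0"
proof -
  have "(y, y) \<in> r"
    using assms(2,4) by (auto simp: partial_order_on_def preorder_on_def refl_on_def)
  then have "{z \<in> P. (x, z) \<in> r \<and> (z, y) \<in> r}
      = insert y {z \<in> P. (x, z) \<in> r \<and> (z, y) \<in> r \<and> z \<noteq> y}"
    using assms by auto
  then show ?thesis using moebius_rec[OF assms] assms(1) by simp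
qed

text \<open>
  A value of the Moebius function depends only on the interval, so it may be computed in any poset that
  contains an isomorphic copy of the lower set \<open>D\<close>.
\<close>

lemma moebius_image:
  assumes P: "finite P" "partial_order_on P r" and Q: "finite (f ` D)" "partial_order_on (f ` D) s"
    and D: "D \<subseteq> P" "\<And>z v. z \<in> P \<Longrightarrow> v \<in> D \<Longrightarrow> (z, v) \<in> r \<Longrightarrow> z \<in> D"
    and f: "\<And>u v. u \<in> D \<Longrightarrow> v \<in> D \<Longrightarrow> (f u, f v) \<in> s \<longleftrightarrow> (u, v) \<in> r"
    and x: "x \<in> D"
  shows "y \<in> D \<Longrightarrow> moebius (f ` D) s (f x) (f y) = moebius P r x y"
proof (induction "card {z \<in> P. (z, y) \<in> r}" arbitrary: y rule: less_induct)
  case less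
  note y = less.prems
  have rP: "refl_on P r" "antisym r" "trans r"
    using P(2) by (auto simp: partial_order_on_def preorder_on_def)
  have inj: "inj_on f D"
  proof (rule inj_onI)
    fix u v assume uv: "u \<in> D" "v \<in> D" "f u = f v"
    have "(f u, f u) \<in> s"
      using Q(2) uv(1) by (simp add: partial_order_on_def preorder_on_def refl_on_def)
    then have "(u, v) \<in> r" "(v, u) \<in> r"
      using f[OF uv(1,2)] f[OF uv(2,1)] uv(3) by simp_all
    then show "u = v" by (rule antisymD[OF rP(2)])
  qed
  let ?I = "{z \<in> P. (x, z) \<in> r \<and> (z, y) \<in> r \<and> z \<noteq> y}"
  have ID: "?I \<subseteq> D" using D(2) y by blast
  have eqf: "f u = f v \<longleftrightarrow> u = v" if "u \<in> D" "v \<in> D" for u v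
    using inj that by (auto simp: inj_on_def)
  have I': "{z \<in> f ` D. (f x, z) \<in> s \<and> (z, f y) \<in> s \<and> z \<noteq> f y} = f ` ?I"
    using D ID f[OF x] f[OF _ y] eqf[OF _ y] by auto
  have IH: "moebius (f ` D) s (f x) (f z) = moebius P r x z" if z: "z \<in> ?I" for z
  proof (rule less.hyps)
    have "{v \<in> P. (v, z) \<in> r} \<subseteq> {v \<in> P. (v, y) \<in> r}"
      using z rP(3) by (auto dest: transD)
    moreover have "y \<in> {v \<in> P. (v, y) \<in> r}" "y \<notin> {v \<in> P. (v, z) \<in> r}"
      using z rP(1,2) D(1) y by (auto simp: refl_on_def dest: antisymD)
    ultimately have "{v \<in> P. (v, z) \<in> r} \<subset> {v \<in> P. (v, y) \<in> r}" by blast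
    then show "card {v \<in> P. (v, z) \<in> r} < card {v \<in> P. (v, y) \<in> r}"
      using P(1) by (intro psubset_card_mono) auto
    show "z \<in> D" using ID z by blast
  qed
  have xy: "x \<in> P" "y \<in> P" using x y D(1) by auto
  consider "x = y" | "x \<noteq> y" "(x, y) \<in> r" | "(x, y) \<notin> r" by blast
  then show ?case
  proof cases
    case 1
    then show ?thesis
      using moebius_self[OF P xy(2)] moebius_self[OF Q imageI[OF y]] by simp
  next
    case 2
    have "moebius (f ` D) s (f x) (f y) = - (\<Sum>z\<in>f ` ?I. moebius (f ` D) s (f x) z)"
      using moebius_rec[OF Q, of "f x" "f y"] x y 2 f eqf unfolding I' by auto
    also have "\<dots> = - (\<Sum>z\<in>?I. moebius P r x z)"
      using IH by (subst sum.reindex[OF inj_on_subset[OF inj ID]]) simp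
    also have "\<dots> = moebius P r x y"
      using moebius_rec[OF P xy 2(2,1)] by simp
    finally show ?thesis .
  next
    case 3
    then show ?thesis using f[OF x y] by (subst (1 2) moebius.simps) simp
  qed
qed

section \<open>The Moebius function of the absolute order\<close>

definition mu :: "nat \<Rightarrow> (int \<Rightarrow> int) \<Rightarrow> int" where
  "mu N w = moebius (hyperoctahedral N) (abs_order N) id w"

lemma mu_id [simp]: "mu N id = 1"
  unfolding mu_def
  by (rule moebius_self[OF finite_hyperoctahedral partial_order_on_abs_order id_in_hyperoctahedral])

lemma mu_sum_eq_0:
  assumes "w \<in> hyperoctahedral N" "w \<noteq> id"
  shows "(\<Sum>u \<in> {u \<in> hyperoctahedral N. le_B N u w}. mu N u) = 0"
proof -
  have "{u \<in> hyperoctahedral N. le_B N u w}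
      = {u \<in> hyperoctahedral N. (id, u) \<in> abs_order N \<and> (u, w) \<in> abs_order N}"
    using assms(1) by (auto simp: abs_order_def)
  then show ?thesis
    using moebius_sum_eq_0[OF finite_hyperoctahedral partial_order_on_abs_order
        id_in_hyperoctahedral assms(1)] assms
    by (simp add: mu_def abs_order_def)
qed

lemma srefl_same: "srefl k k = id"
  by (auto simp: srefl_def)

text \<open>
  Let \<open>k\<close> be a point moved by \<open>w\<close>. Every group element \<open>c\<close> factors uniquely as \<open>t \<circ> g\<close>, where \<open>g\<close> fixes \<open>k\<close>
  and \<open>t\<close> is the identity or a reflection moving \<open>k\<close>, namely \<open>t = srefl (c k) k\<close>, and lengths add up.
  Here the identity is \<open>srefl k k\<close>. Writing \<open>w = u \<circ> c\<close> for every \<open>u\<close> below \<open>w\<close>, the defining relation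
  that the values \<open>mu N u\<close> with \<open>u\<close> below \<open>w\<close> sum to 0 becomes a double sum over \<open>g\<close> and \<open>t\<close>. The inner sum is
  the sum of this lemma for \<open>w \<circ> inv g\<close>, which again moves \<open>k\<close> and is shorter unless \<open>g = id\<close>.
  By induction only the term of \<open>g = id\<close> survives.
\<close>

lemma mu_strip_sum:
  assumes "k \<in> pm_set N"
  shows "w \<in> hyperoctahedral N \<Longrightarrow> w k \<noteq> k \<Longrightarrow>
    (\<Sum>a\<in>{a \<in> pm_set N. linked N w a k}. mu N (w \<circ> srefl a k)) = 0"
proof (induction "length_B N w" arbitrary: w rule: less_induct)
  case less
  note w = less.prems(1)
  let ?H = "hyperoctahedral N" and ?A = "\<lambda>v. {a \<in> pm_set N. linked N v a k}"
  have k0: "k \<noteq> 0" using assms pm_set_nonzero by blast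
  have tt: "srefl a k (srefl a k i) = i" if "a \<in> pm_set N" for a i
    using that pm_set_nonzero k0 by simp
  have tH: "srefl a k \<in> ?H" if "a \<in> pm_set N" for a using that assms by blast
  \<comment> \<open>lengths add up in \<open>c = srefl (c k) k \<circ> g\<close>\<close>
  have len_c: "length_B N c = length_B N (srefl (c k) k) + length_B N (srefl (c k) k \<circ> c)"
    if c: "c \<in> ?H" for c
  proof (cases "c k = k")
    case True
    then show ?thesis by (simp add: srefl_same)
  next
    case False
    have "c k \<in> pm_set N" using assms hyperoctahedralD(5)[OF c] by simp
    then show ?thesis
      using length_B_srefl_comp(1)[OF c _ assms False linked_apply] length_B_srefl[OF _ assms False]
      by simp
  qed
  have A_iff: "linked N v a k \<longleftrightarrow> length_B N v = length_B N (v \<circ> srefl a k) + length_B N (srefl a k)"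
    if v: "v \<in> ?H" and a: "a \<in> pm_set N" for v a
  proof (cases "a = k")
    case True
    then show ?thesis by (simp add: srefl_same linked_def)
  next
    case False
    then show ?thesis
      using length_B_comp_srefl[OF v a assms False] length_B_srefl[OF a assms False]
      by (cases "linked N v a k") auto
  qed
  define G where "G = {g \<in> ?H. g k = k \<and> length_B N w = length_B N (w \<circ> inv g) + length_B N g}"
  have GH: "g \<in> ?H" if "g \<in> G" for g using that by (simp add: G_def)
  have invk: "inv g k = k" if "g \<in> G" for g
    using that comp_inv_hyperoctahedral(5)[of g N k] by (simp add: G_def)
  have "(\<Sum>u\<in>{u \<in> ?H. le_B N u w}. mu N u)
      = (\<Sum>(g, a)\<in>Sigma G (\<lambda>g. ?A (w \<circ> inv g)). mu N (w \<circ> inv g \<circ> srefl a k))"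
  proof (rule sum.reindex_bij_witness
      [where i = "\<lambda>(g, a). w \<circ> inv g \<circ> srefl a k"
        and j = "\<lambda>u. (srefl ((inv u \<circ> w) k) k \<circ> (inv u \<circ> w), (inv u \<circ> w) k)"])
    fix u assume "u \<in> {u \<in> ?H. le_B N u w}"
    then have u: "u \<in> ?H" and le: "length_B N w = length_B N u + length_B N (inv u \<circ> w)"
      by (auto simp: le_B_def)
    define c where "c = inv u \<circ> w"
    define a where "a = c k"
    define g where "g = srefl a k \<circ> c"
    have c: "c \<in> ?H" using u w by (auto simp: c_def)
    have a: "a \<in> pm_set N" using assms hyperoctahedralD(5)[OF c] by (simp add: a_def)
    have g: "g \<in> ?H" using tH[OF a] c by (auto simp: g_def)
    have "inv g = inv c \<circ> srefl a k"
      using inv_comp_hyperoctahedral[OF tH[OF a] c] a pm_set_nonzero k0 by (simp add: g_def)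
    moreover have "w \<circ> inv c = u"
      using inv_comp_hyperoctahedral[OF inv_in_hyperoctahedral[OF u] w] u w
      by (simp add: c_def o_assoc fun_eq_iff)
    ultimately have wg: "w \<circ> inv g = u \<circ> srefl a k" by (simp add: o_assoc)
    have wga: "w \<circ> inv g \<circ> srefl a k = u" using tt[OF a] by (simp add: wg fun_eq_iff)
    have gk: "g k = k" by (simp add: g_def a_def)
    have lc: "length_B N c = length_B N (srefl a k) + length_B N g"
      using len_c[OF c] by (simp add: a_def g_def)
    have wgH: "w \<circ> inv g \<in> ?H" using w g by auto
    have "length_B N (w \<circ> inv g) \<le> length_B N u + length_B N (srefl a k)"
      unfolding wg using length_B_comp_le[OF u tH[OF a]] .
    moreover have "w \<circ> inv g \<circ> g = w" using g by (simp add: fun_eq_iff)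
    then have "length_B N w \<le> length_B N (w \<circ> inv g) + length_B N g"
      using length_B_comp_le[OF wgH g] by simp
    ultimately have L: "length_B N (w \<circ> inv g) = length_B N u + length_B N (srefl a k)"
      "length_B N w = length_B N (w \<circ> inv g) + length_B N g"
      using le lc by (simp_all add: c_def)
    have "g \<in> G" using g gk L(2) by (simp add: G_def)
    moreover have "linked N (w \<circ> inv g) a k" using A_iff[OF wgH a] L(1) wga by simp
    ultimately have mem: "(g, a) \<in> Sigma G (\<lambda>g. ?A (w \<circ> inv g))" using a by simp
    show "(case (srefl ((inv u \<circ> w) k) k \<circ> (inv u \<circ> w), (inv u \<circ> w) k) of
        (g, a) \<Rightarrow> w \<circ> inv g \<circ> srefl a k) = u"
      using wga by (simp only: case_prod_conv c_def[symmetric] a_def[symmetric] g_def[symmetric])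
    show "(srefl ((inv u \<circ> w) k) k \<circ> (inv u \<circ> w), (inv u \<circ> w) k) \<in> Sigma G (\<lambda>g. ?A (w \<circ> inv g))"
      using mem by (simp only: c_def[symmetric] a_def[symmetric] g_def[symmetric])
    show "(case (srefl ((inv u \<circ> w) k) k \<circ> (inv u \<circ> w), (inv u \<circ> w) k) of
        (g, a) \<Rightarrow> mu N (w \<circ> inv g \<circ> srefl a k)) = mu N u"
      using wga by (simp only: case_prod_conv c_def[symmetric] a_def[symmetric] g_def[symmetric])
  next
    fix ga assume "ga \<in> Sigma G (\<lambda>g. ?A (w \<circ> inv g))"
    then obtain g a where ga: "ga = (g, a)" and gG: "g \<in> G" and a: "a \<in> pm_set N"
      and lk: "linked N (w \<circ> inv g) a k" by auto
    have g: "g \<in> ?H" and gk: "g k = k" using gG by (auto simp: G_def)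
    have wgH: "w \<circ> inv g \<in> ?H" using w g by auto
    define u where "u = w \<circ> inv g \<circ> srefl a k"
    have u: "u \<in> ?H" using wgH tH[OF a] by (auto simp: u_def)
    have "u \<circ> (srefl a k \<circ> g) = w" using tt[OF a] g by (simp add: u_def fun_eq_iff)
    then have "inv u \<circ> w = (inv u \<circ> u) \<circ> (srefl a k \<circ> g)" by (metis comp_assoc)
    then have c: "inv u \<circ> w = srefl a k \<circ> g" using u by simp
    then have ck: "(inv u \<circ> w) k = a" using gk by simp
    have gg: "srefl a k \<circ> (inv u \<circ> w) = g" using tt[OF a] c by (simp add: fun_eq_iff)
    have "length_B N w = length_B N u + length_B N (srefl a k) + length_B N g"
      using gG A_iff[OF wgH a] lk by (simp add: G_def u_def)
    moreover have "length_B N (inv u \<circ> w) = length_B N (srefl a k) + length_B N g"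
      using len_c[of "inv u \<circ> w"] u w ck gg by auto
    ultimately have "le_B N u w" by (simp add: le_B_def)
    then show "(case ga of (g, a) \<Rightarrow> w \<circ> inv g \<circ> srefl a k) \<in> {u \<in> ?H. le_B N u w}"
      using u by (simp add: ga u_def)
    show "(srefl ((inv (case ga of (g, a) \<Rightarrow> w \<circ> inv g \<circ> srefl a k) \<circ> w) k) k \<circ>
          (inv (case ga of (g, a) \<Rightarrow> w \<circ> inv g \<circ> srefl a k) \<circ> w),
          (inv (case ga of (g, a) \<Rightarrow> w \<circ> inv g \<circ> srefl a k) \<circ> w) k) = ga"
      using ck gg by (simp only: ga case_prod_conv u_def[symmetric])
  qed
  also have "\<dots> = (\<Sum>g\<in>G. \<Sum>a\<in>?A (w \<circ> inv g). mu N (w \<circ> inv g \<circ> srefl a k))"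
  proof (rule sum.Sigma[symmetric])
    show "finite G" by (rule finite_subset[OF _ finite_hyperoctahedral[of N]]) (auto simp: G_def)
  qed (simp add: finite_pm_set)
  also have "\<dots> = (\<Sum>g\<in>{id}. \<Sum>a\<in>?A (w \<circ> inv g). mu N (w \<circ> inv g \<circ> srefl a k))"
  proof (rule sum.mono_neutral_right)
    show "finite G" by (rule finite_subset[OF _ finite_hyperoctahedral[of N]]) (auto simp: G_def)
    show "{id} \<subseteq> G" by (simp add: G_def inv_id)
    show "\<forall>g\<in>G - {id}. (\<Sum>a\<in>?A (w \<circ> inv g). mu N (w \<circ> inv g \<circ> srefl a k)) = 0"
    proof
      fix g assume g: "g \<in> G - {id}"
      then have "length_B N g \<noteq> 0" using length_B_eq_0_iff GH by blast
      then have "length_B N (w \<circ> inv g) < length_B N w" using g by (simp add: G_def)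
      moreover have "w \<circ> inv g \<in> ?H" using w GH g by auto
      moreover have "(w \<circ> inv g) k \<noteq> k" using invk g less.prems(2) by simp
      ultimately show "(\<Sum>a\<in>?A (w \<circ> inv g). mu N (w \<circ> inv g \<circ> srefl a k)) = 0"
        by (rule less.hyps)
    qed
  qed
  also have "\<dots> = (\<Sum>a\<in>?A w. mu N (w \<circ> srefl a k))" by (simp add: inv_id)
  finally have "(\<Sum>u\<in>{u \<in> ?H. le_B N u w}. mu N u) = (\<Sum>a\<in>?A w. mu N (w \<circ> srefl a k))" .
  moreover have "w \<noteq> id" using less.prems(2) by (metis id_apply)
  ultimately show ?case using mu_sum_eq_0[OF w] by simp
qed

text \<open>
  This recursion involves only the reflections that move one chosen point \<open>k\<close>, instead of the whole
  interval below \<open>w\<close>. It is the tool for all evaluations below.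
\<close>

lemma mu_strip:
  assumes "k \<in> pm_set N" "w \<in> hyperoctahedral N" "w k \<noteq> k"
  shows "mu N w = - (\<Sum>a\<in>{a \<in> pm_set N. a \<noteq> k \<and> linked N w a k}. mu N (w \<circ> srefl a k))"
proof -
  have "{a \<in> pm_set N. linked N w a k} = insert k {a \<in> pm_set N. a \<noteq> k \<and> linked N w a k}"
    using assms(1) by (auto simp: linked_def)
  then show ?thesis
    using mu_strip_sum[OF assms] finite_pm_set by (simp add: srefl_same)
qed

text \<open>
  All elements of \<open>S_nc_B p q\<close> lie below \<open>gamma_B p q\<close>, so on them merged orbits, fixed spaces and the
  absolute order carry the same information.
\<close>

lemma moebius_NC_B_eq_mu:
  assumes g: "gamma_B p q \<in> hyperoctahedral (p + q)"
  shows "moebius (NC_B p q) (NC_B_rel p q) (Orb_merged (p + q) id) (Orb_merged (p + q) (gamma_B p q))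
    = mu (p + q) (gamma_B p q)"
proof -
  let ?N = "p + q" and ?D = "S_nc_B p q" and ?f = "Orb_merged (p + q)"
  have DH: "?D \<subseteq> hyperoctahedral ?N" by (auto simp: S_nc_B_def)
  have "moebius (?f ` ?D) (NC_B_rel p q) (?f id) (?f (gamma_B p q))
      = moebius (hyperoctahedral ?N) (abs_order ?N) id (gamma_B p q)"
  proof (rule moebius_image[OF finite_hyperoctahedral partial_order_on_abs_order _ _ DH])
    show "finite (?f ` ?D)" using finite_NC_B[of p q] by (simp add: NC_B_def)
    show "partial_order_on (?f ` ?D) (NC_B_rel p q)"
      using partial_order_on_NC_B[of p q] by (simp add: NC_B_def)
    show "z \<in> ?D" if "z \<in> hyperoctahedral ?N" "v \<in> ?D" "(z, v) \<in> abs_order ?N" for z v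
      using that g le_B_trans[of z ?N v "gamma_B p q"] by (auto simp: S_nc_B_def abs_order_def)
    show "(?f u, ?f v) \<in> NC_B_rel p q \<longleftrightarrow> (u, v) \<in> abs_order ?N" if "u \<in> ?D" "v \<in> ?D" for u v
    proof -
      have uv: "u \<in> hyperoctahedral ?N" "v \<in> hyperoctahedral ?N"
        "le_B ?N u (gamma_B p q)" "le_B ?N v (gamma_B p q)"
        using that by (auto simp: S_nc_B_def)
      have "(?f u, ?f v) \<in> NC_B_rel p q \<longleftrightarrow> Fix ?N v \<subseteq> Fix ?N u"
        using that refines_Orb_merged_iff[OF uv(1,2)] by (auto simp: NC_B_rel_def NC_B_def)
      also have "\<dots> \<longleftrightarrow> le_B ?N u v"
        using Fix_subset_imp_le_B[OF uv(1,2) g uv(3,4)] le_B_Fix_subset[OF uv(1,2)] by blast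
      finally show ?thesis using uv by (simp add: abs_order_def)
    qed
    show "id \<in> ?D" by (simp add: S_nc_B_def)
    show "gamma_B p q \<in> ?D" using g le_B_refl by (simp add: S_nc_B_def)
  qed
  then show ?thesis by (simp add: NC_B_def mu_def)
qed

section \<open>Catalan numbers\<close>

text \<open>
  The usual quotient of the central binomial coefficient by \<open>n + 1\<close>, written as a difference so that it is
  visibly an integer.
\<close>

definition catalan :: "nat \<Rightarrow> int" where
  "catalan n = int ((2 * n) choose n) - int ((2 * n) choose Suc n)"

lemma Suc_times_catalan: "(int n + 1) * catalan n = int ((2 * n) choose n)"
proof -
  have "(2 * n - n) * ((2 * n) choose n) = Suc n * ((2 * n) choose Suc n)"
    using binomial_absorb_comp[of "2 * n" n] binomial_absorption[of n "2 * n"] by simp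
  then have "int n * int ((2 * n) choose n) = (int n + 1) * int ((2 * n) choose Suc n)"
    by (metis add_diff_cancel_right' mult_2 of_nat_Suc of_nat_mult add.commute)
  then show ?thesis unfolding catalan_def by (simp add: algebra_simps)
qed

lemma catalan_0 [simp]: "catalan 0 = 1"
  by (simp add: catalan_def)

text \<open>
  The generating functions of central binomial coefficients and of Catalan numbers come from the powers
  of \<open>1 - 4 * x\<close> with exponents \<open>- 1 / 2\<close> and \<open>1 / 2\<close>. With generalized binomial coefficients in place of
  power series, their products are evaluated by Vandermonde's convolution.
\<close>

lemma central_binomial_gchoose: "real ((2 * n) choose n) = (- 4) ^ n * ((- 1 / 2) gchoose n)"
proof (induction n)
  case (Suc n)
  have 1: "Suc n * ((2 * Suc n) choose Suc n) = 2 * Suc n * (Suc (2 * n) choose n)"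
    using binomial_absorption[of n "2 * Suc n"] by simp
  have 2: "Suc n * (Suc (2 * n) choose n) = Suc (2 * n) * ((2 * n) choose n)"
    using binomial_absorb_comp[of "Suc (2 * n)" n] by simp
  have "Suc n * ((2 * Suc n) choose Suc n) = Suc n * (2 * (Suc (2 * n) choose n))"
    using 1 by (simp only: mult_ac)
  then have "(2 * Suc n) choose Suc n = 2 * (Suc (2 * n) choose n)"
    by (simp only: mult_left_cancel[of "Suc n"])
  then have "Suc n * ((2 * Suc n) choose Suc n) = 2 * (2 * n + 1) * ((2 * n) choose n)"
    using 2 by (simp add: algebra_simps)
  then have "real (Suc n * ((2 * Suc n) choose Suc n)) = real (2 * (2 * n + 1) * ((2 * n) choose n))"
    by (rule arg_cong)
  then have "(real n + 1) * real ((2 * Suc n) choose Suc n) = 2 * (2 * real n + 1) * real ((2 * n) choose n)"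
    by (simp only: of_nat_mult of_nat_Suc of_nat_add of_nat_numeral of_nat_1 add.commute)
  also have "\<dots> = (- 4) ^ Suc n * (((- 1 / 2) - real n) * ((- 1 / 2) gchoose n))"
    unfolding Suc.IH by (simp add: algebra_simps)
  also have "((- 1 / 2) - real n) * ((- 1 / 2) gchoose n) = (real n + 1) * ((- 1 / 2) gchoose Suc n)"
    using gbinomial_mult_1[of "- 1 / 2 :: real" n] by (simp add: algebra_simps)
  finally have "(real n + 1) * real ((2 * Suc n) choose Suc n)
      = (real n + 1) * ((- 4) ^ Suc n * ((- 1 / 2) gchoose Suc n))"
    by (simp only: mult_ac)
  then show ?case by (simp only: mult_left_cancel)
qed simp

lemma catalan_gchoose: "real_of_int (catalan n) = - ((- 4) ^ Suc n * ((1 / 2) gchoose Suc n)) / 2"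
proof -
  have "real_of_int ((int n + 1) * catalan n) = real ((2 * n) choose n)"
    by (simp only: Suc_times_catalan of_int_of_nat_eq)
  then have "(real n + 1) * real_of_int (catalan n) = (- 4) ^ n * ((- 1 / 2) gchoose n)"
    by (simp add: central_binomial_gchoose)
  moreover have "(real n + 1) * ((1 / 2) gchoose Suc n) = (1 / 2) * ((- 1 / 2) gchoose n)"
    using gbinomial_absorption[of n "1 / 2 :: real"] by (simp add: algebra_simps)
  then have "((- 1 / 2) gchoose n) = (real n + 1) * (2 * ((1 / 2) gchoose Suc n))"
    by (simp add: algebra_simps)
  ultimately have "(real n + 1) * real_of_int (catalan n)
      = (real n + 1) * (- ((- 4) ^ Suc n * ((1 / 2) gchoose Suc n)) / 2)"
    by simp
  then show ?thesis by (simp only: mult_left_cancel)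
qed

text \<open>
  Compare coefficients in \<open>sqrt (1 - 4 * x) * sqrt (1 - 4 * x) = 1 - 4 * x\<close>.
\<close>

lemma catalan_Suc: "catalan (Suc n) = (\<Sum>i\<le>n. catalan i * catalan (n - i))"
proof -
  let ?h = "\<lambda>i. (1 / 2 :: real) gchoose i"
  have "0 = (\<Sum>i\<le>Suc (Suc n). ?h i * ?h (Suc (Suc n) - i))"
    using gbinomial_Vandermonde[of "1 / 2 :: real" "1 / 2" "Suc (Suc n)"]
      binomial_gbinomial[of 1 "Suc (Suc n)", where 'a = real]
    by (simp add: atMost_atLeast0)
  also have "\<dots> = ?h 0 * ?h (Suc (Suc n)) + (\<Sum>i\<le>n. ?h (Suc i) * ?h (Suc (n - i))) + ?h (Suc (Suc n)) * ?h 0"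
    by (subst sum.atMost_Suc_shift, subst sum.atMost_Suc) (simp add: Suc_diff_le algebra_simps)
  finally have "(\<Sum>i\<le>n. ?h (Suc i) * ?h (Suc (n - i))) = - 2 * ?h (Suc (Suc n))"
    by simp
  moreover have "real_of_int (\<Sum>i\<le>n. catalan i * catalan (n - i))
      = (- 4) ^ Suc (Suc n) / 4 * (\<Sum>i\<le>n. ?h (Suc i) * ?h (Suc (n - i)))"
    unfolding of_int_sum of_int_mult sum_distrib_left catalan_gchoose
  proof (rule sum.cong[OF refl], goal_cases)
    case (1 i)
    then have "(- 4 :: real) ^ Suc (Suc n) = (- 4) ^ Suc i * (- 4) ^ Suc (n - i)"
      by (simp flip: power_add)
    then show ?case by simp
  qed
  ultimately have "real_of_int (\<Sum>i\<le>n. catalan i * catalan (n - i)) = real_of_int (catalan (Suc n))"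
    by (simp add: catalan_gchoose)
  then show ?thesis by (simp only: of_int_eq_iff)
qed

text \<open>
  Compare coefficients in \<open>sqrt (1 - 4 * x) * (1 / sqrt (1 - 4 * x)) = 1\<close>.
\<close>

lemma central_binomial_catalan:
  "int ((2 * Suc n) choose Suc n) = 2 * (\<Sum>i\<le>n. catalan i * int ((2 * (n - i)) choose (n - i)))"
proof -
  let ?h = "\<lambda>i. (1 / 2 :: real) gchoose i" and ?r = "\<lambda>i. (- 1 / 2 :: real) gchoose i"
  have "0 = (\<Sum>i\<le>Suc n. ?h i * ?r (Suc n - i))"
    using gbinomial_Vandermonde[of "1 / 2 :: real" "- 1 / 2" "Suc n"]
    by (simp add: atMost_atLeast0)
  also have "\<dots> = ?r (Suc n) + (\<Sum>i\<le>n. ?h (Suc i) * ?r (n - i))"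
    by (subst sum.atMost_Suc_shift) simp
  finally have *: "(\<Sum>i\<le>n. ?h (Suc i) * ?r (n - i)) = - ?r (Suc n)" by simp
  have "real_of_int (\<Sum>i\<le>n. catalan i * int ((2 * (n - i)) choose (n - i)))
      = - ((- 4) ^ Suc n) / 2 * (\<Sum>i\<le>n. ?h (Suc i) * ?r (n - i))"
    unfolding of_int_sum of_int_mult sum_distrib_left catalan_gchoose of_int_of_nat_eq
      central_binomial_gchoose
  proof (rule sum.cong[OF refl], goal_cases)
    case (1 i)
    then have "(- 4 :: real) ^ Suc n = (- 4) ^ Suc i * (- 4) ^ (n - i)"
      by (simp flip: power_add)
    then show ?case by simp
  qed
  then have "real_of_int (2 * (\<Sum>i\<le>n. catalan i * int ((2 * (n - i)) choose (n - i))))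
      = real_of_int (int ((2 * Suc n) choose Suc n))"
    unfolding of_int_of_nat_eq central_binomial_gchoose * by (simp add: *)
  then show ?thesis by (simp only: of_int_eq_iff)
qed

section \<open>The numbers attached to a disc and to an annulus\<close>

text \<open>
  Up to sign the Moebius value of a single negative cycle of length \<open>m\<close>; the value 1 at \<open>m = 0\<close> stands for
  the absence of the cycle.
\<close>

definition disc_count :: "nat \<Rightarrow> int" where
  "disc_count m = (if m = 0 then 1 else int ((2 * m - 1) choose m))"

text \<open>
  The contribution of joining the two negative cycles: once the first cycle has been shortened to \<open>j + 1\<close>
  elements, which accounts for the central binomial coefficient, it is joined with the second one in
  \<open>2 * q\<close> ways, giving a positive cycle with \<open>j + 1 + q\<close> elements, whose Moebius value is a Catalan
  number up to sign.
\<close>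

definition join_count :: "nat \<Rightarrow> nat \<Rightarrow> int" where
  "join_count p q = (\<Sum>j<p. int ((2 * (p - 1 - j)) choose (p - 1 - j)) * (2 * int q * catalan (j + q)))"

text \<open>
  Up to sign the Moebius value of two negative cycles of lengths \<open>p\<close> and \<open>q\<close>: either they are resolved
  separately, or they get joined.
\<close>

definition annulus_count :: "nat \<Rightarrow> nat \<Rightarrow> int" where
  "annulus_count p q = disc_count p * disc_count q + join_count p q"

lemma double_disc_count: "m > 0 \<Longrightarrow> 2 * disc_count m = int ((2 * m) choose m)"
proof -
  assume "m > 0"
  then obtain n where m: "m = Suc n" by (cases m) auto
  have "(2 * Suc n) choose Suc n = (Suc (2 * n) choose n) + (Suc (2 * n) choose Suc n)"
    by simp
  moreover have "Suc (2 * n) choose n = Suc (2 * n) choose Suc n"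
    using binomial_symmetric[of n "Suc (2 * n)"] by simp
  ultimately show ?thesis by (simp add: m disc_count_def)
qed

lemma disc_count_Suc:
  "disc_count (Suc m) = 2 * (\<Sum>i<m. catalan i * disc_count (m - i)) + catalan m"
proof -
  have "2 * disc_count (Suc m) = 2 * (\<Sum>i\<le>m. catalan i * int ((2 * (m - i)) choose (m - i)))"
    using double_disc_count[of "Suc m"] central_binomial_catalan[of m] by simp
  also have "(\<Sum>i\<le>m. catalan i * int ((2 * (m - i)) choose (m - i)))
      = (\<Sum>i<m. catalan i * int ((2 * (m - i)) choose (m - i))) + catalan m"
    by (simp flip: lessThan_Suc_atMost)
  also have "(\<Sum>i<m. catalan i * int ((2 * (m - i)) choose (m - i)))
      = (\<Sum>i<m. 2 * (catalan i * disc_count (m - i)))"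
    by (rule sum.cong[OF refl]) (simp flip: double_disc_count)
  finally show ?thesis by (simp flip: sum_distrib_left)
qed

lemma join_count_Suc:
  "join_count (Suc m) q = 2 * (\<Sum>i<m. catalan i * join_count (m - i) q) + 2 * int q * catalan (m + q)"
proof -
  define X where "X j = 2 * int q * catalan (j + q)" for j
  define c where "c n = int ((2 * n) choose n)" for n
  have c: "c (m - j) = 2 * (\<Sum>i\<in>{i\<in>{..<m}. i + j < m}. catalan i * c (m - 1 - j - i))" if "j < m" for j
  proof -
    have "m - j = Suc (m - 1 - j)" "{i\<in>{..<m}. i + j < m} = {..m - 1 - j}" using that by auto
    then show ?thesis using central_binomial_catalan[of "m - 1 - j"] by (simp add: c_def)
  qed
  have "join_count (Suc m) q = (\<Sum>j<m. c (m - j) * X j) + X m"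
    by (simp add: join_count_def c_def X_def)
  also have "(\<Sum>j<m. c (m - j) * X j)
      = (\<Sum>j<m. \<Sum>i\<in>{i\<in>{..<m}. i + j < m}. 2 * (catalan i * (c (m - 1 - j - i) * X j)))"
    by (rule sum.cong[OF refl]) (simp add: c sum_distrib_left sum_distrib_right mult_ac)
  also have "\<dots> = (\<Sum>i<m. \<Sum>j\<in>{j\<in>{..<m}. i + j < m}. 2 * (catalan i * (c (m - 1 - j - i) * X j)))"
    by (rule sum.swap_restrict) auto
  also have "\<dots> = (\<Sum>i<m. 2 * (catalan i * join_count (m - i) q))"
  proof (rule sum.cong[OF refl])
    fix i
    have "{j\<in>{..<m}. i + j < m} = {..<m - i}" by auto
    moreover have "m - 1 - j - i = m - i - 1 - j" for j by simp
    ultimately show "(\<Sum>j\<in>{j\<in>{..<m}. i + j < m}. 2 * (catalan i * (c (m - 1 - j - i) * X j)))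
        = 2 * (catalan i * join_count (m - i) q)"
      unfolding join_count_def sum_distrib_left c_def X_def by simp
  qed
  finally show ?thesis by (simp add: sum_distrib_left X_def)
qed

lemma annulus_count_0: "annulus_count 0 q = disc_count q" "annulus_count p 0 = disc_count p"
  by (simp_all add: annulus_count_def join_count_def disc_count_def)

text \<open>
  This is the recursion that \<open>mu_strip\<close> produces for two negative cycles when \<open>k\<close> is in the first of them.
\<close>

lemma annulus_count_Suc:
  "annulus_count (Suc m) q = 2 * (\<Sum>i<m. catalan i * annulus_count (m - i) q)
    + catalan m * annulus_count 0 q + 2 * int q * catalan (m + q)"
proof -
  have "annulus_count 0 q = disc_count q" by (rule annulus_count_0)
  then show ?thesis
    unfolding annulus_count_def disc_count_Suc join_count_Suc
    by (simp add: algebra_simps sum.distrib sum_distrib_left)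
qed

section \<open>The closed form\<close>

definition annulus_sum :: "nat \<Rightarrow> nat \<Rightarrow> int" where
  "annulus_sum p q = (\<Sum>c = 1..p. int c * int ((2 * p - c - 1) choose (p - 1))
                                * int ((2 * q + c - 1) choose (q - 1)))"

text \<open>
  The summand on the left was put into telescoping form by hypergeometric summation, which yields the
  cubic \<open>P\<close> as certificate. After division by the binomial coefficients it is a polynomial
  identity.
\<close>

lemma annulus_sum_telescope:
  fixes p q c :: nat
  assumes c: "1 \<le> c" "c \<le> p" and q: "q \<ge> 1"
  defines "P \<equiv> \<lambda>c. 2 * int q * (int p + 1) + (3 * int p - 3 * int q + 2) * c
      + (int q - int p - 3) * c ^ 2 + c ^ 3"
  shows "int p * ((int q + 1) * (int c * int ((2 * p + 1 - c) choose p) * int ((2 * q + c - 1) choose (q - 1)))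
      - int q * (int c * int ((2 * p - c - 1) choose (p - 1)) * int ((2 * q + c + 1) choose q)))
    = int ((2 * p - c) choose (p - 1)) * int ((2 * q + c - 1) choose (q - 1)) * P (int c)
      - int ((2 * p - c - 1) choose (p - 1)) * int ((2 * q + c) choose (q - 1)) * P (int c + 1)"
proof -
  obtain p' r where p: "p = Suc p'" "p = c + r" using c by (metis Suc_le_D le_Suc_ex le_trans One_nat_def)
  obtain q' where q': "q = Suc q'" using q by (cases q) auto
  define h1 where "h1 = int ((2 * p - c - 1) choose (p - 1))"
  define h2 where "h2 = int ((2 * q + c - 1) choose (q - 1))"
  define A where "A = int ((2 * p - c) choose (p - 1))"
  define B where "B = int ((2 * q + c) choose (q - 1))"
  define A' where "A' = int ((2 * p + 1 - c) choose p)"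
  define B' where "B' = int ((2 * q + c + 1) choose q)"
  have "(2 * p - c - (p - 1)) * ((2 * p - c) choose (p - 1)) = (2 * p - c) * ((2 * p - c - 1) choose (p - 1))"
    by (rule binomial_absorb_comp)
  then have "int ((2 * p - c - (p - 1)) * ((2 * p - c) choose (p - 1)))
      = int ((2 * p - c) * ((2 * p - c - 1) choose (p - 1)))" by (rule arg_cong)
  moreover have "int (2 * p - c - (p - 1)) = int p - int c + 1" "int (2 * p - c) = 2 * int p - int c"
    using c by (simp_all add: of_nat_diff)
  ultimately have X1: "(int p - int c + 1) * A = (2 * int p - int c) * h1"
    by (simp only: A_def h1_def of_nat_mult)
  have "p * ((2 * p + 1 - c) choose p) = (2 * p + 1 - c) * ((2 * p - c) choose (p - 1))"
    using Suc_times_binomial_eq[of "2 * p - c" p'] c p(1) by (simp add: Suc_diff_le mult_ac)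
  then have "int (p * ((2 * p + 1 - c) choose p)) = int ((2 * p + 1 - c) * ((2 * p - c) choose (p - 1)))"
    by (rule arg_cong)
  moreover have "int (2 * p + 1 - c) = 2 * int p + 1 - int c" using c by (simp add: of_nat_diff)
  ultimately have X2: "int p * A' = (2 * int p + 1 - int c) * A"
    by (simp only: A_def A'_def of_nat_mult)
  have "(2 * q + c - (q - 1)) * ((2 * q + c) choose (q - 1)) = (2 * q + c) * ((2 * q + c - 1) choose (q - 1))"
    by (rule binomial_absorb_comp)
  then have "int ((2 * q + c - (q - 1)) * ((2 * q + c) choose (q - 1)))
      = int ((2 * q + c) * ((2 * q + c - 1) choose (q - 1)))" by (rule arg_cong)
  moreover have "int (2 * q + c - (q - 1)) = int q + int c + 1"
    using q by (simp add: of_nat_diff)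
  moreover have "int (2 * q + c) = 2 * int q + int c" by simp
  ultimately have Y1: "(int q + int c + 1) * B = (2 * int q + int c) * h2"
    by (simp only: B_def h2_def of_nat_mult)
  have "q * ((2 * q + c + 1) choose q) = (2 * q + c + 1) * ((2 * q + c) choose (q - 1))"
    using Suc_times_binomial_eq[of "2 * q + c" q'] q' by (simp add: mult_ac)
  then have "int (q * ((2 * q + c + 1) choose q)) = int ((2 * q + c + 1) * ((2 * q + c) choose (q - 1)))"
    by (rule arg_cong)
  moreover have "int (2 * q + c + 1) = 2 * int q + int c + 1" by simp
  ultimately have Y2: "int q * B' = (2 * int q + int c + 1) * B"
    by (simp only: B_def B'_def of_nat_mult)
  have "int p * ((int q + 1) * (int c * A' * h2) - int q * (int c * h1 * B'))
      = (int q + 1) * int c * h2 * (int p * A') - int p * int c * h1 * (int q * B')"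
    by (simp add: algebra_simps)
  also have "\<dots> = (int q + 1) * int c * h2 * ((2 * int p + 1 - int c) * A)
      - int p * int c * h1 * ((2 * int q + int c + 1) * B)"
    unfolding X2 Y2 ..
  also have "\<dots> = A * h2 * P (int c) - h1 * B * P (int c + 1)" (is "?L = ?R")
  proof -
    let ?a = "int p - int c + 1" and ?b = "int q + int c + 1"
    have "?a * ?b * ?L = (int q + 1) * int c * h2 * (2 * int p + 1 - int c) * ?b * (?a * A)
        - int p * int c * h1 * (2 * int q + int c + 1) * ?a * (?b * B)"
      by (simp add: algebra_simps)
    also have "\<dots> = ?b * (?a * A) * h2 * P (int c) - ?a * h1 * (?b * B) * P (int c + 1)"
      unfolding X1 Y1 P_def by (simp add: algebra_simps power2_eq_square power3_eq_cube)
    also have "\<dots> = ?a * ?b * ?R" by (simp add: algebra_simps)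
    finally have "?a * ?b * ?L = ?a * ?b * ?R" .
    moreover have "?a * ?b \<noteq> 0" using c by simp
    ultimately show ?thesis by (metis mult_left_cancel)
  qed
  finally show ?thesis by (simp only: h1_def h2_def A_def B_def A'_def B'_def)
qed

text \<open>
  Summing the telescoping identity over \<open>c\<close> gives a recursion that decreases \<open>p\<close> and increases \<open>q\<close>. The
  function \<open>join_count\<close> satisfies the same recursion, because its sum is shifted by one index.
\<close>

lemma annulus_sum_Suc:
  assumes q: "q \<ge> 1"
  shows "(int q + 1) * annulus_sum (Suc p) q = int q * annulus_sum p (Suc q)
    + int q * int ((2 * q) choose q) * int ((2 * p) choose p)"
proof -
  have Q: "(int q + 1) * int ((2 * q) choose (q - 1)) = int q * int ((2 * q) choose q)"
  proof -
    have Sq: "Suc (q - 1) = q" using q by simp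
    have "q * ((2 * q) choose q) = 2 * q * ((2 * q - 1) choose (q - 1))"
      using binomial_absorption[of "q - 1" "2 * q"] by (simp only: Sq)
    moreover have "(2 * q - (q - 1)) * ((2 * q) choose (q - 1)) = 2 * q * ((2 * q - 1) choose (q - 1))"
      by (rule binomial_absorb_comp)
    moreover have "2 * q - (q - 1) = q + 1" using q by simp
    ultimately have "(q + 1) * ((2 * q) choose (q - 1)) = q * ((2 * q) choose q)" by (simp only:)
    then have "int ((q + 1) * ((2 * q) choose (q - 1))) = int (q * ((2 * q) choose q))"
      by (rule arg_cong)
    then show ?thesis by (simp only: of_nat_mult of_nat_add of_nat_1)
  qed
  show ?thesis
  proof (cases "p = 0")
    case True
    then show ?thesis using Q by (simp add: annulus_sum_def)
  next
    case False
    define P where "P c = 2 * int q * (int p + 1) + (3 * int p - 3 * int q + 2) * c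
      + (int q - int p - 3) * c ^ 2 + c ^ 3" for c
    define G where "G c = int ((2 * p - c) choose (p - 1)) * int ((2 * q + c - 1) choose (q - 1)) * P (int c)"
      for c :: nat
    define T where "T c = int c * int ((2 * p + 1 - c) choose p) * int ((2 * q + c - 1) choose (q - 1))"
      for c :: nat
    define T' where "T' c = int c * int ((2 * p - c - 1) choose (p - 1)) * int ((2 * q + c + 1) choose q)"
      for c :: nat
    have tele: "int p * ((int q + 1) * T c - int q * T' c) = G c - G (Suc c)" if "c \<in> {1..p}" for c
      using annulus_sum_telescope[of c p q] that q
      by (simp add: T_def T'_def G_def P_def add.commute)
    have "int p * ((int q + 1) * (\<Sum>c=1..p. T c) - int q * (\<Sum>c=1..p. T' c))
        = (\<Sum>c=1..p. int p * ((int q + 1) * T c - int q * T' c))"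
      by (simp only: sum_distrib_left sum_subtractf right_diff_distrib)
    also have "\<dots> = (\<Sum>c=1..p. G c - G (Suc c))"
      by (rule sum.cong[OF refl]) (rule tele)
    also have "\<dots> = G 1 - G (Suc p)"
      using sum_Suc_diff[of 1 p "\<lambda>c. - G c"] by simp
    finally have 1: "int p * ((int q + 1) * (\<Sum>c=1..p. T c) - int q * (\<Sum>c=1..p. T' c)) = G 1 - G (Suc p)" .
    have "P (int p + 1) = int p * (int q + 1) * (int p + 1)"
      unfolding P_def by (simp add: algebra_simps power2_eq_square power3_eq_cube)
    then have 2: "G (Suc p) = int p * ((int q + 1) * T (Suc p))"
      using False by (simp add: G_def T_def add.commute)
    have "P 1 = 2 * int p * (int q + 1)"
      unfolding P_def by (simp add: algebra_simps)
    then have "G 1 = int p * (2 * int ((2 * p - 1) choose (p - 1))) * ((int q + 1) * int ((2 * q) choose (q - 1)))"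
      by (simp add: G_def)
    moreover have "(2 * p - 1) choose (p - 1) = (2 * p - 1) choose p"
      using binomial_symmetric[of "p - 1" "2 * p - 1"] False by simp
    then have "2 * int ((2 * p - 1) choose (p - 1)) = int ((2 * p) choose p)"
      using double_disc_count[of p] False by (simp add: disc_count_def)
    ultimately have 3: "G 1 = int p * (int q * int ((2 * q) choose q) * int ((2 * p) choose p))"
      unfolding Q by (simp add: mult_ac)
    have S1: "annulus_sum (Suc p) q = (\<Sum>c=1..p. T c) + T (Suc p)"
      by (simp add: annulus_sum_def T_def)
    have S2: "annulus_sum p (Suc q) = (\<Sum>c=1..p. T' c)"
      by (simp add: annulus_sum_def T'_def add.commute)
    have "int p * ((int q + 1) * annulus_sum (Suc p) q) = int p * (int q * annulus_sum p (Suc q)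
      + int q * int ((2 * q) choose q) * int ((2 * p) choose p))"
      unfolding S1 S2 using 1 unfolding 2 3 by (simp add: algebra_simps)
    then show ?thesis using False by simp
  qed
qed

lemma join_count_eq:
  assumes "q \<ge> 1"
  shows "join_count p q = 2 * annulus_sum p q"
  using assms
proof (induction p arbitrary: q)
  case 0
  then show ?case by (simp add: join_count_def annulus_sum_def)
next
  case (Suc p)
  have "(\<Sum>j<Suc p. int ((2 * (p - j)) choose (p - j)) * catalan (j + q))
      = int ((2 * p) choose p) * catalan q + (\<Sum>j<p. int ((2 * (p - 1 - j)) choose (p - 1 - j)) * catalan (j + Suc q))"
    by (subst sum.lessThan_Suc_shift) simp
  moreover have J: "join_count (Suc p) q = 2 * int q * (\<Sum>j<Suc p. int ((2 * (p - j)) choose (p - j)) * catalan (j + q))"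
    unfolding join_count_def sum_distrib_left by (simp add: mult_ac)
  moreover have J': "join_count p (Suc q)
      = 2 * (int q + 1) * (\<Sum>j<p. int ((2 * (p - 1 - j)) choose (p - 1 - j)) * catalan (j + Suc q))"
    unfolding join_count_def sum_distrib_left by (rule sum.cong) (simp_all add: algebra_simps)
  ultimately have "(int q + 1) * join_count (Suc p) q
      = int q * join_count p (Suc q) + 2 * int q * int ((2 * p) choose p) * ((int q + 1) * catalan q)"
    by (simp add: algebra_simps)
  also have "\<dots> = 2 * ((int q + 1) * annulus_sum (Suc p) q)"
    unfolding Suc_times_catalan annulus_sum_Suc[OF Suc.prems] Suc.IH[of "Suc q", simplified]
    by (simp add: algebra_simps)
  finally have "(int q + 1) * join_count (Suc p) q = (int q + 1) * (2 * annulus_sum (Suc p) q)"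
    by simp
  moreover have "int q + 1 \<noteq> 0" by simp
  ultimately show ?case by (metis mult_left_cancel)
qed

section \<open>Positive and negative cycles\<close>

text \<open>
  For pairwise distinct absolute values this maps every entry to the next one, cyclically, and does the same to
  the negatives: a pair of opposite cycles. Defining it as a product of reflections reduces the
  identities between products of cycles to the conjugation rule \<open>srefl_conj\<close>.
\<close>

fun cyc :: "int list \<Rightarrow> int \<Rightarrow> int" where
  "cyc (x # y # zs) = srefl x y \<circ> cyc (y # zs)"
| "cyc _ = id"

text \<open>
  The cycle that runs through the list and then through its negative; for the last entry \<open>l\<close> the reflection
  \<open>srefl l (- l)\<close> redirects the arrow of \<open>l\<close> from the first entry to the negative of the first entry.
\<close>

definition ncyc :: "int list \<Rightarrow> int \<Rightarrow> int" where
  "ncyc xs = (if xs = [] then id else cyc xs \<circ> srefl (last xs) (- last xs))"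

definition signed_list :: "nat \<Rightarrow> int list \<Rightarrow> bool" where
  "signed_list N xs \<longleftrightarrow> set xs \<subseteq> pm_set N \<and> distinct (map abs xs)"

lemma signed_list_Nil [simp]: "signed_list N []"
  by (simp add: signed_list_def)

lemma signed_list_Cons [simp]:
  "signed_list N (x # xs) \<longleftrightarrow> x \<in> pm_set N \<and> \<bar>x\<bar> \<notin> abs ` set xs \<and> signed_list N xs"
  by (auto simp: signed_list_def)

lemma signed_list_append [simp]:
  "signed_list N (xs @ ys) \<longleftrightarrow> signed_list N xs \<and> signed_list N ys \<and> abs ` set xs \<inter> abs ` set ys = {}"
  by (auto simp: signed_list_def)

lemma signed_list_uminus [simp]: "signed_list N (map uminus xs) \<longleftrightarrow> signed_list N xs"
  by (induction xs) (auto simp: image_image)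

lemma signed_listD: "signed_list N xs \<Longrightarrow> set xs \<subseteq> pm_set N" "signed_list N xs \<Longrightarrow> distinct xs"
  by (auto simp: signed_list_def distinct_map)

lemma signed_list_set: "signed_list N xs \<Longrightarrow> x \<in> set xs \<Longrightarrow> x \<in> pm_set N"
  using signed_listD(1) by blast

lemma not_in_abs_imageD: "\<bar>k\<bar> \<notin> abs ` S \<Longrightarrow> x \<in> S \<Longrightarrow> \<bar>x\<bar> \<noteq> \<bar>k\<bar>" for k :: int
  by (metis imageI)

lemma abs_disjointD: "abs ` A \<inter> abs ` B = {} \<Longrightarrow> x \<in> A \<Longrightarrow> y \<in> B \<Longrightarrow> \<bar>x\<bar> \<noteq> \<bar>y\<bar>" for x y :: int
  by (metis disjoint_iff imageI)

lemma srefl_fix: "\<bar>i\<bar> \<noteq> \<bar>a\<bar> \<Longrightarrow> \<bar>i\<bar> \<noteq> \<bar>b\<bar> \<Longrightarrow> srefl a b i = i"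
  by (rule srefl_other) auto

lemma srefl_conj:
  assumes "w \<in> hyperoctahedral N" "a \<noteq> 0" "b \<noteq> 0"
  shows "w \<circ> srefl a b = srefl (w a) (w b) \<circ> w"
proof
  fix i
  have eq: "w i = w j \<longleftrightarrow> i = j" "w i = - w j \<longleftrightarrow> i = - j" for j
    using hyperoctahedralD(2,4)[OF assms(1)] by (metis injD)+
  show "(w \<circ> srefl a b) i = (srefl (w a) (w b) \<circ> w) i"
    by (simp add: srefl_def eq hyperoctahedralD(2)[OF assms(1)])
qed

lemma srefl_neg_exchange:
  assumes "a \<in> pm_set N" "k \<in> pm_set N" "\<bar>a\<bar> \<noteq> \<bar>k\<bar>"
  shows "srefl a (- a) \<circ> srefl a k = srefl a k \<circ> srefl k (- k)"
    and "srefl (- k) k \<circ> srefl a k = srefl a (- k) \<circ> srefl (- k) k"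
proof -
  have nz: "a \<noteq> 0" "k \<noteq> 0" using assms pm_set_nonzero by auto
  show "srefl a (- a) \<circ> srefl a k = srefl a k \<circ> srefl k (- k)"
    using srefl_conj[OF srefl_in_hyperoctahedral[OF assms(1,2)], of k "- k"] nz by simp
  have "srefl (- k) k a = a" using assms(3) by (simp add: srefl_fix)
  then show "srefl (- k) k \<circ> srefl a k = srefl a (- k) \<circ> srefl (- k) k"
    using srefl_conj[OF srefl_in_hyperoctahedral[of "- k" N k], of a k] assms(2) nz by simp
qed

lemma cyc_in_hyperoctahedral: "set xs \<subseteq> pm_set N \<Longrightarrow> cyc xs \<in> hyperoctahedral N"
  by (induction xs rule: cyc.induct) auto

lemma ncyc_in_hyperoctahedral: "set xs \<subseteq> pm_set N \<Longrightarrow> ncyc xs \<in> hyperoctahedral N"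
  unfolding ncyc_def using last_in_set[of xs] subsetD[of "set xs" "pm_set N" "last xs"]
  by (auto intro!: cyc_in_hyperoctahedral comp_in_hyperoctahedral srefl_in_hyperoctahedral)

lemma cyc_fix: "\<bar>i\<bar> \<notin> abs ` set xs \<Longrightarrow> cyc xs i = i"
  by (induction xs rule: cyc.induct) (auto simp: srefl_fix)

lemma ncyc_fix: "\<bar>i\<bar> \<notin> abs ` set xs \<Longrightarrow> ncyc xs i = i"
proof -
  assume i: "\<bar>i\<bar> \<notin> abs ` set xs"
  have "\<bar>i\<bar> \<noteq> \<bar>last xs\<bar>" if "xs \<noteq> []" using i that by auto
  then show ?thesis using i by (simp add: ncyc_def cyc_fix srefl_fix)
qed

lemma cyc_conj:
  assumes "w \<in> hyperoctahedral N"
  shows "set xs \<subseteq> pm_set N \<Longrightarrow> w \<circ> cyc xs = cyc (map w xs) \<circ> w"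
proof (induction xs rule: cyc.induct)
  case (1 x y zs)
  have nz: "x \<noteq> 0" "y \<noteq> 0" using 1 pm_set_nonzero by auto
  have "w \<circ> cyc (x # y # zs) = (w \<circ> srefl x y) \<circ> cyc (y # zs)" by (simp add: o_assoc)
  also have "\<dots> = srefl (w x) (w y) \<circ> (w \<circ> cyc (y # zs))"
    by (simp add: srefl_conj[OF assms nz] o_assoc)
  also have "w \<circ> cyc (y # zs) = cyc (map w (y # zs)) \<circ> w" by (rule "1.IH") (use 1 in simp)
  finally show ?case by (simp add: o_assoc)
qed simp_all

lemma cyc_commute:
  assumes "w \<in> hyperoctahedral N" "set xs \<subseteq> pm_set N" "\<And>i. i \<in> set xs \<Longrightarrow> w i = i"
  shows "w \<circ> cyc xs = cyc xs \<circ> w"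
proof -
  have "map w xs = xs" using assms(3) by (simp add: map_idI)
  then show ?thesis using cyc_conj[OF assms(1,2)] by simp
qed

lemma srefl_commute_fix:
  assumes "w \<in> hyperoctahedral N" "a \<noteq> 0" "b \<noteq> 0" "w a = a" "w b = b"
  shows "w \<circ> srefl a b = srefl a b \<circ> w"
  using srefl_conj[OF assms(1-3)] assms by simp

lemma cyc_append: "cyc (xs @ a # zs) = cyc (xs @ [a]) \<circ> cyc (a # zs)"
proof (induction xs rule: cyc.induct)
  case ("2_2" x)
  then show ?case by simp
qed (simp_all add: o_assoc)

lemma cyc_last:
  assumes "signed_list N xs" "xs \<noteq> []"
  shows "cyc xs (last xs) = hd xs"
  using assms by (induction xs rule: cyc.induct) auto

text \<open>
  Move the reflection that involves \<open>x\<close> from the left end of the product to its right end, by conjugation.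
\<close>

lemma cyc_rotate:
  assumes "signed_list N (x # us)"
  shows "cyc (x # us) = cyc (us @ [x])"
proof (cases "us = []")
  case False
  then obtain ws l where us: "us = ws @ [l]" by (metis append_butlast_last_id)
  obtain y vs where us': "us = y # vs" using False by (cases us) auto
  have C: "cyc us \<in> hyperoctahedral N"
    using assms by (intro cyc_in_hyperoctahedral) (auto dest: signed_listD)
  have nz: "x \<noteq> 0" "l \<noteq> 0" using assms us pm_set_nonzero by auto
  have "cyc (us @ [x]) = cyc us \<circ> srefl l x"
    using cyc_append[of ws l "[x]"] by (simp add: us)
  also have "\<dots> = srefl (cyc us l) (cyc us x) \<circ> cyc us"
    using srefl_conj[OF C nz(2,1)] .
  also have "cyc us l = y" using cyc_last[of N us] assms False us us' by (metis last_snoc list.sel(1) signed_list_Cons)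
  also have "cyc us x = x" using assms by (intro cyc_fix) simp
  also have "srefl y x \<circ> cyc us = cyc (x # us)"
    using srefl_commute[of x y] nz assms pm_set_nonzero by (auto simp: us')
  finally show ?thesis by simp
qed simp

lemma cyc_uminus: "0 \<notin> set xs \<Longrightarrow> cyc (map uminus xs) = cyc xs"
  by (induction xs rule: cyc.induct) (auto simp: srefl_neg_neg)

lemma signed_list_nz: "signed_list N xs \<Longrightarrow> 0 \<notin> set xs"
  using signed_listD(1) pm_set_nonzero by blast

lemma ncyc_uminus: "signed_list N xs \<Longrightarrow> ncyc (map uminus xs) = ncyc xs"
proof (cases "xs = []")
  case False
  assume xs: "signed_list N xs"
  have "last xs \<noteq> 0" using xs False signed_list_nz last_in_set by metis
  then show ?thesis
    using False cyc_uminus[OF signed_list_nz[OF xs]] srefl_commute[of "last xs" "- last xs"]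
    by (simp add: ncyc_def last_map)
qed (simp add: ncyc_def)

text \<open>
  Multiplication with a reflection whose two points are on one positive cycle cuts the cycle in two pieces.
\<close>

lemma cyc_split:
  assumes xs: "signed_list N (k # ys @ zs)" and ys: "ys \<noteq> []"
  shows "cyc (k # ys @ zs) \<circ> srefl (last ys) k = cyc ys \<circ> cyc (k # zs)"
proof -
  obtain ws a where ys: "ys = ws @ [a]" using ys by (metis append_butlast_last_id)
  have nz: "a \<noteq> 0" "k \<noteq> 0" using xs ys pm_set_nonzero by auto
  let ?t = "srefl a k"
  have t: "?t \<in> hyperoctahedral N" using xs ys by auto
  have "map ?t (k # zs) = a # zs"
    using xs ys by (auto intro!: map_idI srefl_fix dest: not_in_abs_imageD)
  then have conj: "?t \<circ> cyc (k # zs) = cyc (a # zs) \<circ> ?t"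
    using cyc_conj[OF t, of "k # zs"] xs by (auto dest: signed_listD)
  have "signed_list N (k # ws @ [a])" using xs ys by auto
  then have "cyc (k # ws @ [a]) = cyc (ws @ [a, k])" using cyc_rotate[of N k "ws @ [a]"] by simp
  also have "\<dots> = cyc ys \<circ> ?t" using cyc_append[of ws a "[k]"] ys by simp
  finally have rot: "cyc (k # ws @ [a]) = cyc ys \<circ> ?t" .
  have "cyc (k # ys @ zs) \<circ> ?t = cyc (k # ws @ [a]) \<circ> (cyc (a # zs) \<circ> ?t)"
    using cyc_append[of "k # ws" a zs] ys by (simp add: o_assoc)
  also have "\<dots> = cyc ys \<circ> (?t \<circ> ?t) \<circ> cyc (k # zs)"
    unfolding rot conj[symmetric] by (simp only: o_assoc)
  finally show ?thesis using ys nz by simp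
qed

lemma ncyc_rotate:
  assumes "signed_list N (k # us)"
  shows "ncyc (k # us) = ncyc (us @ [- k])"
proof -
  have k: "k \<noteq> 0" using assms pm_set_nonzero by auto
  show ?thesis
  proof (cases "us = []")
    case True
    then show ?thesis using k srefl_commute[of k "- k"] by (simp add: ncyc_def)
  next
    case False
    then obtain ws l where us: "us = ws @ [l]" by (metis append_butlast_last_id)
    have l: "l \<noteq> 0" "\<bar>l\<bar> \<noteq> \<bar>k\<bar>" "\<bar>k\<bar> \<noteq> \<bar>l\<bar>" and lk: "l \<in> pm_set N" "k \<in> pm_set N"
      using assms us pm_set_nonzero by auto
    have sw: "srefl l (- k) \<circ> srefl (- k) k = srefl l k \<circ> srefl l (- l)"
      using srefl_neg_exchange(2)[OF lk l(2)] srefl_neg_exchange(1)[OF lk(2,1) l(3)]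
        srefl_commute[of "- k" k] srefl_commute[of k l] k l(1) by simp
    have "ncyc (us @ [- k]) = cyc us \<circ> (srefl l (- k) \<circ> srefl (- k) k)"
      using cyc_append[of ws l "[- k]"] by (simp add: ncyc_def us o_assoc)
    also have "\<dots> = cyc (us @ [k]) \<circ> srefl l (- l)"
      unfolding sw using cyc_append[of ws l "[k]"] by (simp add: us o_assoc)
    also have "\<dots> = ncyc (k # us)"
      using cyc_rotate[OF assms] by (simp add: ncyc_def us)
    finally show ?thesis by simp
  qed
qed

lemma ncyc_rotate_append:
  "signed_list N (us @ vs) \<Longrightarrow> ncyc (us @ vs) = ncyc (vs @ map uminus us)"
proof (induction us arbitrary: vs)
  case (Cons k us)
  have "ncyc ((k # us) @ vs) = ncyc (us @ (vs @ [- k]))"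
    using ncyc_rotate[of N k "us @ vs"] Cons.prems by simp
  also have "\<dots> = ncyc ((vs @ [- k]) @ map uminus us)"
    by (rule Cons.IH) (use Cons.prems in auto)
  finally show ?case by simp
qed simp

text \<open>
  A reflection whose two points are entries of the list cuts off a positive cycle; \<open>k\<close> stays on the negative
  one. The commutation rules for the reflection hidden in \<open>ncyc\<close> reduce this to \<open>cyc_split\<close>.
\<close>

lemma ncyc_split:
  assumes xs: "signed_list N (k # ys @ zs)" and ys: "ys \<noteq> []"
  shows "ncyc (k # ys @ zs) \<circ> srefl (last ys) k = cyc ys \<circ> ncyc (k # zs)"
proof -
  define a where "a = last ys"
  have a: "a \<in> set ys" using ys by (simp add: a_def)
  have k0: "k \<noteq> 0" "a \<noteq> 0" using xs a pm_set_nonzero signed_list_nz[OF xs] by auto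
  have ak: "\<bar>a\<bar> \<noteq> \<bar>k\<bar>" using xs a not_in_abs_imageD[of k "set ys" a] by auto
  show ?thesis
  proof (cases "zs = []")
    case True
    have sw: "srefl a (- a) \<circ> srefl a k = srefl a k \<circ> srefl k (- k)"
      by (rule srefl_neg_exchange(1)[of _ N]) (use xs ak signed_list_set[OF _ a] in auto)
    have "ncyc (k # ys) \<circ> srefl a k = cyc (k # ys) \<circ> (srefl a (- a) \<circ> srefl a k)"
      using ys by (simp add: ncyc_def a_def o_assoc)
    also have "\<dots> = (cyc (k # ys @ []) \<circ> srefl (last ys) k) \<circ> srefl k (- k)"
      unfolding sw by (simp add: o_assoc a_def)
    also have "\<dots> = cyc ys \<circ> ncyc [k]"
      unfolding cyc_split[OF xs[unfolded True] ys] by (simp add: ncyc_def)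
    finally show ?thesis by (simp add: True a_def)
  next
    case False
    define l where "l = last zs"
    have l: "l \<in> set zs" using False by (simp add: l_def)
    have nz: "l \<noteq> 0" using l signed_list_nz[OF xs] by auto
    have lk: "\<bar>l\<bar> \<noteq> \<bar>k\<bar>" using xs l not_in_abs_imageD[of k "set zs" l] by auto
    have la: "\<bar>l\<bar> \<noteq> \<bar>a\<bar>" using xs abs_disjointD[OF _ a l] by auto
    have "l \<in> pm_set N" using xs signed_list_set[OF _ l] by auto
    then have "srefl l (- l) \<in> hyperoctahedral N" by auto
    then have sw: "srefl l (- l) \<circ> srefl a k = srefl a k \<circ> srefl l (- l)"
      by (rule srefl_commute_fix) (use k0 lk la in \<open>simp_all add: srefl_fix\<close>)
    have "ncyc (k # ys @ zs) \<circ> srefl a k = cyc (k # ys @ zs) \<circ> (srefl l (- l) \<circ> srefl a k)"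
      using False by (simp add: ncyc_def l_def o_assoc)
    also have "\<dots> = (cyc (k # ys @ zs) \<circ> srefl (last ys) k) \<circ> srefl l (- l)"
      unfolding sw by (simp add: o_assoc a_def)
    also have "\<dots> = cyc ys \<circ> ncyc (k # zs)"
      unfolding cyc_split[OF xs ys] using False by (simp add: ncyc_def l_def o_assoc)
    finally show ?thesis by (simp add: a_def)
  qed
qed

text \<open>
  When the second point has the opposite sign, \<open>k\<close> moves to the positive cycle instead. This is
  \<open>ncyc_split\<close> read from the other point, after rotating the list so that it starts at \<open>- last ys\<close>.
\<close>

lemma ncyc_split_neg:
  assumes xs: "signed_list N (k # ys @ zs)" and ys: "ys \<noteq> []"
  shows "ncyc (k # ys @ zs) \<circ> srefl (- last ys) k = ncyc ys \<circ> cyc (k # map uminus zs)"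
proof -
  obtain ws a where ys: "ys = ws @ [a]" using ys by (metis append_butlast_last_id)
  let ?nz = "map uminus zs"
  have nz: "a \<noteq> 0" "k \<noteq> 0" using xs ys pm_set_nonzero by auto
  have sl: "signed_list N (- a # (?nz @ [k]) @ ws)" "signed_list N (a # zs)"
    using xs ys by (auto simp: image_image)
  have "ncyc (k # ys @ zs) = ncyc ((k # ws) @ (a # zs))" by (simp add: ys)
  also have "\<dots> = ncyc ((a # zs) @ map uminus (k # ws))"
    by (rule ncyc_rotate_append) (use xs ys in auto)
  also have "\<dots> = ncyc (map uminus ((a # zs) @ map uminus (k # ws)))"
    by (rule ncyc_uminus[symmetric]) (use xs ys in \<open>auto simp: image_image\<close>)
  also have "\<dots> = ncyc (- a # (?nz @ [k]) @ ws)" by (simp add: comp_def)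
  finally have rot: "ncyc (k # ys @ zs) = ncyc (- a # (?nz @ [k]) @ ws)" .
  have "ncyc (k # ys @ zs) \<circ> srefl (- a) k = ncyc (- a # (?nz @ [k]) @ ws) \<circ> srefl (last (?nz @ [k])) (- a)"
    using rot nz srefl_commute[of "- a" k] by simp
  also have "\<dots> = cyc (?nz @ [k]) \<circ> ncyc (- a # ws)"
    by (rule ncyc_split[OF sl(1)]) simp
  also have "cyc (?nz @ [k]) = cyc (k # ?nz)"
    by (rule cyc_rotate[symmetric, of N]) (use xs in \<open>auto simp: image_image\<close>)
  also have "ncyc (- a # ws) = ncyc ys"
    using ncyc_rotate[of N "- a" ws] sl(1) ys by (auto simp: image_image)
  also have "cyc (k # ?nz) \<circ> ncyc ys = ncyc ys \<circ> cyc (k # ?nz)"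
  proof (rule cyc_commute[symmetric])
    show "ncyc ys \<in> hyperoctahedral N" "set (k # ?nz) \<subseteq> pm_set N"
      using xs by (auto intro!: ncyc_in_hyperoctahedral dest: signed_list_set)
    show "ncyc ys i = i" if "i \<in> set (k # ?nz)" for i
      using that xs by (intro ncyc_fix) (auto simp: image_image dest: abs_disjointD not_in_abs_imageD)
  qed
  finally show ?thesis by (simp only: ys last_snoc)
qed

text \<open>
  The reflection changing the sign of \<open>k\<close> makes the negative cycle positive.
\<close>

lemma ncyc_comp_neg:
  assumes xs: "signed_list N (k # ys)"
  shows "ncyc (k # ys) \<circ> srefl (- k) k = cyc (k # map uminus ys)"
proof -
  have k: "k \<noteq> 0" using xs pm_set_nonzero by auto
  have "ncyc (k # ys) \<circ> srefl (- k) k = cyc (ys @ [- k]) \<circ> (srefl (- k) k \<circ> srefl (- k) k)"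
    unfolding ncyc_rotate[OF xs] by (simp add: ncyc_def o_assoc)
  also have "\<dots> = cyc (- k # ys)"
    using cyc_rotate[of N "- k" ys] xs k by simp
  also have "\<dots> = cyc (map uminus (k # map uminus ys))" by (simp add: comp_def)
  also have "\<dots> = cyc (k # map uminus ys)"
    by (rule cyc_uminus, rule signed_list_nz[of N]) (use xs in \<open>auto simp: image_image\<close>)
  finally show ?thesis .
qed

text \<open>
  A reflection with points on two different negative cycles joins them to one positive cycle. This is the
  step in which the two boundary circles of the annulus interact.
\<close>

lemma ncyc_join:
  assumes xs: "signed_list N (k # ys @ zs)" and zs: "zs \<noteq> []"
  shows "ncyc (k # ys) \<circ> ncyc zs \<circ> srefl (last zs) k = cyc (ys @ - k # zs)"
proof -
  obtain ws a where zs: "zs = ws @ [a]" using zs by (metis append_butlast_last_id)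
  have nz: "a \<noteq> 0" "k \<noteq> 0" "\<bar>a\<bar> \<noteq> \<bar>k\<bar>" using xs zs pm_set_nonzero by auto
  let ?n = "srefl (- k) k"
  have n: "?n \<in> hyperoctahedral N" using xs by auto
  have comm: "?n \<circ> cyc zs = cyc zs \<circ> ?n"
    by (rule cyc_commute[OF n]) (use xs in \<open>auto intro!: srefl_fix dest: signed_list_set not_in_abs_imageD\<close>)
  have sw: "?n \<circ> srefl a (- a) \<circ> srefl a k = srefl a (- k)"
  proof -
    have "?n \<circ> srefl a (- a) \<circ> srefl a k = (?n \<circ> srefl a k) \<circ> srefl k (- k)"
      using srefl_neg_exchange(1)[of a N k] xs zs nz(3) by (simp add: o_assoc[symmetric])
    also have "\<dots> = srefl a (- k) \<circ> (?n \<circ> ?n)"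
      using srefl_neg_exchange(2)[of a N k] xs zs nz srefl_commute[of k "- k"]
      by (simp add: o_assoc[symmetric])
    finally show ?thesis using nz by simp
  qed
  have sl: "signed_list N (k # ys)" using xs by auto
  have "ncyc (k # ys) \<circ> ncyc zs \<circ> srefl a k
      = cyc (ys @ [- k]) \<circ> (?n \<circ> cyc zs) \<circ> srefl a (- a) \<circ> srefl a k"
    unfolding ncyc_rotate[OF sl] using zs by (simp add: ncyc_def o_assoc)
  also have "\<dots> = cyc (ys @ [- k]) \<circ> (cyc zs \<circ> (?n \<circ> srefl a (- a) \<circ> srefl a k))"
    unfolding comm by (simp only: o_assoc)
  also have "cyc zs \<circ> (?n \<circ> srefl a (- a) \<circ> srefl a k) = cyc (zs @ [- k])"
    unfolding sw using cyc_append[of ws a "[- k]"] by (simp add: zs)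
  also have "\<dots> = cyc (- k # zs)"
    by (rule cyc_rotate[symmetric, of N]) (use xs in auto)
  also have "cyc (ys @ [- k]) \<circ> cyc (- k # zs) = cyc (ys @ - k # zs)"
    by (rule cyc_append[symmetric])
  finally show ?thesis by (simp only: zs last_snoc)
qed

section \<open>Blocks of a product of cycles\<close>

lemma cyc_nth: "signed_list N xs \<Longrightarrow> Suc i < length xs \<Longrightarrow> cyc xs (xs ! i) = xs ! Suc i"
proof (induction xs arbitrary: i rule: cyc.induct)
  case (1 x y zs)
  show ?case
  proof (cases i)
    case 0
    have "cyc (y # zs) x = x" by (rule cyc_fix) (use 1 in auto)
    then show ?thesis using 0 by simp
  next
    case (Suc j)
    have IH: "cyc (y # zs) ((y # zs) ! j) = (y # zs) ! Suc j"
      by (rule "1.IH") (use 1 Suc in auto)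
    have v: "zs ! j \<in> set zs" using 1 Suc by simp
    then have "srefl x y (zs ! j) = zs ! j"
      using 1 not_in_abs_imageD[of x "set zs"] not_in_abs_imageD[of y "set zs"]
      by (intro srefl_fix) auto
    then show ?thesis using IH Suc by simp
  qed
qed simp_all

lemma ncyc_nth:
  assumes xs: "signed_list N xs" and i: "Suc i < length xs"
  shows "ncyc xs (xs ! i) = xs ! Suc i"
proof -
  obtain ws l where ws: "xs = ws @ [l]" using i by (metis append_butlast_last_id list.size(3) not_less0)
  have "xs ! i \<in> set ws" using i by (simp add: ws nth_append)
  then have "srefl l (- l) (xs ! i) = xs ! i"
    using xs ws not_in_abs_imageD[of l "set ws"] by (intro srefl_fix) auto
  then show ?thesis using cyc_nth[OF xs i] by (simp add: ncyc_def ws)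
qed

lemma ncyc_last:
  assumes xs: "signed_list N xs" and ne: "xs \<noteq> []"
  shows "ncyc xs (last xs) = - hd xs"
proof -
  have "cyc xs \<in> hyperoctahedral N" using xs by (intro cyc_in_hyperoctahedral) (rule signed_listD)
  then show ?thesis
    using cyc_last[OF assms] ne hyperoctahedralD(2)[of "cyc xs" N "last xs"] by (simp add: ncyc_def)
qed

lemma Fix_const_on_list:
  assumes x: "x \<in> Fix N w" and w: "\<And>i. Suc i < length xs \<Longrightarrow> w (xs ! i) = xs ! Suc i"
    and a: "a \<in> set xs"
  shows "x a = x (hd xs)"
proof -
  have ne: "xs \<noteq> []" using a by auto
  have "x (xs ! i) = x (hd xs)" if "i < length xs" for i
    using that
  proof (induction i)
    case 0
    then show ?case using ne by (simp add: hd_conv_nth)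
  next
    case (Suc i)
    then show ?case using FixD(1)[OF x, of "xs ! i"] w[of i] by simp
  qed
  then show ?thesis using a by (metis in_set_conv_nth)
qed

lemma Fix_ncyc_zero:
  assumes xs: "signed_list N xs" and x: "x \<in> Fix N w"
    and w: "\<And>i. i \<in> set xs \<Longrightarrow> w i = ncyc xs i" and a: "\<bar>a\<bar> \<in> abs ` set xs"
  shows "x a = 0"
proof -
  have ne: "xs \<noteq> []" using a by auto
  have const: "x b = x (hd xs)" if "b \<in> set xs" for b
  proof (rule Fix_const_on_list[OF x _ that])
    fix i assume "Suc i < length xs"
    then show "w (xs ! i) = xs ! Suc i" using w[of "xs ! i"] ncyc_nth[OF xs] by simp
  qed
  have "x (- hd xs) = x (last xs)"
    using FixD(1)[OF x, of "last xs"] w[of "last xs"] ncyc_last[OF xs ne] ne by simp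
  then have "x (hd xs) = - x (hd xs)"
    using const[of "last xs"] ne odd_vecs_uminus[OF FixD(2)[OF x]] by simp
  then have "x (hd xs) = 0" by (simp only: mod3_eq_uminus)
  then have *: "x b = 0" if "b \<in> set xs" for b using const that by simp
  obtain b where "b \<in> set xs" "\<bar>a\<bar> = \<bar>b\<bar>" using a by auto
  then have "a = b \<or> a = - b" by arith
  then show ?thesis using *[OF \<open>b \<in> set xs\<close>] odd_vecs_uminus[OF FixD(2)[OF x]] by auto
qed

lemma inj_maps_to_iff:
  assumes "inj f" "finite S" "\<And>i. i \<in> S \<Longrightarrow> f i \<in> S"
  shows "f i \<in> S \<longleftrightarrow> i \<in> S"
proof -
  have "f ` S = S"
    using endo_inj_surj[OF assms(2)] assms(1,3) inj_on_subset by blast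
  then show ?thesis using assms(1) by (metis inj_image_mem_iff)
qed

lemma abs_in_image_iff: "\<bar>a\<bar> \<in> abs ` S \<longleftrightarrow> a \<in> S \<or> a \<in> uminus ` S" for a :: int
  by (auto simp: image_iff abs_eq_iff)

text \<open>
  The signed indicator of the cycle is a fixed vector and separates the cycle from all other points.
\<close>

lemma linked_cyc:
  assumes g: "g \<in> hyperoctahedral N" and xs: "signed_list N (k # ys)"
    and fix_g: "\<And>i. i \<in> set (k # ys) \<Longrightarrow> g i = i"
  shows "{a \<in> pm_set N. a \<noteq> k \<and> linked N (g \<circ> cyc (k # ys)) a k} = set ys"
proof -
  let ?S = "set (k # ys)" and ?w = "g \<circ> cyc (k # ys)"
  have S: "?S \<subseteq> pm_set N" using signed_listD(1)[OF xs] .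
  have w: "?w \<in> hyperoctahedral N" using g cyc_in_hyperoctahedral[OF S] by blast
  have step: "?w ((k # ys) ! i) = (k # ys) ! Suc i" if i: "Suc i < length (k # ys)" for i
  proof -
    have "(k # ys) ! Suc i \<in> set (k # ys)" using i nth_mem by blast
    then show ?thesis using cyc_nth[OF xs i] fix_g by simp
  qed
  have into: "?w i \<in> ?S" if i: "i \<in> ?S" for i
  proof -
    obtain j where j: "j < length (k # ys)" "i = (k # ys) ! j" using i by (metis in_set_conv_nth)
    show ?thesis
    proof (cases "Suc j < length (k # ys)")
      case True
      then show ?thesis using step[OF True] j nth_mem[OF True] by simp
    next
      case False
      then have "i = last (k # ys)" using j by (metis Suc_lessI diff_Suc_1 last_conv_nth list.discI)
      then show ?thesis using cyc_last[OF xs] fix_g[of k] by simp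
    qed
  qed
  have iff: "?w i \<in> ?S \<longleftrightarrow> i \<in> ?S" for i
    using inj_maps_to_iff[OF hyperoctahedralD(4)[OF w], of ?S] into by blast
  have neg: "- i \<notin> ?S" if "i \<in> ?S" for i
  proof
    assume m: "- i \<in> ?S"
    have "inj_on abs ?S" using xs unfolding signed_list_def distinct_map by blast
    then have "i = - i" using that m by (metis abs_minus_cancel inj_onD)
    then show False using that S pm_set_nonzero by auto
  qed
  let ?x = "\<lambda>i. if i \<in> ?S then 1 else if - i \<in> ?S then - 1 else (0::3)"
  have x: "?x \<in> Fix N ?w" by (rule Fix_indicator[OF w S iff neg])
  have "linked N ?w a k \<longleftrightarrow> a \<in> ?S" for a
  proof
    assume "linked N ?w a k"
    from linkedD[OF this x] have "?x a = 1" by simp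
    then show "a \<in> ?S" by (simp split: if_splits)
  next
    assume a: "a \<in> ?S"
    show "linked N ?w a k"
      unfolding linked_def
    proof
      fix x assume "x \<in> Fix N ?w"
      from Fix_const_on_list[OF this step a] show "x a = x k" by simp
    qed
  qed
  moreover have "k \<notin> set ys" using signed_listD(2)[OF xs] by simp
  ultimately show ?thesis using S by auto
qed

text \<open>
  All fixed vectors vanish on both negative cycles, so each point of the second cycle, with either sign, is
  linked to \<open>k\<close> as well.
\<close>

lemma linked_ncyc:
  assumes xs: "signed_list N (k # ys @ zs)"
  shows "{a \<in> pm_set N. a \<noteq> k \<and> linked N (ncyc (k # ys) \<circ> ncyc zs) a k}
    = insert (- k) (set ys \<union> uminus ` set ys \<union> (set zs \<union> uminus ` set zs))"
proof -
  let ?w = "ncyc (k # ys) \<circ> ncyc zs"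
  have sl: "signed_list N (k # ys)" "signed_list N zs" using xs by auto
  have w: "?w \<in> hyperoctahedral N"
    using ncyc_in_hyperoctahedral[OF signed_listD(1)[OF sl(1)]]
      ncyc_in_hyperoctahedral[OF signed_listD(1)[OF sl(2)]] by blast
  have disj: "\<bar>i\<bar> \<notin> abs ` set zs" if "\<bar>i\<bar> \<in> abs ` set (k # ys)" for i
    using xs that by auto
  have zs_step: "ncyc zs i = i" if "\<bar>i\<bar> \<in> abs ` set (k # ys)" for i
    using disj[OF that] by (rule ncyc_fix)
  have zsH: "ncyc zs i \<in> pm_set N \<and> \<bar>ncyc zs i\<bar> \<notin> abs ` set (k # ys)" if "i \<in> set zs" for i
  proof -
    have i: "i \<in> pm_set N" using sl(2) that signed_list_set by blast
    then have "ncyc zs i \<in> pm_set N"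
      using hyperoctahedralD(5)[OF ncyc_in_hyperoctahedral[OF signed_listD(1)[OF sl(2)]]] by simp
    moreover have "\<bar>ncyc zs i\<bar> \<notin> abs ` set (k # ys)"
    proof
      assume a: "\<bar>ncyc zs i\<bar> \<in> abs ` set (k # ys)"
      then have "ncyc zs (ncyc zs i) = ncyc zs i" by (rule zs_step)
      then have "ncyc zs i = i"
        using hyperoctahedralD(4)[OF ncyc_in_hyperoctahedral[OF signed_listD(1)[OF sl(2)]]]
        by (metis injD)
      then show False using disj[of i] a that by simp
    qed
    ultimately show ?thesis by blast
  qed
  have zero: "x a = 0" if x: "x \<in> Fix N ?w" and a: "\<bar>a\<bar> \<in> abs ` set (k # ys @ zs)" for x a
  proof -
    have "\<bar>a\<bar> \<in> abs ` set (k # ys) \<or> \<bar>a\<bar> \<in> abs ` set zs" using a by auto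
    then show ?thesis
    proof
      assume "\<bar>a\<bar> \<in> abs ` set (k # ys)"
      then show ?thesis
        by (rule Fix_ncyc_zero[OF sl(1) x, rotated]) (simp only: o_apply zs_step imageI)
    next
      assume "\<bar>a\<bar> \<in> abs ` set zs"
      then show ?thesis
        by (rule Fix_ncyc_zero[OF sl(2) x, rotated]) (simp only: o_apply ncyc_fix[OF conjunct2[OF zsH]])
    qed
  qed
  have iff: "linked N ?w a k \<longleftrightarrow> \<bar>a\<bar> \<in> abs ` set (k # ys @ zs)" if a: "a \<in> pm_set N" for a
  proof
    assume l: "linked N ?w a k"
    show "\<bar>a\<bar> \<in> abs ` set (k # ys @ zs)"
    proof (rule ccontr)
      assume n: "\<bar>a\<bar> \<notin> abs ` set (k # ys @ zs)"
      have "ncyc zs a = a" "ncyc (k # ys) a = a" using n by (auto intro!: ncyc_fix)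
      then have wa: "?w a = a" by simp
      have "?w i \<in> {a} \<longleftrightarrow> i \<in> {a}" for i
        using inj_maps_to_iff[OF hyperoctahedralD(4)[OF w], of "{a}" i] wa by auto
      then have "(\<lambda>i. if i \<in> {a} then 1 else if - i \<in> {a} then - 1 else 0) \<in> Fix N ?w"
        using a pm_set_nonzero[OF a] by (intro Fix_indicator[OF w]) auto
      from linkedD[OF l this] zero[OF this, of k] show False by simp
    qed
  next
    assume a: "\<bar>a\<bar> \<in> abs ` set (k # ys @ zs)"
    show "linked N ?w a k"
      unfolding linked_def
    proof
      fix x assume x: "x \<in> Fix N ?w"
      have "x k = 0" by (rule zero[OF x]) simp
      then show "x a = x k" using zero[OF x a] by simp
    qed
  qed
  have sub: "set (k # ys @ zs) \<subseteq> pm_set N" using signed_listD(1)[OF xs] .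
  have k: "k \<notin> set ys" "k \<notin> set zs" "- k \<notin> set ys" "- k \<notin> set zs" "k \<noteq> - k"
    using xs not_in_abs_imageD[of k "set ys \<union> set zs" k]
      not_in_abs_imageD[of k "set ys \<union> set zs" "- k"] pm_set_nonzero by auto
  have "{a \<in> pm_set N. a \<noteq> k \<and> linked N ?w a k}
      = {a \<in> pm_set N. a \<noteq> k \<and> (a \<in> set (k # ys @ zs) \<or> a \<in> uminus ` set (k # ys @ zs))}"
    using iff unfolding abs_in_image_iff by blast
  also have "\<dots> = insert (- k) (set ys \<union> uminus ` set ys \<union> (set zs \<union> uminus ` set zs))"
    using sub k by auto
  finally show ?thesis .
qed

lemma signed_list_append_abs: "signed_list N (xs @ zs) \<Longrightarrow> x \<in> set xs \<Longrightarrow> \<bar>x\<bar> \<notin> abs ` set zs"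
  by auto

section \<open>Moebius values of products of cycles\<close>

lemma sum_set_eq_sum_nth:
  assumes "distinct xs"
  shows "(\<Sum>a\<in>set xs. f a) = (\<Sum>i<length xs. f (xs ! i))"
  using sum.reindex_bij_betw[OF bij_betw_nth[OF assms refl refl], of f] by simp

lemma take_drop_split:
  assumes "i < length ys"
  shows "ys = take (Suc i) ys @ drop (Suc i) ys" "take (Suc i) ys \<noteq> []" "last (take (Suc i) ys) = ys ! i"
proof -
  show "ys = take (Suc i) ys @ drop (Suc i) ys" by (rule append_take_drop_id[symmetric])
qed (use assms in \<open>auto simp: take_Suc_conv_app_nth\<close>)

text \<open>
  The Moebius value of the type A noncrossing partition lattice on \<open>m\<close> points.
\<close>

definition cyc_mu :: "nat \<Rightarrow> int" where
  "cyc_mu m = (if m = 0 then 1 else (- 1) ^ (m - 1) * catalan (m - 1))"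

lemma cyc_mu_rec:
  assumes "m > 0"
  shows "cyc_mu (Suc m) = - (\<Sum>i<m. cyc_mu (Suc i) * cyc_mu (m - i))"
proof -
  obtain n where m: "m = Suc n" using assms by (cases m) auto
  have "(\<Sum>i<m. cyc_mu (Suc i) * cyc_mu (m - i)) = (\<Sum>i\<le>n. (- 1) ^ n * (catalan i * catalan (n - i)))"
    unfolding m lessThan_Suc_atMost
  proof (rule sum.cong[OF refl])
    fix i assume "i \<in> {..n}"
    then have "Suc n - i = Suc (n - i)" "n = i + (n - i)" by auto
    then have "(- 1 :: int) ^ n = (- 1) ^ i * (- 1) ^ (n - i)" by (metis power_add)
    then show "cyc_mu (Suc i) * cyc_mu (Suc n - i) = (- 1) ^ n * (catalan i * catalan (n - i))"
      using \<open>Suc n - i = Suc (n - i)\<close> by (simp add: cyc_mu_def)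
  qed
  moreover have "cyc_mu (Suc m) = - ((- 1) ^ n * (\<Sum>i\<le>n. catalan i * catalan (n - i)))"
    by (simp add: m cyc_mu_def catalan_Suc)
  ultimately show ?thesis by (simp only: sum_distrib_left)
qed

text \<open>
  A positive cycle contributes a factor that does not depend on the rest of the permutation: stripping at a point
  of the cycle cuts only this cycle, and the cuts reproduce Catalan's recursion.
\<close>

lemma mu_comp_cyc:
  "g \<in> hyperoctahedral N \<Longrightarrow> signed_list N xs \<Longrightarrow> (\<And>i. i \<in> set xs \<Longrightarrow> g i = i) \<Longrightarrow>
    mu N (g \<circ> cyc xs) = cyc_mu (length xs) * mu N g"
proof (induction "length xs" arbitrary: g xs rule: less_induct)
  case less
  note g = less.prems(1) and xs = less.prems(2)
  consider "length xs < 2" | k ys where "xs = k # ys" "ys \<noteq> []"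
    by (metis One_nat_def Suc_1 length_Cons length_0_conv list.exhaust zero_less_Suc lessI)
  then show ?case
  proof cases
    case 1
    then have "cyc xs = id" "cyc_mu (length xs) = 1"
      by (cases xs rule: cyc.cases; simp add: cyc_mu_def)+
    then show ?thesis by simp
  next
    case 2
    let ?w = "g \<circ> cyc (k # ys)" and ?m = "length ys"
    have sl: "signed_list N (k # ys)" using xs 2 by simp
    have fix_g: "g i = i" if "i \<in> set (k # ys)" for i using less.prems(3) that 2 by simp
    have k: "k \<in> pm_set N" using sl by simp
    have w: "?w \<in> hyperoctahedral N"
      using g cyc_in_hyperoctahedral[OF signed_listD(1)[OF sl]] by blast
    have "cyc (k # ys) k = hd ys" using cyc_nth[OF sl, of 0] 2(2) by (simp add: hd_conv_nth)
    then have "?w k = hd ys" using fix_g 2(2) by simp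
    moreover have "hd ys \<noteq> k" using signed_listD(2)[OF sl] 2(2) by (cases ys) auto
    ultimately have "?w k \<noteq> k" by simp
    have "{a \<in> pm_set N. a \<noteq> k \<and> linked N ?w a k} = set ys"
      by (rule linked_cyc[OF g sl]) (rule fix_g)
    then have "mu N ?w = - (\<Sum>a\<in>set ys. mu N (?w \<circ> srefl a k))"
      using mu_strip[OF k w \<open>?w k \<noteq> k\<close>] by (simp only:)
    also have "(\<Sum>a\<in>set ys. mu N (?w \<circ> srefl a k)) = (\<Sum>i<?m. mu N (?w \<circ> srefl (ys ! i) k))"
      by (rule sum_set_eq_sum_nth) (use signed_listD(2)[OF sl] in simp)
    also have "\<dots> = (\<Sum>i<?m. cyc_mu (Suc i) * cyc_mu (?m - i) * mu N g)"
    proof (rule sum.cong[OF refl])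
      fix i assume "i \<in> {..<?m}"
      then have i: "i < ?m" by simp
      define T where "T = take (Suc i) ys"
      define D where "D = drop (Suc i) ys"
      have ys: "ys = T @ D" and T: "T \<noteq> []" "last T = ys ! i"
        using take_drop_split[OF i] by (simp_all add: T_def D_def)
      have len: "length T = Suc i" "length (k # D) = ?m - i" using i by (simp_all add: T_def D_def)
      have slT: "signed_list N T" "signed_list N (k # D)" using sl ys by auto
      have "?w \<circ> srefl (ys ! i) k = g \<circ> (cyc (k # T @ D) \<circ> srefl (last T) k)"
        using T ys by (simp add: o_assoc)
      also have "\<dots> = g \<circ> cyc T \<circ> cyc (k # D)"
        using cyc_split[of N k T D] sl ys T by (simp add: o_assoc)
      finally have eq: "?w \<circ> srefl (ys ! i) k = g \<circ> cyc T \<circ> cyc (k # D)" .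
      have gT: "g \<circ> cyc T \<in> hyperoctahedral N"
        using g cyc_in_hyperoctahedral[OF signed_listD(1)[OF slT(1)]] by blast
      have "mu N (g \<circ> cyc T \<circ> cyc (k # D)) = cyc_mu (length (k # D)) * mu N (g \<circ> cyc T)"
      proof (rule less.hyps[OF _ gT slT(2)])
        show "length (k # D) < length xs" using len 2(1) i by simp
        fix j assume j: "j \<in> set (k # D)"
        have "cyc T j = j" by (rule cyc_fix) (use j sl ys in auto)
        then show "(g \<circ> cyc T) j = j" using fix_g[of j] j ys by auto
      qed
      also have "mu N (g \<circ> cyc T) = cyc_mu (length T) * mu N g"
      proof (rule less.hyps[OF _ g slT(1)])
        show "length T < length xs" using len 2(1) i by simp
        show "\<And>j. j \<in> set T \<Longrightarrow> g j = j" using fix_g ys by simp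
      qed
      finally show "mu N (?w \<circ> srefl (ys ! i) k) = cyc_mu (Suc i) * cyc_mu (?m - i) * mu N g"
        unfolding eq len by (simp only: mult_ac)
    qed
    also have "- \<dots> = cyc_mu (Suc ?m) * mu N g"
      using cyc_mu_rec[of ?m] 2(2) by (simp add: sum_distrib_right)
    finally show ?thesis by (simp only: 2(1) length_Cons)
  qed
qed

lemma mu_cyc: "signed_list N xs \<Longrightarrow> mu N (cyc xs) = cyc_mu (length xs)"
  using mu_comp_cyc[of id N xs] by simp

definition annulus_mu :: "nat \<Rightarrow> nat \<Rightarrow> int" where
  "annulus_mu p q = (- 1) ^ (p + q) * annulus_count p q"

lemma annulus_mu_rec:
  "annulus_mu (Suc m) q = - (cyc_mu (Suc m) * annulus_mu 0 q
    + (\<Sum>i<m. cyc_mu (Suc i) * annulus_mu (m - i) q)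
    + (\<Sum>i<m. cyc_mu (m - i) * annulus_mu (Suc i) q)
    + 2 * int q * cyc_mu (Suc m + q))"
proof -
  have 1: "(\<Sum>i<m. cyc_mu (Suc i) * annulus_mu (m - i) q)
      = (- 1) ^ (m + q) * (\<Sum>i<m. catalan i * annulus_count (m - i) q)"
    unfolding sum_distrib_left
  proof (rule sum.cong[OF refl])
    fix i assume "i \<in> {..<m}"
    then have "m + q = i + (m - i + q)" by simp
    then have "(- 1 :: int) ^ (m + q) = (- 1) ^ i * (- 1) ^ (m - i + q)" by (metis power_add)
    then show "cyc_mu (Suc i) * annulus_mu (m - i) q = (- 1) ^ (m + q) * (catalan i * annulus_count (m - i) q)"
      by (simp add: cyc_mu_def annulus_mu_def)
  qed
  have 2: "(\<Sum>i<m. cyc_mu (m - i) * annulus_mu (Suc i) q) = (\<Sum>i<m. cyc_mu (Suc i) * annulus_mu (m - i) q)"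
  proof -
    have "(\<Sum>i<m. cyc_mu (m - i) * annulus_mu (Suc i) q)
        = (\<Sum>i<m. cyc_mu (m - (m - Suc i)) * annulus_mu (Suc (m - Suc i)) q)"
      by (rule sum.nat_diff_reindex[symmetric])
    also have "\<dots> = (\<Sum>i<m. cyc_mu (Suc i) * annulus_mu (m - i) q)"
      by (rule sum.cong[OF refl]) (auto simp: Suc_diff_Suc)
    finally show ?thesis .
  qed
  show ?thesis
    unfolding 2 1 using annulus_count_Suc[of m q]
    by (simp add: annulus_mu_def cyc_mu_def power_add algebra_simps)
qed

text \<open>
  The signed entries of a negative cycle are all on an equal footing: by rotation and inversion any of them
  can be made the last entry.
\<close>

lemma ncyc_end_with:
  assumes zs: "signed_list N zs" and a: "a \<in> set zs \<union> uminus ` set zs"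
  shows "\<exists>zs'. signed_list N zs' \<and> length zs' = length zs \<and> abs ` set zs' = abs ` set zs \<and>
    zs' \<noteq> [] \<and> last zs' = a \<and> ncyc zs' = ncyc zs"
proof -
  obtain b where b: "b \<in> set zs" "a = b \<or> a = - b" using a by auto
  obtain us vs where zs': "zs = (us @ [b]) @ vs" using b(1) by (metis split_list append.assoc append_Cons append_Nil)
  define rs where "rs = vs @ map uminus (us @ [b])"
  have rs: "signed_list N rs" "length rs = length zs" "abs ` set rs = abs ` set zs" "rs \<noteq> []" "last rs = - b"
    using zs unfolding zs' rs_def by (auto simp: image_image image_Un)
  have eq: "ncyc rs = ncyc zs"
    unfolding rs_def zs' by (rule ncyc_rotate_append[of N, symmetric]) (use zs zs' in simp)
  show ?thesis
  proof (cases "a = - b")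
    case True
    then show ?thesis using rs eq by blast
  next
    case False
    then have "last (map uminus rs) = a" using b rs by (simp add: last_map)
    moreover have "ncyc (map uminus rs) = ncyc zs" using ncyc_uminus[OF rs(1)] eq by simp
    ultimately show ?thesis using rs
      by (intro exI[of _ "map uminus rs"]) (simp add: image_image)
  qed
qed

text \<open>
  Strip at the first point \<open>k\<close> of the first cycle. The linked points fall into four kinds: \<open>- k\<close> makes the first
  cycle positive; an entry of \<open>ys\<close> cuts off a positive cycle and leaves \<open>k\<close> on a negative one; the
  negative of an entry of \<open>ys\<close> does the reverse; and each of the \<open>2 * length zs\<close> signed entries of the
  second cycle joins the two cycles. Positive cycles are removed with \<open>mu_comp_cyc\<close>.
\<close>

lemma mu_ncyc_step:
  assumes sl: "signed_list N (k # ys @ zs)"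
    and IH: "\<And>xs' zs'. length xs' + length zs' < length (k # ys) + length zs \<Longrightarrow>
      signed_list N (xs' @ zs') \<Longrightarrow> mu N (ncyc xs' \<circ> ncyc zs') = annulus_mu (length xs') (length zs')"
  shows "mu N (ncyc (k # ys) \<circ> ncyc zs) = annulus_mu (Suc (length ys)) (length zs)"
proof -
  let ?w = "ncyc (k # ys) \<circ> ncyc zs" and ?m = "length ys" and ?q = "length zs"
  let ?F = "\<lambda>a. mu N (?w \<circ> srefl a k)"
  have sly: "signed_list N (k # ys)" and slz: "signed_list N zs" using sl by auto
  have k: "k \<in> pm_set N" and k0: "k \<noteq> 0" using sl pm_set_nonzero by auto
  have zH: "ncyc zs \<in> hyperoctahedral N" by (rule ncyc_in_hyperoctahedral[OF signed_listD(1)[OF slz]])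
  have yH: "ncyc (k # ys) \<in> hyperoctahedral N" by (rule ncyc_in_hyperoctahedral[OF signed_listD(1)[OF sly]])
  have w: "?w \<in> hyperoctahedral N" using zH yH by blast
  have zfix: "ncyc zs i = i" if "\<bar>i\<bar> \<in> abs ` set (k # ys)" for i
    by (rule ncyc_fix) (use that sl in auto)
  have comm: "?w \<circ> srefl a k = (ncyc (k # ys) \<circ> srefl a k) \<circ> ncyc zs" if a: "\<bar>a\<bar> \<in> abs ` set (k # ys)" for a
  proof -
    have "a \<noteq> 0" using a signed_list_nz[OF sly] by auto
    then have "ncyc zs \<circ> srefl a k = srefl a k \<circ> ncyc zs"
      using zfix[OF a] zfix[of k] k0 by (intro srefl_commute_fix[OF zH]) auto
    then show ?thesis by (metis comp_assoc)
  qed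
  have F_neg: "?F (- k) = cyc_mu (Suc ?m) * annulus_mu 0 ?q"
  proof -
    have "?w \<circ> srefl (- k) k = cyc (k # map uminus ys) \<circ> ncyc zs"
      using comm[of "- k"] ncyc_comp_neg[OF sly] by simp
    also have "\<dots> = ncyc zs \<circ> cyc (k # map uminus ys)"
      by (rule cyc_commute[OF zH, symmetric])
        (use sl zfix in \<open>auto simp: image_image dest: signed_list_set\<close>)
    finally have "?F (- k) = mu N (ncyc zs \<circ> cyc (k # map uminus ys))" by (rule arg_cong)
    also have "\<dots> = cyc_mu (length (k # map uminus ys)) * mu N (ncyc zs)"
      by (rule mu_comp_cyc[OF zH]) (use sl zfix in \<open>auto simp: image_image\<close>)
    also have "mu N (ncyc zs) = annulus_mu 0 ?q"
      using IH[of "[]" zs] slz by (simp add: ncyc_def)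
    finally show ?thesis by (simp only: length_Cons length_map)
  qed
  have F_pos: "?F (ys ! i) = cyc_mu (Suc i) * annulus_mu (?m - i) ?q"
    and F_neg_pos: "?F (- ys ! i) = cyc_mu (?m - i) * annulus_mu (Suc i) ?q" if i: "i < ?m" for i
  proof -
    define T where "T = take (Suc i) ys"
    define D where "D = drop (Suc i) ys"
    have ys: "ys = T @ D" and T: "T \<noteq> []" "last T = ys ! i"
      using take_drop_split[OF i] by (simp_all add: T_def D_def)
    have len: "length T = Suc i" "length (k # D) = ?m - i" using i by (simp_all add: T_def D_def)
    have slTD: "signed_list N (k # T @ D)" using sl ys by auto
    have mem: "\<bar>ys ! i\<bar> \<in> abs ` set (k # ys)" "\<bar>- ys ! i\<bar> \<in> abs ` set (k # ys)"
      using i by auto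
    have sub: "set T \<subseteq> pm_set N" "set (k # map uminus D) \<subseteq> pm_set N" "set (k # D) \<subseteq> pm_set N"
      using sl ys signed_list_set by auto
    have H: "ncyc (k # D) \<circ> ncyc zs \<in> hyperoctahedral N" "ncyc T \<circ> ncyc zs \<in> hyperoctahedral N"
      using ncyc_in_hyperoctahedral sub zH by blast+
    have slT: "signed_list N (T @ (k # D) @ zs)" and slD: "signed_list N ((k # map uminus D) @ T @ zs)"
      using sl ys by (auto simp: image_image)
    have fixT: "ncyc (k # D) j = j" "ncyc zs j = j" if "j \<in> set T" for j
      using signed_list_append_abs[OF slT that] unfolding set_append image_Un
      by (auto intro!: ncyc_fix simp del: list.set)
    have fixD: "ncyc T j = j" "ncyc zs j = j" if "j \<in> set (k # map uminus D)" for j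
      using signed_list_append_abs[OF slD that] unfolding set_append image_Un
      by (auto intro!: ncyc_fix simp del: list.set)
    have "?w \<circ> srefl (ys ! i) k = cyc T \<circ> (ncyc (k # D) \<circ> ncyc zs)"
      using comm[OF mem(1)] ncyc_split[OF slTD T(1)] T(2) ys by (simp add: o_assoc)
    also have "\<dots> = (ncyc (k # D) \<circ> ncyc zs) \<circ> cyc T"
      by (rule cyc_commute[OF H(1) sub(1), symmetric]) (simp add: fixT)
    finally have "?F (ys ! i) = mu N ((ncyc (k # D) \<circ> ncyc zs) \<circ> cyc T)" by (rule arg_cong)
    also have "\<dots> = cyc_mu (length T) * mu N (ncyc (k # D) \<circ> ncyc zs)"
      by (rule mu_comp_cyc[OF H(1)]) (use slTD fixT in auto)
    also have "mu N (ncyc (k # D) \<circ> ncyc zs) = annulus_mu (length (k # D)) ?q"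
      by (rule IH) (use len i sl ys in auto)
    finally show "?F (ys ! i) = cyc_mu (Suc i) * annulus_mu (?m - i) ?q" unfolding len .
    have "?w \<circ> srefl (- ys ! i) k = ncyc T \<circ> (cyc (k # map uminus D) \<circ> ncyc zs)"
      using comm[OF mem(2)] ncyc_split_neg[OF slTD T(1)] T(2) ys by (simp add: o_assoc)
    also have "cyc (k # map uminus D) \<circ> ncyc zs = ncyc zs \<circ> cyc (k # map uminus D)"
      by (rule cyc_commute[OF zH sub(2), symmetric]) (rule fixD)
    finally have "?F (- ys ! i) = mu N (ncyc T \<circ> (ncyc zs \<circ> cyc (k # map uminus D)))"
      by (rule arg_cong)
    also have "ncyc T \<circ> (ncyc zs \<circ> cyc (k # map uminus D)) = (ncyc T \<circ> ncyc zs) \<circ> cyc (k # map uminus D)"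
      by (rule o_assoc)
    also have "mu N ((ncyc T \<circ> ncyc zs) \<circ> cyc (k # map uminus D))
        = cyc_mu (length (k # map uminus D)) * mu N (ncyc T \<circ> ncyc zs)"
      by (rule mu_comp_cyc[OF H(2)]) (use slTD fixD in \<open>auto simp: image_image\<close>)
    also have "mu N (ncyc T \<circ> ncyc zs) = annulus_mu (length T) ?q"
      by (rule IH) (use len i sl ys in auto)
    finally show "?F (- ys ! i) = cyc_mu (?m - i) * annulus_mu (Suc i) ?q" using len by (simp only: length_Cons length_map)
  qed
  have F_join: "?F a = cyc_mu (Suc ?m + ?q)" if a: "a \<in> set zs \<union> uminus ` set zs" for a
  proof -
    obtain zs' where z: "signed_list N zs'" "length zs' = ?q" "abs ` set zs' = abs ` set zs"
      "zs' \<noteq> []" "last zs' = a" "ncyc zs' = ncyc zs"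
      using ncyc_end_with[OF slz a] by blast
    have "signed_list N (k # ys @ zs')" using sl z(1,3) by (auto simp: image_Un)
    then have "?w \<circ> srefl a k = cyc (ys @ - k # zs')" "signed_list N (ys @ - k # zs')"
      using ncyc_join[of N k ys zs'] z by (auto simp: image_Un)
    then show ?thesis using mu_cyc[of N "ys @ - k # zs'"] z(2) by simp
  qed
  have moved: "?w k \<noteq> k"
  proof (cases "ys = []")
    case True
    then have "?w k = - k" using zfix[of k] ncyc_last[OF sly] by simp
    then show ?thesis using k0 by simp
  next
    case False
    then have "?w k = ys ! 0" "ys ! 0 \<in> set ys" using zfix[of k] ncyc_nth[OF sly, of 0] by simp_all
    moreover have "k \<notin> set ys" using signed_listD(2)[OF sly] by simp
    ultimately show ?thesis by metis
  qed
  have signed_ys: "signed_list N ys" using sly by simp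
  have dist: "distinct ys" "distinct zs" using signed_listD(2) sly slz by auto
  have no_neg: "set us \<inter> uminus ` set us = {}" if "signed_list N us" for us
  proof -
    have inj: "inj_on abs (set us)" and z: "0 \<notin> set us"
      using that signed_list_nz[OF that] by (auto simp: signed_list_def distinct_map)
    have False if a: "a \<in> set us" and b: "b \<in> set us" and ab: "a = - b" for a b
    proof -
      have "a = b" by (rule inj_onD[OF inj _ a b]) (simp add: ab)
      then show False using ab a z by auto
    qed
    then show ?thesis by blast
  qed
  have "k \<notin> set ys \<union> set zs" "- k \<notin> set ys \<union> set zs"
    using sl not_in_abs_imageD[of k "set ys \<union> set zs" k]
      not_in_abs_imageD[of k "set ys \<union> set zs" "- k"] by auto
  then have d1: "- k \<notin> set ys \<union> uminus ` set ys \<union> (set zs \<union> uminus ` set zs)" by auto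
  have "abs ` set ys \<inter> abs ` set zs = {}" using sl by simp
  then have d2: "(set ys \<union> uminus ` set ys) \<inter> (set zs \<union> uminus ` set zs) = {}"
    using abs_in_image_iff[of _ "set ys"] abs_in_image_iff[of _ "set zs"] by blast
  have split: "(\<Sum>a\<in>insert (- k) (set ys \<union> uminus ` set ys \<union> (set zs \<union> uminus ` set zs)). ?F a)
    = ?F (- k) + ((\<Sum>a\<in>set ys. ?F a) + (\<Sum>a\<in>uminus ` set ys. ?F a)
      + (\<Sum>a\<in>set zs \<union> uminus ` set zs. ?F a))"
    using d1 d2 no_neg[OF signed_ys] by (subst sum.insert) (auto simp: sum.union_disjoint)
  have S1: "(\<Sum>a\<in>set ys. ?F a) = (\<Sum>i<?m. cyc_mu (Suc i) * annulus_mu (?m - i) ?q)"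
    unfolding sum_set_eq_sum_nth[OF dist(1)] by (rule sum.cong) (simp_all only: F_pos lessThan_iff)
  have "(\<Sum>a\<in>uminus ` set ys. ?F a) = (\<Sum>a\<in>set ys. ?F (- a))"
    by (subst sum.reindex) (simp_all add: inj_on_def)
  also have "\<dots> = (\<Sum>i<?m. cyc_mu (?m - i) * annulus_mu (Suc i) ?q)"
    unfolding sum_set_eq_sum_nth[OF dist(1)] by (rule sum.cong) (simp_all only: F_neg_pos lessThan_iff)
  finally have S2: "(\<Sum>a\<in>uminus ` set ys. ?F a) = (\<Sum>i<?m. cyc_mu (?m - i) * annulus_mu (Suc i) ?q)" .
  have "card (set zs \<union> uminus ` set zs) = 2 * ?q"
    using no_neg[OF slz] dist(2) by (subst card_Un_disjoint) (simp_all add: card_image inj_on_def distinct_card)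
  then have S3: "(\<Sum>a\<in>set zs \<union> uminus ` set zs. ?F a) = 2 * int ?q * cyc_mu (Suc ?m + ?q)"
    using F_join by simp
  have "(\<Sum>a\<in>insert (- k) (set ys \<union> uminus ` set ys \<union> (set zs \<union> uminus ` set zs)). ?F a)
    = - annulus_mu (Suc ?m) ?q"
    using annulus_mu_rec[of ?m ?q] unfolding split S1 S2 S3 F_neg by linarith
  with mu_strip[OF k w moved, unfolded linked_ncyc[OF sl]] show ?thesis
    by (simp only: minus_minus)
qed

text \<open>
  When the first list is empty, the two commuting cycles are exchanged, so that the recursion can go on at a point
  of the remaining cycle.
\<close>

lemma mu_ncyc_ncyc:
  "signed_list N (xs @ zs) \<Longrightarrow> mu N (ncyc xs \<circ> ncyc zs) = annulus_mu (length xs) (length zs)"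
proof (induction "length xs + length zs" arbitrary: xs zs rule: less_induct)
  case less
  show ?case
  proof (cases xs)
    case (Cons k ys)
    then show ?thesis using mu_ncyc_step[of N k ys zs] less by simp
  next
    case Nil
    show ?thesis
    proof (cases zs)
      case Nil
      then show ?thesis using \<open>xs = []\<close>
        by (simp add: ncyc_def annulus_mu_def annulus_count_0 disc_count_def)
    next
      case (Cons k ys)
      then have "mu N (ncyc (k # ys) \<circ> ncyc []) = annulus_mu (Suc (length ys)) 0"
        using mu_ncyc_step[of N k ys "[]"] less \<open>xs = []\<close> by simp
      then show ?thesis using Cons \<open>xs = []\<close>
        by (simp add: ncyc_def annulus_mu_def annulus_count_0)
    qed
  qed
qed

section \<open>The element with two negative cycles\<close>

lemma comp_transpose: "inj f \<Longrightarrow> f \<circ> transpose a b = transpose (f a) (f b) \<circ> f"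
  by (auto simp: fun_eq_iff transpose_def dest: injD)

lemma inj_cycle_of_list: "inj (cycle_of_list cs)"
  using cycle_permutes permutes_inj by blast

lemma cycle_of_list_append:
  "cycle_of_list (xs @ a # zs) = cycle_of_list (xs @ [a]) \<circ> cycle_of_list (a # zs)"
proof (induction xs rule: cycle_of_list.induct)
  case ("2_2" x)
  then show ?case by simp
qed (simp_all add: o_assoc)

lemma cycle_of_list_last:
  "distinct xs \<Longrightarrow> xs \<noteq> [] \<Longrightarrow> cycle_of_list xs (last xs) = hd xs"
  by (induction xs rule: cycle_of_list.induct) auto

text \<open>
  Separate the entries from their negatives; transpositions of negatives commute with the cycle of the entries.
\<close>

lemma cyc_eq_cycle_of_list:
  "signed_list N xs \<Longrightarrow> cyc xs = cycle_of_list xs \<circ> cycle_of_list (map uminus xs)"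
proof (induction xs rule: cyc.induct)
  case (1 x y zs)
  let ?C = "cycle_of_list (y # zs)" and ?C' = "cycle_of_list (map uminus (y # zs))"
  have nz: "x \<noteq> 0" "y \<noteq> 0" "x \<noteq> y" "x \<noteq> - y" using 1 pm_set_nonzero by auto
  have n: "- x \<notin> set (y # zs)" "- y \<notin> set (y # zs)"
    using 1 nz not_in_abs_imageD[of x "set zs" "- x"] not_in_abs_imageD[of y "set zs" "- y"] by auto
  have C: "?C (- x) = - x" "?C (- y) = - y"
    by (rule id_outside_supp[OF n(1)], rule id_outside_supp[OF n(2)])
  have "cyc (x # y # zs) = srefl x y \<circ> cyc (y # zs)" by simp
  also have "cyc (y # zs) = ?C \<circ> ?C'" by (rule "1.IH") (use 1 in simp)
  also have "srefl x y \<circ> (?C \<circ> ?C') = transpose x y \<circ> (transpose (- x) (- y) \<circ> ?C) \<circ> ?C'"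
    unfolding transpose_comp_eq_srefl[OF nz, symmetric] by (simp only: o_assoc)
  also have "transpose (- x) (- y) \<circ> ?C = ?C \<circ> transpose (- x) (- y)"
    using comp_transpose[OF inj_cycle_of_list, of "y # zs" "- x" "- y"] C by simp
  finally show ?case by (simp add: o_assoc)
qed simp_all

lemma ncyc_eq_cycle_of_list:
  assumes xs: "signed_list N xs" and ne: "xs \<noteq> []"
  shows "cycle_of_list (xs @ map uminus xs) = ncyc xs"
proof -
  obtain ws l where ws: "xs = ws @ [l]" using ne by (metis append_butlast_last_id)
  obtain k ys where ys: "xs = k # ys" using ne by (cases xs) auto
  let ?C = "cycle_of_list xs" and ?C' = "cycle_of_list (map uminus xs)"
  have l: "l \<noteq> 0" "l \<in> set xs" using xs ws pm_set_nonzero by auto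
  have "l \<notin> set (map uminus xs)"
  proof
    assume "l \<in> set (map uminus xs)"
    then have "- l \<in> set xs" by auto
    then have "- l \<in> set ws" using ws l by auto
    then show False using not_in_abs_imageD[of l "set ws" "- l"] xs ws by auto
  qed
  then have C1: "?C' l = l" by (rule id_outside_supp)
  have "?C' (last (map uminus xs)) = hd (map uminus xs)"
    by (rule cycle_of_list_last) (use signed_listD(2)[of N "map uminus xs"] xs ne in auto)
  moreover have "last (map uminus xs) = - l" by (simp add: ws)
  moreover have "hd (map uminus xs) = - k" by (simp add: ys)
  ultimately have C2: "?C' (- l) = - k" by (simp only:)
  have "cycle_of_list (xs @ map uminus xs) = cycle_of_list (xs @ [- k]) \<circ> ?C'"
    using cycle_of_list_append[of xs "- k" "map uminus ys"] by (simp add: ys)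
  also have "cycle_of_list (xs @ [- k]) = ?C \<circ> transpose l (- k)"
    using cycle_of_list_append[of ws l "[- k]"] by (simp add: ws)
  also have "?C \<circ> transpose l (- k) \<circ> ?C' = ?C \<circ> ?C' \<circ> transpose l (- l)"
    using comp_transpose[OF inj_cycle_of_list, of "map uminus xs" l "- l"] C1 C2 by (metis comp_assoc)
  also have "\<dots> = ncyc xs"
    using cyc_eq_cycle_of_list[OF xs] transpose_eq_srefl[OF l(1)] ne ws by (simp add: ncyc_def)
  finally show ?thesis .
qed

lemma abs_image_upto: "1 \<le> i \<Longrightarrow> abs ` set [i..j] = {i..j}"
  by (auto simp: image_iff intro!: bexI)

lemma signed_list_upto: "1 \<le> i \<Longrightarrow> j \<le> int N \<Longrightarrow> signed_list N [i..j]"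
  unfolding signed_list_def by (auto simp: pm_set_def distinct_map inj_on_def)

lemma signed_list_gamma: "signed_list (p + q) ([1..int p] @ [int p + 1..int p + int q])"
  by (simp add: signed_list_upto abs_image_upto del: set_upto)

lemma gamma_B_eq_ncyc:
  assumes "p \<ge> 1" "q \<ge> 1"
  shows "gamma_B p q = ncyc [1..int p] \<circ> ncyc [int p + 1..int p + int q]"
  unfolding gamma_B_def
  using ncyc_eq_cycle_of_list[of "p + q" "[1..int p]"]
    ncyc_eq_cycle_of_list[of "p + q" "[int p + 1..int p + int q]"] signed_list_gamma[of p q] assms
  by simp

lemma Orb_merged_id: "Orb_merged N id = zero_B N"
proof -
  have orb: "orbit id i = {i}" for i :: int by (simp add: orbit_eq_singleton_iff)
  then have "Orb N id = zero_B N" by (simp add: Orb_def zero_B_def)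
  moreover have "inv_blocks (zero_B N) = {}"
    by (auto simp: inv_blocks_def zero_B_def pm_set_def)
  ultimately show ?thesis by (simp add: Orb_merged_def)
qed

text \<open>
  Every point is linked to 1, so the two inversion-invariant orbits merge to the only block.
\<close>

lemma Orb_merged_gamma_B:
  assumes "p \<ge> 1" "q \<ge> 1"
  shows "Orb_merged (p + q) (gamma_B p q) = one_B (p + q)"
proof -
  let ?N = "p + q" and ?xs = "[1..int p]" and ?zs = "[int p + 1..int p + int q]"
  let ?g = "gamma_B p q"
  have sl: "signed_list ?N (1 # [2..int p] @ ?zs)" and xs: "?xs = 1 # [2..int p]"
    using signed_list_gamma[of p q] assms upto_rec1[of 1 "int p"] by simp_all
  have H: "?g \<in> hyperoctahedral ?N"
    unfolding gamma_B_eq_ncyc[OF assms]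
    using signed_list_gamma[of p q] by (intro comp_in_hyperoctahedral ncyc_in_hyperoctahedral signed_listD(1)) auto
  have one: "1 \<in> pm_set ?N" using assms by (simp add: pm_set_def)
  have "linked ?N ?g j 1" if j: "j \<in> pm_set ?N" for j
  proof (cases "j = 1")
    case False
    have "j \<in> insert (- 1) (set [2..int p] \<union> uminus ` set [2..int p] \<union> (set ?zs \<union> uminus ` set ?zs))"
      using j False by (auto simp: pm_set_def image_iff)
    then show ?thesis
      unfolding gamma_B_eq_ncyc[OF assms] xs linked_ncyc[OF sl, symmetric] by simp
  qed (simp add: linked_def)
  then have all: "\<exists>X\<in>Orb_merged ?N ?g. j \<in> X \<and> 1 \<in> X" if "j \<in> pm_set ?N" for j
    using Orb_merged_linked[OF H that one] that by simp
  have P: "partition_on (pm_set ?N) (Orb_merged ?N ?g)"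
    using partition_on_Orb_merged[OF hyperoctahedralD(1)[OF H]] .
  obtain X where X: "X \<in> Orb_merged ?N ?g" "1 \<in> X" using all[OF one] by blast
  have uniq: "Y = X" if "Y \<in> Orb_merged ?N ?g" "1 \<in> Y" for Y
    using P X that unfolding partition_on_def disjoint_def by blast
  have "pm_set ?N \<subseteq> X" using all uniq by blast
  moreover have "X \<subseteq> pm_set ?N" using P X(1) by (auto simp: partition_on_def)
  ultimately have XN: "X = pm_set ?N" by blast
  have "Y = X" if Y: "Y \<in> Orb_merged ?N ?g" for Y
  proof -
    have "Y \<noteq> {}" "Y \<subseteq> pm_set ?N" using P Y by (auto simp: partition_on_def)
    then obtain j where "j \<in> Y" "j \<in> X" using XN by blast
    then show ?thesis using P X(1) Y unfolding partition_on_def disjoint_def by blast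
  qed
  then have "Orb_merged ?N ?g = {X}" using X(1) by blast
  then show ?thesis by (simp only: one_B_def XN)
qed

theorem corollary5p4:
  fixes p q :: nat
  assumes "p \<ge> 1" and "q \<ge> 1"
  shows "moebius (NC_B p q) (NC_B_rel p q) (zero_B (p + q)) (one_B (p + q)) =
    (- 1) ^ (p + q) *
      (int ((2 * p - 1) choose p) * int ((2 * q - 1) choose q)
       + (\<Sum>c = 1..p. 2 * int c * int ((2 * p - c - 1) choose (p - 1))
                                * int ((2 * q + c - 1) choose (q - 1))))"
proof -
  have H: "gamma_B p q \<in> hyperoctahedral (p + q)"
    unfolding gamma_B_eq_ncyc[OF assms]
    using signed_list_gamma[of p q] by (intro comp_in_hyperoctahedral ncyc_in_hyperoctahedral signed_listD(1)) auto
  have "moebius (NC_B p q) (NC_B_rel p q) (zero_B (p + q)) (one_B (p + q)) = mu (p + q) (gamma_B p q)"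
    using moebius_NC_B_eq_mu[OF H] by (simp add: Orb_merged_id Orb_merged_gamma_B[OF assms])
  also have "\<dots> = annulus_mu p q"
    using mu_ncyc_ncyc[OF signed_list_gamma[of p q]] by (simp add: gamma_B_eq_ncyc[OF assms])
  also have "\<dots> = (- 1) ^ (p + q) * (disc_count p * disc_count q + 2 * annulus_sum p q)"
    by (simp add: annulus_mu_def annulus_count_def join_count_eq[OF assms(2)])
  also have "2 * annulus_sum p q = (\<Sum>c = 1..p. 2 * int c * int ((2 * p - c - 1) choose (p - 1))
                                * int ((2 * q + c - 1) choose (q - 1)))"
    by (simp add: annulus_sum_def sum_distrib_left mult.assoc)
  finally show ?thesis using assms by (simp add: disc_count_def)
qed

end
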